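(* Let $\mu\in\mathbb{R}$ and let $\Phi(\lambda)=\lambda^\alpha$ for some $\alpha\in(0,1)$. For every $s>1$ there exists a function $f\in H^s(\mathbb{S}^2)$ such that for all $t>0$ and all $\varepsilon>0$ the strong solution $u$ of $$\frac{d^{\Phi}u}{dt^{\Phi}}(t)=\mathcal{G}_\mu u(t)\quad (t>0),\qquad u(0)=f,$$ satisfies $u(t)\notin H^{s+2+\varepsilon}(\mathbb{S}^2)$.
   Context: Sphere. $\mathbb{S}^2\subset\mathbb{R}^3$ is the unit sphere with the round metric $g$, surface measure $\sigma$ and spherical coordinates $(\sin\theta\cos\varphi,\sin\theta\sin\varphi,\cos\theta)$, $\theta\in[0,\pi]$, $\varphi\in[0,2\pi)$. Functions are complex-valued. $\Delta_g$ is the Laplace–Beltrami operator, $X_\mu$ is the smooth vector field equal to $\mu\,\partial/\partial\varphi$ in spherical coordinates (and zero at the poles), and $\mathcal{G}_\mu=\Delta_g+X_\mu$. The spherical harmonics are $Y_{\ell,m}(\theta,\varphi)=\sqrt{\frac{(2\ell+1)(\ell-m)!}{4\pi(\ell+m)!}}P_\ell^m(\cos\theta)e^{im\varphi}$, $\ell=0,1,\dots$, $m=-\ell,\dots,\ell$, with $P_\ell^m(x)=\frac{(-1)^m}{2^\ell\ell!}(1-x^2)^{m/2}\frac{d^{\ell+m}}{dx^{\ell+m}}(x^2-1)^\ell$; they form an orthonormal basis of $L^2(\mathbb{S}^2,\sigma)$ and $\mathcal{G}_\mu Y_{\ell,m}=(i\mu m-\ell(\ell+1))Y_{\ell,m}$.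 The Fourier–Laplace coefficients of $f\in L^2(\mathbb{S}^2)$ are $f_{\ell,m}=\int_{\mathbb{S}^2}f\,\overline{Y}_{\ell,m}\,d\sigma$, and $A_\ell(f)=\sum_{m=-\ell}^{\ell}|f_{\ell,m}|^2$. For $s\ge0$, $H^s(\mathbb{S}^2)$ is the set of $f\in L^2(\mathbb{S}^2)$ with $[f]_{H^s}^2:=\sum_{\ell\ge0}\ell^{2s}A_\ell(f)<\infty$, with norm $\|f\|_{L^2}+[f]_{H^s}$. For $u\in H^2(\mathbb{S}^2)$, $\mathcal{G}_\mu u=\sum_{\ell,m}(i\mu m-\ell(\ell+1))u_{\ell,m}Y_{\ell,m}$. Nonlocal derivative. For $\Phi(\lambda)=\lambda^\alpha=\int_0^\infty(1-e^{-\lambda t})\nu_\Phi(dt)$, let $\overline{\nu}_\Phi(t)=\nu_\Phi(t,+\infty)=t^{-\alpha}/\Gamma(1-\alpha)$. For a Banach space $\mathfrak{B}$ and $u:[0,\infty)\to\mathfrak{B}$, $\frac{d^{\Phi}u}{dt^{\Phi}}(t)=\frac{d}{dt}\int_0^t\overline{\nu}_\Phi(t-\tau)(u(\tau)-u(0^+))\,d\tau$, $t>0$ (Bochner integral; derivative as a strong limit in $\mathfrak{B}$). Strong solution. For $f\in H^s(\mathbb{S}^2)$, $s>1$, the strong solution is the unique $u\in C([0,\infty);H^s(\mathbb{S}^2))\cap C((0,\infty);H^{s+2}(\mathbb{S}^2))$ such that $\frac{d^{\Phi}u}{dt^{\Phi}}(t)$ is well-defined in $H^s(\mathbb{S}^2)$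 for all $t>0$, $\frac{d^{\Phi}u}{dt^{\Phi}}\in C((0,\infty);H^s(\mathbb{S}^2))$, and $u$ satisfies the two equalities of the Cauchy problem. *)

theory Defs
  imports "HOL-Analysis.Analysis"
begin

section \<open>The unit sphere and its surface measure\<close>

abbreviation S2 :: "(real ^ 3) set" where
  "S2 \<equiv> sphere 0 1"

definition sph_coord :: "real \<times> real \<Rightarrow> real ^ 3" where
  "sph_coord = (\<lambda>(\<theta>, \<phi>). vector [sin \<theta> * cos \<phi>, sin \<theta> * sin \<phi>, cos \<theta>])"

text \<open>In spherical coordinates the round metric is
  \<open>d\<theta>\<^sup>2 + sin\<^sup>2 \<theta> d\<phi>\<^sup>2\<close>, with volume density \<open>sin \<theta>\<close>.\<close>

definition sph_measure :: "(real ^ 3) measure" where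
  "sph_measure =
     distr (density (restrict_space lborel ({0..pi} \<times> {0..<2 * pi})) (\<lambda>(\<theta>, \<phi>). ennreal (sin \<theta>)))
       (restrict_space borel S2) sph_coord"

lemma space_sph_measure [simp]: "space sph_measure = S2"
  by (simp add: sph_measure_def space_restrict_space)

lemma sets_sph_measure [simp, measurable_cong]: "sets sph_measure = sets (restrict_space borel S2)"
  by (simp add: sph_measure_def)

lemma norm_sph_coord: "norm (sph_coord p) = 1"
proof -
  obtain a b where p: "p = (a, b)" by (cases p)
  have "(sin a * cos b)\<^sup>2 + (sin a * sin b)\<^sup>2 + (cos a)\<^sup>2
      = (sin a)\<^sup>2 * ((cos b)\<^sup>2 + (sin b)\<^sup>2) + (cos a)\<^sup>2"
    by (simp only: power_mult_distrib distrib_left)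
  also have "\<dots> = 1" by simp
  finally show ?thesis
    unfolding p by (simp add: sph_coord_def norm_vec_def L2_set_def sum_3 vector_3)
qed

lemma borel_measurable_sph_coord: "sph_coord \<in> borel_measurable borel"
proof -
  have eq: "sph_coord = (\<lambda>p. (sin (fst p) * cos (snd p)) *\<^sub>R axis 1 1
      + (sin (fst p) * sin (snd p)) *\<^sub>R axis 2 1 + cos (fst p) *\<^sub>R axis 3 1)"
    by (auto simp: fun_eq_iff sph_coord_def vec_eq_iff forall_3 axis_def)
  show ?thesis
    unfolding eq by (intro borel_measurable_continuous_onI continuous_intros)
qed

lemma measurable_sph_coord:
  "sph_coord \<in> measurable (density (restrict_space lborel ({0..pi} \<times> {0..<2 * pi}))
     (\<lambda>(\<theta>, \<phi>). ennreal (sin \<theta>))) (restrict_space borel S2)"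
proof -
  have "sph_coord \<in> measurable (restrict_space lborel ({0..pi} \<times> {0..<2 * pi})) (restrict_space borel S2)"
    using borel_measurable_sph_coord
    by (intro measurable_restrict_space2 measurable_restrict_space1) (auto simp: norm_sph_coord)
  then show ?thesis by simp
qed

lemma finite_measure_sph: "finite_measure sph_measure"
proof (rule finite_measureI)
  let ?R = "restrict_space lborel ({0..pi} \<times> {0..<2 * pi}) :: (real \<times> real) measure"
  have sets: "{0..pi} \<times> {0..<2 * pi} \<in> sets (lborel :: (real \<times> real) measure)"
    unfolding sets_lborel borel_prod[symmetric] by (rule pair_measureI) auto
  have m: "(\<lambda>(\<theta>, \<phi>). ennreal (sin \<theta>)) \<in> borel_measurable ?R"
    by (intro measurable_restrict_space1)
      (auto simp: split_beta intro!: borel_measurable_continuous_onI continuous_on_ennreal continuous_intros)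
  have "emeasure sph_measure (space sph_measure)
      = emeasure (density ?R (\<lambda>(\<theta>, \<phi>). ennreal (sin \<theta>))) (space ?R)"
    unfolding space_sph_measure using measurable_space[OF measurable_sph_coord]
    by (subst sph_measure_def, subst emeasure_distr[OF measurable_sph_coord])
      (auto simp: space_restrict_space sets_restrict_space norm_sph_coord intro!: arg_cong2[of _ _ _ _ emeasure])
  also have "\<dots> = (\<integral>\<^sup>+p. (case p of (\<theta>, \<phi>) \<Rightarrow> ennreal (sin \<theta>)) * indicator (space ?R) p \<partial>?R)"
    by (rule emeasure_density[OF m]) simp
  also have "\<dots> \<le> (\<integral>\<^sup>+p. indicator (space ?R) p \<partial>?R)"
    by (intro nn_integral_mono) (auto split: split_indicator simp: ennreal_le_1)
  also have "\<dots> = emeasure ?R (space ?R)"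
    by simp
  also have "\<dots> = emeasure lborel (({0..pi} \<times> {0..<2 * pi}) :: (real \<times> real) set)"
    using sets by (simp add: space_restrict_space emeasure_restrict_space del: sets_lborel)
  also have "\<dots> = emeasure lborel {0..pi} * emeasure lborel {0..<2 * pi}"
    unfolding lborel_prod[symmetric] by (rule lborel.emeasure_pair_measure_Times) auto
  also have "\<dots> < \<infinity>"
    by (simp add: ennreal_mult[symmetric])
  finally show "emeasure sph_measure (space sph_measure) \<noteq> \<infinity>" by auto
qed

interpretation sph: finite_measure sph_measure
  by (rule finite_measure_sph)


section \<open>Spherical harmonics\<close>

text \<open>The factor \<open>(1 - x\<^sup>2)\<^sup>m\<^sup>/\<^sup>2\<close> is written as an integer power of
  \<open>sqrt (1 - x\<^sup>2)\<close>, so that it equals 1 for \<open>m = 0\<close> also at \<open>x = 1, -1\<close>.\<close>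

definition assoc_legendre :: "nat \<Rightarrow> int \<Rightarrow> real \<Rightarrow> real" where
  "assoc_legendre l m x =
     (-1) powi m / (2 ^ l * fact l) * sqrt (1 - x\<^sup>2) powi m
       * (deriv ^^ nat (int l + m)) (\<lambda>y. (y\<^sup>2 - 1) ^ l) x"

definition sph_harm_coord :: "nat \<Rightarrow> int \<Rightarrow> real \<Rightarrow> real \<Rightarrow> complex" where
  "sph_harm_coord l m \<theta> \<phi> =
     complex_of_real (sqrt ((2 * real l + 1) * fact (nat (int l - m)) / (4 * pi * fact (nat (int l + m))))
       * assoc_legendre l m (cos \<theta>)) * cis (real_of_int m * \<phi>)"

text \<open>The azimuth is irrelevant at the poles (for \<open>m \<noteq> 0\<close> the function vanishes there).
  Outside the index range \<open>-l \<le> m \<le> l\<close> the function is set to 0.\<close>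

definition sph_harm :: "nat \<Rightarrow> int \<Rightarrow> real ^ 3 \<Rightarrow> complex" where
  "sph_harm l m x =
     (if \<bar>m\<bar> \<le> int l then sph_harm_coord l m (arccos (x $ 3)) (Arg2pi (Complex (x $ 1) (x $ 2))) else 0)"

lemma deriv_funpow_poly: "(deriv ^^ n) (poly p) = poly ((pderiv ^^ n) p)" for p :: "real poly"
proof (induction n)
  case (Suc n)
  have "deriv (poly q) = poly (pderiv q)" for q :: "real poly"
    by (rule ext) (rule DERIV_imp_deriv, rule poly_DERIV)
  with Suc show ?case by simp
qed simp

lemma power_dvd_pderiv_funpow:
  fixes p :: "real poly"
  assumes "n \<le> l"
  shows "p ^ (l - n) dvd (pderiv ^^ n) (p ^ l)"
  using assms
proof (induction n)
  case (Suc n)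
  then obtain r where r: "(pderiv ^^ n) (p ^ l) = p ^ (l - n) * r"
    by (auto simp: dvd_def)
  from Suc.prems have l: "l - n = Suc (l - Suc n)" by simp
  have "(pderiv ^^ Suc n) (p ^ l) = pderiv (p ^ (l - n) * r)"
    using r by simp
  also have "\<dots> = p ^ (l - Suc n) * (p * pderiv r + smult (of_nat (l - n)) (pderiv p * r))"
    unfolding l pderiv_mult pderiv_power_Suc by (simp add: algebra_simps)
  finally show ?case by simp
qed simp

lemma assoc_legendre_poly:
  "assoc_legendre l m x =
     (-1) powi m / (2 ^ l * fact l) * sqrt (1 - x\<^sup>2) powi m
       * poly ((pderiv ^^ nat (int l + m)) ([:-1, 0, 1:] ^ l)) x"
proof -
  have "(\<lambda>y::real. (y\<^sup>2 - 1) ^ l) = poly ([:-1, 0, 1:] ^ l)"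
    by (auto simp: fun_eq_iff poly_power power2_eq_square)
  then show ?thesis
    by (simp add: assoc_legendre_def deriv_funpow_poly)
qed

lemma borel_measurable_assoc_legendre [measurable]: "assoc_legendre l m \<in> borel_measurable borel"
proof -
  have "(\<lambda>x::real. sqrt (1 - x\<^sup>2) powi m) \<in> borel_measurable borel"
    by (cases "m \<ge> 0") (simp_all add: power_int_def)
  moreover have "(\<lambda>x. poly p x) \<in> borel_measurable borel" for p :: "real poly"
    by (intro borel_measurable_continuous_onI continuous_intros)
  ultimately show ?thesis
    unfolding assoc_legendre_poly[abs_def] by measurable
qed

lemma bounded_assoc_legendre:
  assumes "\<bar>m\<bar> \<le> int l"
  obtains B where "\<And>x. x \<in> {-1..1} \<Longrightarrow> \<bar>assoc_legendre l m x\<bar> \<le> B"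
proof -
  let ?p = "[:-1, 0, 1:] :: real poly"
  let ?q = "(pderiv ^^ nat (int l + m)) (?p ^ l)"
  have poly_bdd: "\<exists>B. \<forall>x\<in>{-1..1}. \<bar>poly q x\<bar> \<le> B" for q :: "real poly"
  proof -
    have "compact (poly q ` {-1..1})"
      by (intro compact_continuous_image continuous_intros compact_Icc)
    then show ?thesis
      using compact_imp_bounded bounded_iff by (metis image_eqI real_norm_def)
  qed
  have "\<exists>r. \<forall>x\<in>{-1..1}. \<bar>sqrt (1 - x\<^sup>2) powi m * poly ?q x\<bar> \<le> \<bar>poly r x\<bar>"
  proof (cases "m \<ge> 0")
    case True
    have "\<bar>sqrt (1 - x\<^sup>2) powi m * poly ?q x\<bar> \<le> \<bar>poly ?q x\<bar>" if "x \<in> {-1..1}" for x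
    proof -
      have "x\<^sup>2 \<le> 1" using that by (simp add: abs_square_le_1 abs_le_iff)
      then have "sqrt (1 - x\<^sup>2) \<le> 1" "0 \<le> sqrt (1 - x\<^sup>2)" by auto
      then have "sqrt (1 - x\<^sup>2) ^ nat m \<le> 1" by (rule power_le_one[rotated])
      with \<open>0 \<le> sqrt (1 - x\<^sup>2)\<close> show ?thesis
        using True by (simp add: power_int_def abs_mult mult_left_le_one_le)
    qed
    then show ?thesis by blast
  next
    case False
    define k where "k = nat (- m)"
    have k: "k > 0" "k \<le> l" "m = - int k" "nat (int l + m) = l - k"
      using False assms by (auto simp: k_def)
    obtain r where r: "?q = ?p ^ k * r"
      using power_dvd_pderiv_funpow[of "l - k" l ?p] k by (auto simp: dvd_def)
    have "\<bar>sqrt (1 - x\<^sup>2) powi m * poly ?q x\<bar> \<le> \<bar>poly r x\<bar>" if "x \<in> {-1..1}" for x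
    proof -
      define w where "w = sqrt (1 - x\<^sup>2)"
      have "x\<^sup>2 \<le> 1" using that by (simp add: abs_square_le_1 abs_le_iff)
      then have w: "w \<le> 1" "0 \<le> w" "1 - x\<^sup>2 = w\<^sup>2" by (auto simp: w_def)
      have "poly ?p x = - (w\<^sup>2)" using w(3) by (simp add: power2_eq_square)
      then have "poly ?q x = (- (w\<^sup>2)) ^ k * poly r x" by (simp add: r poly_power)
      moreover have "w powi m = inverse (w ^ k)"
        by (simp add: k power_int_minus)
      ultimately have "\<bar>w powi m * poly ?q x\<bar> = (inverse (w ^ k) * (w ^ k * w ^ k)) * \<bar>poly r x\<bar>"
        using w by (simp add: abs_mult power_abs power2_eq_square power_mult_distrib)
      also have "inverse (w ^ k) * (w ^ k * w ^ k) = w ^ k"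
        using k by (cases "w = 0") auto
      also have "w ^ k * \<bar>poly r x\<bar> \<le> \<bar>poly r x\<bar>"
        using w by (intro mult_left_le_one_le) (auto intro: power_le_one)
      finally show ?thesis by (simp add: w_def)
    qed
    then show ?thesis by blast
  qed
  then obtain r where r: "\<And>x. x \<in> {-1..1} \<Longrightarrow> \<bar>sqrt (1 - x\<^sup>2) powi m * poly ?q x\<bar> \<le> \<bar>poly r x\<bar>"
    by blast
  obtain B where B: "\<And>x. x \<in> {-1..1} \<Longrightarrow> \<bar>poly r x\<bar> \<le> B"
    using poly_bdd by blast
  show thesis
  proof
    fix x :: real assume x: "x \<in> {-1..1}"
    have "\<bar>assoc_legendre l m x\<bar> = \<bar>(-1) powi m / (2 ^ l * fact l)\<bar> * \<bar>sqrt (1 - x\<^sup>2) powi m * poly ?q x\<bar>"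
      by (simp add: assoc_legendre_poly abs_mult)
    also have "\<dots> \<le> \<bar>(-1) powi m / (2 ^ l * fact l)\<bar> * B"
      using r[OF x] B[OF x] by (intro mult_left_mono) auto
    finally show "\<bar>assoc_legendre l m x\<bar> \<le> \<bar>(-1) powi m / (2 ^ l * fact l)\<bar> * B" .
  qed
qed

lemma borel_measurable_Arg2pi [measurable]: "Arg2pi \<in> borel_measurable borel"
proof -
  have "continuous_on (- \<real>\<^sub>\<ge>\<^sub>0) Arg2pi"
    by (intro continuous_at_imp_continuous_on ballI continuous_at_Arg2pi) auto
  moreover have "continuous_on \<real>\<^sub>\<ge>\<^sub>0 Arg2pi"
    by (subst continuous_on_cong[OF refl, of _ _ "\<lambda>_. 0"])
      (auto simp: Arg2pi_eq_0 nonneg_Reals_def complex_is_Real_iff)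
  ultimately have "(\<lambda>z. if z \<in> \<real>\<^sub>\<ge>\<^sub>0 then Arg2pi z else Arg2pi z) \<in> borel_measurable borel"
    by (intro borel_measurable_continuous_on_if borel_closed closed_nonneg_Reals_complex)
  then show ?thesis by simp
qed

lemma borel_measurable_cnj [measurable]: "cnj \<in> borel_measurable borel"
  by (intro borel_measurable_continuous_onI continuous_intros)

lemma borel_measurable_cis [measurable]: "cis \<in> borel_measurable borel"
  by (intro borel_measurable_continuous_onI) (auto simp: cis_conv_exp intro!: continuous_intros)

lemma borel_measurable_sph_harm [measurable]: "sph_harm l m \<in> borel_measurable sph_measure"
proof -
  have cont: "f \<in> borel_measurable sph_measure" if "continuous_on S2 f" for f :: "real ^ 3 \<Rightarrow> 'a::topological_space"
    unfolding measurable_cong_sets[OF sets_sph_measure refl]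
    using that by (rule borel_measurable_continuous_on_restrict)
  have [measurable]: "(\<lambda>x::real^3. Complex (x $ 1) (x $ 2)) \<in> borel_measurable sph_measure"
    by (intro cont) (auto simp: Complex_eq intro!: continuous_intros)
  have "\<bar>x $ 3\<bar> \<le> 1" if "x \<in> S2" for x :: "real ^ 3"
    using component_le_norm_cart[of x 3] that by simp
  then have [measurable]: "(\<lambda>x::real^3. arccos (x $ 3)) \<in> borel_measurable sph_measure"
    by (intro cont continuous_intros) (force simp: abs_le_iff)+
  have "(\<lambda>x. sph_harm_coord l m (arccos (x $ 3)) (Arg2pi (Complex (x $ 1) (x $ 2))))
      \<in> borel_measurable sph_measure"
    unfolding sph_harm_coord_def by measurable
  then show ?thesis
    by (cases "\<bar>m\<bar> \<le> int l") (simp_all add: sph_harm_def[abs_def])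
qed

lemma bounded_sph_harm: "\<exists>B. \<forall>x. cmod (sph_harm l m x) \<le> B"
proof (cases "\<bar>m\<bar> \<le> int l")
  case True
  obtain B where B: "\<And>x. x \<in> {-1..1} \<Longrightarrow> \<bar>assoc_legendre l m x\<bar> \<le> B"
    using bounded_assoc_legendre[OF True] by blast
  show ?thesis
    using B True
    by (intro exI[of _ "sqrt ((2 * real l + 1) * fact (nat (int l - m)) / (4 * pi * fact (nat (int l + m)))) * B"])
      (auto simp: sph_harm_def sph_harm_coord_def norm_mult abs_mult intro!: mult_left_mono divide_right_mono)
next
  case False
  then show ?thesis by (auto simp: sph_harm_def)
qed


section \<open>The Hilbert space of square integrable functions\<close>

definition square_integrable :: "(real ^ 3 \<Rightarrow> complex) \<Rightarrow> bool" where
  "square_integrable f \<longleftrightarrow> f \<in> borel_measurable sph_measure \<and> integrable sph_measure (\<lambda>x. (cmod (f x))\<^sup>2)"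

definition L2_rel :: "(real ^ 3 \<Rightarrow> complex) \<Rightarrow> (real ^ 3 \<Rightarrow> complex) \<Rightarrow> bool" where
  "L2_rel f g \<longleftrightarrow> square_integrable f \<and> square_integrable g \<and> (AE x in sph_measure. f x = g x)"

lemma square_integrable_add:
  assumes "square_integrable f" "square_integrable g"
  shows "square_integrable (\<lambda>x. f x + g x)"
proof -
  have [measurable]: "f \<in> borel_measurable sph_measure" "g \<in> borel_measurable sph_measure"
    using assms by (auto simp: square_integrable_def)
  have le: "(cmod (a + b))\<^sup>2 \<le> 2 * (cmod a)\<^sup>2 + 2 * (cmod b)\<^sup>2" for a b
  proof -
    have "(cmod (a + b))\<^sup>2 \<le> (cmod a + cmod b)\<^sup>2"
      by (intro power_mono norm_triangle_ineq) simp
    also have "\<dots> \<le> 2 * (cmod a)\<^sup>2 + 2 * (cmod b)\<^sup>2"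
      using zero_le_power2[of "cmod a - cmod b"] by (simp add: power2_diff power2_sum)
    finally show ?thesis .
  qed
  have "integrable sph_measure (\<lambda>x. 2 * (cmod (f x))\<^sup>2 + 2 * (cmod (g x))\<^sup>2)"
    using assms by (auto simp: square_integrable_def)
  then have "integrable sph_measure (\<lambda>x. (cmod (f x + g x))\<^sup>2)"
    by (rule Bochner_Integration.integrable_bound) (auto simp: le)
  then show ?thesis by (simp add: square_integrable_def)
qed

lemma square_integrable_cmult: "square_integrable f \<Longrightarrow> square_integrable (\<lambda>x. c * f x)"
  by (auto simp: square_integrable_def norm_mult power_mult_distrib)

lemma square_integrable_bounded:
  assumes "f \<in> borel_measurable sph_measure" "\<And>x. cmod (f x) \<le> B"
  shows "square_integrable f"
proof -
  have "integrable sph_measure (\<lambda>x. (cmod (f x))\<^sup>2)"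
    using assms by (intro sph.integrable_const_bound[of _ "B\<^sup>2"]) (auto intro!: power_mono)
  with assms show ?thesis by (simp add: square_integrable_def)
qed

lemma square_integrable_sph_harm: "square_integrable (sph_harm l m)"
  using bounded_sph_harm square_integrable_bounded borel_measurable_sph_harm by metis

lemma integrable_mult_cnj:
  assumes "square_integrable f" "square_integrable g"
  shows "integrable sph_measure (\<lambda>x. f x * cnj (g x))"
proof -
  have [measurable]: "f \<in> borel_measurable sph_measure" "g \<in> borel_measurable sph_measure"
    using assms by (auto simp: square_integrable_def)
  have le: "cmod (a * cnj b) \<le> (cmod a)\<^sup>2 + (cmod b)\<^sup>2" for a b
  proof -
    have "0 \<le> cmod a * cmod b" by simp
    then show ?thesis
      using zero_le_power2[of "cmod a - cmod b"] by (simp add: power2_diff norm_mult del: mult_nonneg_nonneg zero_le_mult_iff)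
  qed
  have "integrable sph_measure (\<lambda>x. (cmod (f x))\<^sup>2 + (cmod (g x))\<^sup>2)"
    using assms by (auto simp: square_integrable_def)
  then show ?thesis
    by (rule Bochner_Integration.integrable_bound) (auto intro: order_trans[OF le])
qed

lemma part_equivp_L2_rel: "part_equivp L2_rel"
proof (rule part_equivpI)
  show "\<exists>f. L2_rel f f"
    by (rule exI[of _ "\<lambda>_. 0"]) (simp add: L2_rel_def square_integrable_def)
  show "symp L2_rel"
    by (auto simp: symp_def L2_rel_def elim: eventually_mono)
  show "transp L2_rel"
    unfolding transp_def L2_rel_def by (auto elim: eventually_elim2)
qed

text \<open>\<open>L\<^sup>2(S\<^sup>2, \<sigma>)\<close>, modulo equality almost everywhere. As \<open>sph_measure\<close> has the
  space \<open>S2\<close>, the values of representatives off the sphere are irrelevant.\<close>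

quotient_type sphere_L2 = "real ^ 3 \<Rightarrow> complex" / partial: L2_rel
  by (rule part_equivp_L2_rel)

instantiation sphere_L2 :: real_inner
begin

lift_definition zero_sphere_L2 :: sphere_L2 is "\<lambda>_. 0"
  by (simp add: L2_rel_def square_integrable_def)

lift_definition plus_sphere_L2 :: "sphere_L2 \<Rightarrow> sphere_L2 \<Rightarrow> sphere_L2" is "\<lambda>f g x. f x + g x"
  by (auto simp: L2_rel_def square_integrable_add)

lift_definition uminus_sphere_L2 :: "sphere_L2 \<Rightarrow> sphere_L2" is "\<lambda>f x. - f x"
  using square_integrable_cmult[of _ "-1"] by (auto simp: L2_rel_def)

definition minus_sphere_L2 :: "sphere_L2 \<Rightarrow> sphere_L2 \<Rightarrow> sphere_L2" where
  "minus_sphere_L2 f g = f + - g"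

lift_definition scaleR_sphere_L2 :: "real \<Rightarrow> sphere_L2 \<Rightarrow> sphere_L2" is "\<lambda>c f x. complex_of_real c * f x"
  by (auto simp: L2_rel_def square_integrable_cmult)

lift_definition inner_sphere_L2 :: "sphere_L2 \<Rightarrow> sphere_L2 \<Rightarrow> real"
  is "\<lambda>f g. Re (\<integral>x. f x * cnj (g x) \<partial>sph_measure)"
proof -
  fix f f' g g' assume *: "L2_rel f f'" "L2_rel g g'"
  have [measurable]: "f \<in> borel_measurable sph_measure" "g \<in> borel_measurable sph_measure"
     "f' \<in> borel_measurable sph_measure" "g' \<in> borel_measurable sph_measure"
    using * by (auto simp: L2_rel_def square_integrable_def)
  have "(\<integral>x. f x * cnj (g x) \<partial>sph_measure) = (\<integral>x. f' x * cnj (g' x) \<partial>sph_measure)"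
    using * by (intro integral_cong_AE) (auto simp: L2_rel_def elim!: eventually_elim2)
  then show "Re (\<integral>x. f x * cnj (g x) \<partial>sph_measure) = Re (\<integral>x. f' x * cnj (g' x) \<partial>sph_measure)"
    by simp
qed

lift_definition norm_sphere_L2 :: "sphere_L2 \<Rightarrow> real" is "\<lambda>f. sqrt (\<integral>x. (cmod (f x))\<^sup>2 \<partial>sph_measure)"
proof -
  fix f f' assume *: "L2_rel f f'"
  have [measurable]: "f \<in> borel_measurable sph_measure" "f' \<in> borel_measurable sph_measure"
    using * by (auto simp: L2_rel_def square_integrable_def)
  have "(\<integral>x. (cmod (f x))\<^sup>2 \<partial>sph_measure) = (\<integral>x. (cmod (f' x))\<^sup>2 \<partial>sph_measure)"
    using * by (intro integral_cong_AE) (auto simp: L2_rel_def)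
  then show "sqrt (\<integral>x. (cmod (f x))\<^sup>2 \<partial>sph_measure) = sqrt (\<integral>x. (cmod (f' x))\<^sup>2 \<partial>sph_measure)"
    by simp
qed

definition sgn_sphere_L2 :: "sphere_L2 \<Rightarrow> sphere_L2" where
  "sgn_sphere_L2 f = scaleR (inverse (norm f)) f"

definition dist_sphere_L2 :: "sphere_L2 \<Rightarrow> sphere_L2 \<Rightarrow> real" where
  "dist_sphere_L2 f g = norm (f - g)"

definition uniformity_sphere_L2 :: "(sphere_L2 \<times> sphere_L2) filter" where
  "uniformity_sphere_L2 = (INF e\<in>{0<..}. principal {(x, y). dist x y < e})"

definition open_sphere_L2 :: "sphere_L2 set \<Rightarrow> bool" where
  "open_sphere_L2 U \<longleftrightarrow> (\<forall>x\<in>U. \<forall>\<^sub>F (x', y) in uniformity. x' = x \<longrightarrow> y \<in> U)"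

instance
proof
  fix a b c :: sphere_L2 and r r' :: real
  show "a + b + c = a + (b + c)"
    by transfer (auto simp: L2_rel_def add.assoc intro!: square_integrable_add)
  show "a + b = b + a"
    by transfer (auto simp: L2_rel_def add.commute intro!: square_integrable_add)
  show "0 + a = a"
    by transfer (auto simp: L2_rel_def)
  show "- a + a = 0"
    by transfer (auto simp: L2_rel_def square_integrable_def)
  show "a - b = a + - b"
    by (simp add: minus_sphere_L2_def)
  show "r *\<^sub>R (a + b) = r *\<^sub>R a + r *\<^sub>R b"
    by transfer (auto simp: L2_rel_def distrib_left intro!: square_integrable_add square_integrable_cmult)
  show "(r + r') *\<^sub>R a = r *\<^sub>R a + r' *\<^sub>R a"
    by transfer (auto simp: L2_rel_def distrib_right intro!: square_integrable_add square_integrable_cmult)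
  show "r *\<^sub>R r' *\<^sub>R a = (r * r') *\<^sub>R a"
    by transfer (auto simp: L2_rel_def mult.assoc[symmetric] intro!: square_integrable_cmult)
  show "1 *\<^sub>R a = a"
    by transfer (auto simp: L2_rel_def)
  show "sgn a = scaleR (inverse (norm a)) a"
    by (rule sgn_sphere_L2_def)
  show "dist a b = norm (a - b)"
    by (rule dist_sphere_L2_def)
  show "uniformity = (INF e\<in>{0<..}. principal {(x, y :: sphere_L2). dist x y < e})"
    by (rule uniformity_sphere_L2_def)
  show "open U \<longleftrightarrow> (\<forall>x\<in>U. \<forall>\<^sub>F (x', y) in uniformity. x' = x \<longrightarrow> y \<in> U)" for U :: "sphere_L2 set"
    by (rule open_sphere_L2_def)
  show "inner a b = inner b a"
  proof transfer
    fix f g assume "L2_rel f f" "L2_rel g g"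
    have "cnj (\<integral>x. f x * cnj (g x) \<partial>sph_measure) = (\<integral>x. cnj (f x * cnj (g x)) \<partial>sph_measure)"
      by (rule Bochner_Integration.integral_cnj[symmetric])
    also have "\<dots> = (\<integral>x. g x * cnj (f x) \<partial>sph_measure)"
      by (rule Bochner_Integration.integral_cong) (simp_all add: mult.commute)
    finally have "(\<integral>x. g x * cnj (f x) \<partial>sph_measure) = cnj (\<integral>x. f x * cnj (g x) \<partial>sph_measure)" ..
    then show "Re (\<integral>x. f x * cnj (g x) \<partial>sph_measure) = Re (\<integral>x. g x * cnj (f x) \<partial>sph_measure)"
      by simp
  qed
  show "inner (a + b) c = inner a c + inner b c"
    by transfer (simp add: L2_rel_def distrib_right integrable_mult_cnj)
  show "inner (r *\<^sub>R a) b = r * inner a b"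
    by transfer (simp add: L2_rel_def mult.assoc)
  have sq: "Re (\<integral>x. f x * cnj (f x) \<partial>sph_measure) = (\<integral>x. (cmod (f x))\<^sup>2 \<partial>sph_measure)" for f
    by (simp add: complex_norm_square[symmetric] del: of_real_power)
  show "0 \<le> inner a a"
    by transfer (simp add: sq)
  show "norm a = sqrt (inner a a)"
    by transfer (simp add: sq)
  show "inner a a = 0 \<longleftrightarrow> a = 0"
  proof transfer
    fix f assume f: "L2_rel f f"
    then have "(\<integral>x. (cmod (f x))\<^sup>2 \<partial>sph_measure) = 0 \<longleftrightarrow> (AE x in sph_measure. (cmod (f x))\<^sup>2 = 0)"
      by (intro integral_nonneg_eq_0_iff_AE) (auto simp: L2_rel_def square_integrable_def)
    with f show "Re (\<integral>x. f x * cnj (f x) \<partial>sph_measure) = 0 \<longleftrightarrow> L2_rel f (\<lambda>_. 0)"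
      unfolding sq by (auto simp: L2_rel_def square_integrable_def)
  qed
qed

end

lift_definition scaleC :: "complex \<Rightarrow> sphere_L2 \<Rightarrow> sphere_L2" (infixr "*\<^sub>C" 75) is "\<lambda>c f x. c * f x"
  by (auto simp: L2_rel_def square_integrable_cmult)

lift_definition sph_harm_L2 :: "nat \<Rightarrow> int \<Rightarrow> sphere_L2" is sph_harm
  by (simp add: L2_rel_def square_integrable_sph_harm)

lift_definition fl_coeff :: "sphere_L2 \<Rightarrow> nat \<Rightarrow> int \<Rightarrow> complex"
  is "\<lambda>f l m. \<integral>x. f x * cnj (sph_harm l m x) \<partial>sph_measure"
proof (intro ext)
  fix f f' l m assume *: "L2_rel f f'"
  have [measurable]: "f \<in> borel_measurable sph_measure" "f' \<in> borel_measurable sph_measure"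
    using * by (auto simp: L2_rel_def square_integrable_def)
  show "(\<integral>x. f x * cnj (sph_harm l m x) \<partial>sph_measure) = (\<integral>x. f' x * cnj (sph_harm l m x) \<partial>sph_measure)"
    using * by (intro integral_cong_AE) (auto simp: L2_rel_def)
qed


section \<open>Sobolev spaces and the operator\<close>

definition ang_power :: "sphere_L2 \<Rightarrow> nat \<Rightarrow> real" where
  "ang_power f l = (\<Sum>m = - int l..int l. (cmod (fl_coeff f l m))\<^sup>2)"

definition Sobolev :: "real \<Rightarrow> sphere_L2 set" where
  "Sobolev s = {f. summable (\<lambda>l. real l powr (2 * s) * ang_power f l)}"

definition Sobolev_norm :: "real \<Rightarrow> sphere_L2 \<Rightarrow> real" where
  "Sobolev_norm s f = norm f + sqrt (\<Sum>l. real l powr (2 * s) * ang_power f l)"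

text \<open>\<open>\<Delta>\<^sub>g + \<mu> \<partial>/\<partial>\<phi>\<close> on \<open>H\<^sup>2\<close>, through its spherical harmonic expansion;
  the series converges in the norm of \<open>sphere_L2\<close>.\<close>

definition G_op :: "real \<Rightarrow> sphere_L2 \<Rightarrow> sphere_L2" where
  "G_op \<mu> u = (\<Sum>l. \<Sum>m = - int l..int l.
     ((\<i> * complex_of_real \<mu> * of_int m - of_nat (l * (l + 1))) * fl_coeff u l m) *\<^sub>C sph_harm_L2 l m)"


section \<open>Calculus in a normed space given by a carrier and a norm\<close>

text \<open>The spaces \<open>H\<^sup>s\<close> are not types, since they depend on the real number \<open>s\<close>.
  In the following definitions \<open>V\<close> is a linear subspace of a real vector space and
  \<open>N\<close> is a norm on it.\<close>

definition tendsto_in :: "('b::real_vector \<Rightarrow> real) \<Rightarrow> ('a \<Rightarrow> 'b) \<Rightarrow> 'b \<Rightarrow> 'a filter \<Rightarrow> bool" where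
  "tendsto_in N f x F \<longleftrightarrow> ((\<lambda>t. N (f t - x)) \<longlongrightarrow> 0) F"

definition continuous_into :: "'b::real_vector set \<Rightarrow> ('b \<Rightarrow> real) \<Rightarrow> real set \<Rightarrow> (real \<Rightarrow> 'b) \<Rightarrow> bool" where
  "continuous_into V N I u \<longleftrightarrow> (\<forall>t\<in>I. u t \<in> V \<and> tendsto_in N u (u t) (at t within I))"

text \<open>The Bochner integral: \<open>f\<close> is strongly measurable, that is, almost everywhere the limit of
  simple functions with values in \<open>V\<close>, and these can be chosen to approximate \<open>f\<close> in mean.\<close>

definition has_bochner_integral_in ::
  "'b::real_vector set \<Rightarrow> ('b \<Rightarrow> real) \<Rightarrow> 'a measure \<Rightarrow> ('a \<Rightarrow> 'b) \<Rightarrow> 'b \<Rightarrow> bool" where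
  "has_bochner_integral_in V N M f x \<longleftrightarrow>
     x \<in> V \<and> (\<forall>t\<in>space M. f t \<in> V) \<and>
     (\<exists>\<sigma>. (\<forall>i. Bochner_Integration.simple_bochner_integrable M (\<sigma> i) \<and> (\<forall>t\<in>space M. \<sigma> i t \<in> V)) \<and>
          (AE t in M. tendsto_in N (\<lambda>i. \<sigma> i t) (f t) sequentially) \<and>
          (\<lambda>i. \<integral>\<^sup>+t. ennreal (N (f t - \<sigma> i t)) \<partial>M) \<longlonglongrightarrow> 0 \<and>
          tendsto_in N (\<lambda>i. Bochner_Integration.simple_bochner_integral M (\<sigma> i)) x sequentially)"


section \<open>The nonlocal derivative and strong solutions\<close>

text \<open>The tail \<open>\<nu>(t, \<infinity>)\<close> of the Levy measure
  \<open>\<nu>(dt) = \<alpha> t\<^sup>-\<^sup>\<alpha>\<^sup>-\<^sup>1 dt / \<Gamma>(1 - \<alpha>)\<close> of \<open>\<Phi>(\<lambda>) = \<lambda>\<^sup>\<alpha>\<close>.\<close>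

definition levy_tail :: "real \<Rightarrow> real \<Rightarrow> real" where
  "levy_tail \<alpha> t = t powr (- \<alpha>) / Gamma (1 - \<alpha>)"

text \<open>\<open>D\<close> is the nonlocal derivative of \<open>u\<close> at \<open>t\<close>, with the convolution kernel \<open>k\<close>;
  \<open>u0\<close> is the right limit of \<open>u\<close> at 0 and \<open>J r\<close> the convolution integral over \<open>[0, r]\<close>.\<close>

definition has_nonlocal_derivative_in ::
  "'b::real_vector set \<Rightarrow> ('b \<Rightarrow> real) \<Rightarrow> (real \<Rightarrow> real) \<Rightarrow> (real \<Rightarrow> 'b) \<Rightarrow> 'b \<Rightarrow> real \<Rightarrow> bool" where
  "has_nonlocal_derivative_in V N k u D t \<longleftrightarrow>
     D \<in> V \<and>
     (\<exists>u0\<in>V. tendsto_in N u u0 (at_right 0) \<and>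
       (\<exists>J. (\<forall>r>0. has_bochner_integral_in V N (restrict_space lborel {0..r})
                    (\<lambda>\<tau>. k (r - \<tau>) *\<^sub>R (u \<tau> - u0)) (J r)) \<and>
            tendsto_in N (\<lambda>h. (J (t + h) - J t) /\<^sub>R h) D (at 0)))"

definition solves_Cauchy_problem ::
  "real \<Rightarrow> real \<Rightarrow> real \<Rightarrow> sphere_L2 \<Rightarrow> (real \<Rightarrow> sphere_L2) \<Rightarrow> bool" where
  "solves_Cauchy_problem \<mu> \<alpha> s f u \<longleftrightarrow>
     continuous_into (Sobolev s) (Sobolev_norm s) {0..} u \<and>
     continuous_into (Sobolev (s + 2)) (Sobolev_norm (s + 2)) {0<..} u \<and>
     (\<exists>D. (\<forall>t>0. has_nonlocal_derivative_in (Sobolev s) (Sobolev_norm s) (levy_tail \<alpha>) u (D t) t) \<and>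
          continuous_into (Sobolev s) (Sobolev_norm s) {0<..} D \<and>
          (\<forall>t>0. D t = G_op \<mu> (u t))) \<and>
     u 0 = f"

text \<open>The strong solution is the unique solution; a solution is a function on \<open>[0, \<infinity>)\<close>,
  so the values at negative times are disregarded.\<close>

definition is_strong_solution ::
  "real \<Rightarrow> real \<Rightarrow> real \<Rightarrow> sphere_L2 \<Rightarrow> (real \<Rightarrow> sphere_L2) \<Rightarrow> bool" where
  "is_strong_solution \<mu> \<alpha> s f u \<longleftrightarrow>
     solves_Cauchy_problem \<mu> \<alpha> s f u \<and>
     (\<forall>v. solves_Cauchy_problem \<mu> \<alpha> s f v \<longrightarrow> (\<forall>t\<ge>0. v t = u t))"

end

theory Submission
  imports Defs
begin

text \<open>
  On the spherical harmonics of degree \<open>l\<close> and order 0 the operator acts as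
  multiplication by \<open>- l (l + 1)\<close>, whatever \<open>\<mu>\<close> is. For a zonal datum
  \<open>f = \<Sum>l. a\<^sub>l Y\<^sub>l\<^sub>,\<^sub>0\<close> the Cauchy problem therefore splits into scalar relaxation
  equations with rates \<open>\<kappa> = l (l + 1)\<close>, solved by the Mittag-Leffler functions
  \<open>y\<^sub>l(t) = E\<^sub>\<alpha>(- \<kappa> t\<^sup>\<alpha>)\<close>. In contrast with the exponential, these decay only algebraically:
  for fixed \<open>t > 0\<close> the product \<open>\<kappa> y\<^sub>l(t)\<close> is bounded above (\<open>relax_upper\<close>) and away from 0
  (\<open>relax_lower\<close>), uniformly in \<open>l \<ge> 1\<close>. So at every positive time the solution is exactly two
  Sobolev orders better than the datum, and the claim reduces to finding a datum in \<open>H\<^sup>s\<close> that lies in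
  no better space. We take \<open>a\<^sub>l = l\<^sup>-\<^sup>s q\<^sub>l\<close>, where \<open>q\<close> is summable but sparse, so that
  \<open>l\<^sup>\<epsilon> q\<^sub>l\<close> does not tend to 0 for any \<open>\<epsilon> > 0\<close> (\<open>sparse_sequence_exists\<close>).

  The choice of a summable \<open>q\<close>, and not merely a square summable one, makes
  \<open>\<Sum>l. a\<^sub>l y\<^sub>l(t) Y\<^sub>l\<^sub>,\<^sub>0\<close> absolutely convergent in the Sobolev norms.
  Continuity of \<open>u\<close>, the Bochner integral and the strong derivative then all follow from
  the scalar facts by dominated convergence of series (\<open>zonal_tendsto\<close>,
  \<open>zonal_bochner_integral\<close>).

  The scalar estimates rest on a positivity statement. With the kernel
  \<open>k(t) = t\<^sup>-\<^sup>\<alpha> / \<Gamma>(1 - \<alpha>)\<close> and \<open>r = - y' / \<kappa>\<close>, which is again a Mittag-Leffler type function,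
  one has \<open>y = k * r\<close> and \<open>1 - y = \<kappa> (1 * r)\<close>. A look at the first zero shows that \<open>r > 0\<close>
  (\<open>ml_pos\<close>), hence \<open>y\<close> is positive and decreasing, and comparing the two convolutions
  gives both bounds.

  For uniqueness let \<open>u\<close>, \<open>v\<close> be two solutions. Each Fourier-Laplace coefficient of
  \<open>v - u\<close> solves a scalar equation with zero initial value and a complex rate; the Sonine identity turns it
  into a Volterra equation with an integrable kernel, whose only solution is 0
  (\<open>fractional_ivp_unique\<close>). Then \<open>G_op \<mu> (v t) = G_op \<mu> (u t)\<close>, so every continuous functional of
  \<open>v - u\<close> solves the scalar equation with rate 0 and vanishes too; this disposes of the part
  of \<open>v - u\<close> that is orthogonal to all spherical harmonics. That the coefficients of \<open>G_op \<mu> v\<close> are the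
  expected ones uses the orthonormality of the harmonics (\<open>sph_harm_orthonormal\<close>) and the
  convergence of absolutely convergent series in \<open>L\<^sup>2\<close> (\<open>summable_sphere_L2\<close>).
\<close>

section \<open>Fractional integrals and Mittag-Leffler functions\<close>

lemma has_bochner_integral_restrict_lborel:
  fixes f :: "real \<Rightarrow> real"
  assumes "(f has_integral I) {a..b}" and "\<And>x. x \<in> {a..b} \<Longrightarrow> 0 \<le> f x" and [measurable]: "f \<in> borel_measurable borel"
  shows "has_bochner_integral (restrict_space lborel {a..b}) f I"
proof -
  have "((\<lambda>x. if x \<in> {a..b} then f x else 0) has_integral I) UNIV"
    using assms(1) by (subst has_integral_restrict_UNIV)
  also have "(\<lambda>x. if x \<in> {a..b} then f x else 0) = (\<lambda>x. indicator {a..b} x * f x)"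
    by (auto simp: indicator_def)
  finally have nn: "integral\<^sup>N lborel (\<lambda>x. indicator {a..b} x * f x) = ennreal I"
    by (intro nn_integral_has_integral_lborel) (auto simp: assms(2) indicator_def)
  have "0 \<le> I"
    using assms(1,2) by (rule has_integral_nonneg)
  have "has_bochner_integral lborel (\<lambda>x. indicator {a..b} x * f x) I"
    using nn \<open>0 \<le> I\<close> assms(2) by (intro has_bochner_integral_nn_integral) (auto simp: indicator_def)
  then show ?thesis
    by (simp add: has_bochner_integral_iff integrable_restrict_space integral_restrict_space)
qed

text \<open>Convolution with \<open>riesz \<beta>\<close> is the Riemann-Liouville integral of order \<open>\<beta>\<close>. As
  \<open>0 powr x = 0\<close>, the value at 0 is 0 for every \<open>\<beta>\<close>; hence \<open>riesz 1\<close> is the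
  constant 1 only off 0, and some identities below hold up to one point.\<close>

definition riesz :: "real \<Rightarrow> real \<Rightarrow> real" where
  "riesz \<beta> t = t powr (\<beta> - 1) / Gamma \<beta>"

lemma borel_measurable_riesz [measurable]: "riesz \<beta> \<in> borel_measurable borel"
  unfolding riesz_def[abs_def] by measurable

lemma riesz_nonneg: "0 < \<beta> \<Longrightarrow> 0 \<le> riesz \<beta> t"
  by (simp add: riesz_def less_imp_le)

lemma riesz_pos: "0 < \<beta> \<Longrightarrow> 0 < t \<Longrightarrow> 0 < riesz \<beta> t"
  by (simp add: riesz_def)

text \<open>The semigroup law of fractional integration: the Beta integral, rescaled to \<open>[0, t]\<close>.\<close>

lemma riesz_conv_riesz:
  assumes "0 < \<gamma>" "0 < \<beta>" "0 < t"
  shows "has_bochner_integral (restrict_space lborel {0..t})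
           (\<lambda>\<tau>. riesz \<gamma> (t - \<tau>) * riesz \<beta> \<tau>) (riesz (\<beta> + \<gamma>) t)"
proof -
  have "((\<lambda>x. x powr (\<beta> - 1) * (1 - x) powr (\<gamma> - 1)) has_integral Beta \<beta> \<gamma>) (cbox 0 1)"
    using has_integral_Beta_real[of \<beta> \<gamma>] assms by simp
  from has_integral_affinity'[OF this, of "1 / t" 0] assms(3)
  have "((\<lambda>x. (x / t) powr (\<beta> - 1) * (1 - x / t) powr (\<gamma> - 1)) has_integral (t * Beta \<beta> \<gamma>)) {0..t}"
    by simp
  from has_integral_mult_right[OF this, of "t powr (\<beta> + \<gamma> - 2) / (Gamma \<beta> * Gamma \<gamma>)"]
  have "((\<lambda>x. t powr (\<beta> + \<gamma> - 2) / (Gamma \<beta> * Gamma \<gamma>) * ((x / t) powr (\<beta> - 1) * (1 - x / t) powr (\<gamma> - 1)))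
      has_integral (t powr (\<beta> + \<gamma> - 2) / (Gamma \<beta> * Gamma \<gamma>) * (t * Beta \<beta> \<gamma>))) {0..t}" .
  also have "t powr (\<beta> + \<gamma> - 2) / (Gamma \<beta> * Gamma \<gamma>) * (t * Beta \<beta> \<gamma>) = riesz (\<beta> + \<gamma>) t"
  proof -
    have "t powr (\<beta> + \<gamma> - 2) * t = t powr (\<beta> + \<gamma> - 1)"
      using assms powr_mult_base[of t "\<beta> + \<gamma> - 2"] by (simp add: mult.commute)
    moreover have "Beta \<beta> \<gamma> = Gamma \<beta> * Gamma \<gamma> / Gamma (\<beta> + \<gamma>)"
      by (simp add: Beta_def rGamma_inverse_Gamma divide_inverse)
    moreover have "Gamma \<beta> > 0" "Gamma \<gamma> > 0" using assms by auto
    ultimately show ?thesis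
      by (simp add: riesz_def)
  qed
  finally have *: "((\<lambda>x. t powr (\<beta> + \<gamma> - 2) / (Gamma \<beta> * Gamma \<gamma>) * ((x / t) powr (\<beta> - 1) * (1 - x / t) powr (\<gamma> - 1)))
      has_integral riesz (\<beta> + \<gamma>) t) {0..t}" .
  have eq: "t powr (\<beta> + \<gamma> - 2) / (Gamma \<beta> * Gamma \<gamma>) * ((x / t) powr (\<beta> - 1) * (1 - x / t) powr (\<gamma> - 1))
      = riesz \<gamma> (t - x) * riesz \<beta> x" if "x \<in> {0..t}" for x
  proof -
    have 1: "1 - x / t = (t - x) / t" using assms by (simp add: field_simps)
    have 2: "t powr (\<beta> + \<gamma> - 2) = t powr (\<beta> - 1) * t powr (\<gamma> - 1)"
      by (simp add: powr_add[symmetric])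
    show ?thesis using that assms
      unfolding 1 2 by (simp add: powr_divide riesz_def mult.commute)
  qed
  have "((\<lambda>x. riesz \<gamma> (t - x) * riesz \<beta> x) has_integral riesz (\<beta> + \<gamma>) t) {0..t}"
    by (rule has_integral_eq[OF eq *])
  then show ?thesis
    using assms by (intro has_bochner_integral_restrict_lborel) (auto simp: riesz_nonneg)
qed

text \<open>Only the part over \<open>[T, \<infinity>)\<close> of Euler's integral is kept. As \<open>T\<close> is arbitrary,
  \<open>\<Gamma>\<close> outgrows every geometric sequence along an arithmetic progression.\<close>

lemma Gamma_ge_powr:
  assumes "1 \<le> z" "0 < T"
  shows "T powr (z - 1) * exp (- T) \<le> Gamma (z::real)"
proof -
  have "((\<lambda>x. exp (- 1 * x)) has_integral exp (- 1 * T) / 1) {T..}"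
    by (rule has_integral_exp_minus_to_infinity) simp
  then have 1: "((\<lambda>x. T powr (z - 1) * exp (- x)) has_integral (T powr (z - 1) * exp (- T))) {T..}"
    by (intro has_integral_mult_right) simp
  have 2: "((\<lambda>t. if t \<in> {0..} then t powr (z - 1) / exp t else 0) has_integral Gamma z) UNIV"
    using Gamma_integral_real[of z] assms by (subst has_integral_restrict_UNIV) auto
  have 3: "((\<lambda>x. if x \<in> {T..} then T powr (z - 1) * exp (- x) else 0) has_integral (T powr (z - 1) * exp (- T))) UNIV"
    using 1 by (subst has_integral_restrict_UNIV)
  show ?thesis
    using assms by (intro has_integral_le[OF 3 2])
      (auto simp: exp_minus divide_inverse intro!: mult_right_mono powr_mono2)
qed

lemma summable_mittag_leffler:
  fixes x :: real
  assumes "0 < \<alpha>" "0 < \<beta>"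
  shows "summable (\<lambda>n. x ^ n / Gamma (\<alpha> * real n + \<beta>))"
proof -
  \<comment> \<open>chosen so that the comparison series has a ratio below 1/2\<close>
  define T where "T = (2 * \<bar>x\<bar> + 1) powr (1 / \<alpha>)"
  have T: "T > 0" "T powr \<alpha> = 2 * \<bar>x\<bar> + 1"
    using assms by (auto simp: T_def powr_powr)
  have "eventually (\<lambda>n. \<alpha> * real n + \<beta> \<ge> 1) sequentially"
    using assms(1) by real_asymp
  then have ev: "eventually (\<lambda>n. norm (x ^ n / Gamma (\<alpha> * real n + \<beta>)) \<le> exp T * T powr (1 - \<beta>) * (1/2) ^ n) sequentially"
  proof eventually_elim
    case (elim n)
    have "T powr (\<alpha> * real n + \<beta> - 1) = (T powr \<alpha>) ^ n * T powr (\<beta> - 1)"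
      using T(1) by (simp add: powr_add[symmetric] powr_powr powr_realpow[symmetric] add_diff_eq)
    then have G: "(2 * \<bar>x\<bar> + 1) ^ n * T powr (\<beta> - 1) * exp (- T) \<le> Gamma (\<alpha> * real n + \<beta>)"
      using Gamma_ge_powr[OF elim T(1)] T by simp
    have "norm (x ^ n / Gamma (\<alpha> * real n + \<beta>)) = \<bar>x\<bar> ^ n / Gamma (\<alpha> * real n + \<beta>)"
      using elim by (simp add: power_abs)
    also have "\<dots> \<le> \<bar>x\<bar> ^ n / ((2 * \<bar>x\<bar> + 1) ^ n * T powr (\<beta> - 1) * exp (- T))"
      using T by (intro divide_left_mono G mult_pos_pos) (use elim in \<open>auto intro!: mult_pos_pos\<close>)
    also have "\<dots> = exp T * T powr (1 - \<beta>) * (\<bar>x\<bar> / (2 * \<bar>x\<bar> + 1)) ^ n"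
    proof -
      have "T powr (1 - \<beta>) = inverse (T powr (\<beta> - 1))"
        by (simp add: powr_minus[symmetric])
      then show ?thesis by (simp add: field_simps exp_minus)
    qed
    also have "\<dots> \<le> exp T * T powr (1 - \<beta>) * (1/2) ^ n"
      by (intro mult_left_mono power_mono) (auto simp: field_simps)
    finally show ?case .
  qed
  show ?thesis
    by (rule summable_comparison_test_ev[OF ev]) (intro summable_mult summable_geometric, simp)
qed

definition mittag_leffler :: "real \<Rightarrow> real \<Rightarrow> real \<Rightarrow> real" where
  "mittag_leffler \<alpha> \<beta> x = (\<Sum>n. x ^ n / Gamma (\<alpha> * real n + \<beta>))"

lemma mittag_leffler_differentiable:
  assumes "0 < \<alpha>" "0 < \<beta>"
  shows "\<exists>D. (mittag_leffler \<alpha> \<beta> has_field_derivative D) (at x)"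
proof -
  have s: "summable (\<lambda>n. (1 / Gamma (\<alpha> * real n + \<beta>)) * x ^ n)" for x
    using summable_mittag_leffler[OF assms, of x] by simp
  have "((\<lambda>x. \<Sum>n. (1 / Gamma (\<alpha> * real n + \<beta>)) * x ^ n) has_field_derivative
      (\<Sum>n. diffs (\<lambda>n. 1 / Gamma (\<alpha> * real n + \<beta>)) n * x ^ n)) (at x)"
    by (rule termdiffs_strong_converges_everywhere) (rule s)
  moreover have "(\<lambda>x. \<Sum>n. (1 / Gamma (\<alpha> * real n + \<beta>)) * x ^ n) = mittag_leffler \<alpha> \<beta>"
    by (simp add: mittag_leffler_def[abs_def])
  ultimately show ?thesis by auto
qed

text \<open>This is \<open>t\<^sup>\<beta>\<^sup>-\<^sup>1 E\<^sub>\<alpha>\<^sub>,\<^sub>\<beta>(- \<kappa> t\<^sup>\<alpha>)\<close>, the sum of the kernels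
  \<open>(- \<kappa>)\<^sup>n riesz (\<alpha> n + \<beta>)\<close> (lemma \<open>ml_sums\<close>). Fractional integration of order \<open>\<gamma>\<close> just raises
  \<open>\<beta>\<close> by \<open>\<gamma>\<close> (lemma \<open>riesz_conv_ml\<close>). The members of the family needed below are the relaxation
  function (\<open>\<beta> = 1\<close>), its integral (\<open>\<beta> = 2\<close>), its negative derivative divided by \<open>\<kappa>\<close>
  (\<open>\<beta> = \<alpha>\<close>) and the integral of the latter (\<open>\<beta> = 1 + \<alpha>\<close>).\<close>

definition ml_kernel :: "real \<Rightarrow> real \<Rightarrow> real \<Rightarrow> real \<Rightarrow> real" where
  "ml_kernel \<alpha> \<kappa> \<beta> t = t powr (\<beta> - 1) * mittag_leffler \<alpha> \<beta> (- \<kappa> * t powr \<alpha>)"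

lemma riesz_shift:
  assumes "0 < t"
  shows "c ^ n * riesz (\<alpha> * real n + \<beta>) t = t powr (\<beta> - 1) * ((c * t powr \<alpha>) ^ n / Gamma (\<alpha> * real n + \<beta>))"
proof -
  have "t powr (\<alpha> * real n + \<beta> - 1) = t powr (\<beta> - 1) * (t powr \<alpha>) ^ n"
    using assms by (simp add: powr_realpow[symmetric] powr_powr powr_add[symmetric] algebra_simps)
  then show ?thesis by (simp add: riesz_def power_mult_distrib)
qed

lemma summable_riesz:
  assumes "0 < \<alpha>" "0 < \<beta>" "0 < t"
  shows "summable (\<lambda>n. c ^ n * riesz (\<alpha> * real n + \<beta>) t)"
  unfolding riesz_shift[OF assms(3)]
  by (intro summable_mult summable_mittag_leffler assms)

lemma ml_sums:
  assumes "0 < \<alpha>" "0 < \<beta>" "0 < t"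
  shows "(\<lambda>n. (- \<kappa>) ^ n * riesz (\<alpha> * real n + \<beta>) t) sums ml_kernel \<alpha> \<kappa> \<beta> t"
  unfolding riesz_shift[OF assms(3)] ml_kernel_def mittag_leffler_def
  by (intro sums_mult summable_sums summable_mittag_leffler assms)

lemma ml_recurrence:
  assumes "0 < \<alpha>" "0 < \<beta>" "0 < t"
  shows "ml_kernel \<alpha> \<kappa> \<beta> t = riesz \<beta> t - \<kappa> * ml_kernel \<alpha> \<kappa> (\<beta> + \<alpha>) t"
proof -
  have "(\<lambda>n. - \<kappa> * ((- \<kappa>) ^ n * riesz (\<alpha> * real n + (\<beta> + \<alpha>)) t)) sums (- \<kappa> * ml_kernel \<alpha> \<kappa> (\<beta> + \<alpha>) t)"
    using assms by (intro sums_mult ml_sums) auto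
  then have "(\<lambda>n. (- \<kappa>) ^ Suc n * riesz (\<alpha> * real (Suc n) + \<beta>) t) sums (- \<kappa> * ml_kernel \<alpha> \<kappa> (\<beta> + \<alpha>) t)"
    by (simp add: algebra_simps)
  then have "(\<lambda>n. (- \<kappa>) ^ n * riesz (\<alpha> * real n + \<beta>) t) sums (- \<kappa> * ml_kernel \<alpha> \<kappa> (\<beta> + \<alpha>) t + riesz \<beta> t)"
    by (subst (asm) sums_Suc_iff) simp
  from sums_unique2[OF this ml_sums[OF assms]] show ?thesis by simp
qed

lemma continuous_on_ml:
  assumes "0 < \<alpha>" "0 < \<beta>"
  shows "continuous_on {0<..} (ml_kernel \<alpha> \<kappa> \<beta>)"
proof -
  have "continuous_on UNIV (mittag_leffler \<alpha> \<beta>)"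
    using mittag_leffler_differentiable[OF assms] by (meson DERIV_isCont continuous_at_imp_continuous_on)
  then have "continuous_on {0<..} (\<lambda>t. mittag_leffler \<alpha> \<beta> (- \<kappa> * t powr \<alpha>))"
    by (rule continuous_on_compose2) (auto intro!: continuous_intros)
  then show ?thesis
    unfolding ml_kernel_def[abs_def] by (auto intro!: continuous_intros)
qed

lemma ml_differentiable:
  assumes "0 < \<alpha>" "0 < \<beta>" "0 < t"
  shows "\<exists>D. (ml_kernel \<alpha> \<kappa> \<beta> has_field_derivative D) (at t)"
proof -
  obtain D where D: "(mittag_leffler \<alpha> \<beta> has_field_derivative D) (at (- \<kappa> * t powr \<alpha>))"
    using mittag_leffler_differentiable[OF assms(1,2)] by blast
  have "\<exists>E. ((\<lambda>t. - \<kappa> * t powr \<alpha>) has_field_derivative E) (at t)"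
    using assms by (auto intro!: exI derivative_eq_intros)
  then obtain E where "((\<lambda>t. - \<kappa> * t powr \<alpha>) has_field_derivative E) (at t)" ..
  from DERIV_chain2[of "mittag_leffler \<alpha> \<beta>", OF D this]
  show ?thesis
    unfolding ml_kernel_def[abs_def] using assms
    by (auto intro!: exI derivative_eq_intros)
qed

lemma borel_measurable_ml [measurable]:
  assumes "0 < \<alpha>" "0 < \<beta>"
  shows "ml_kernel \<alpha> \<kappa> \<beta> \<in> borel_measurable borel"
proof -
  have "continuous_on UNIV (mittag_leffler \<alpha> \<beta>)"
    using mittag_leffler_differentiable[OF assms] by (meson DERIV_isCont continuous_at_imp_continuous_on)
  then have [measurable]: "mittag_leffler \<alpha> \<beta> \<in> borel_measurable borel"
    by (rule borel_measurable_continuous_onI)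
  show ?thesis unfolding ml_kernel_def[abs_def] by measurable
qed

lemma ml_0 [simp]: "ml_kernel \<alpha> \<kappa> \<beta> 0 = 0"
  by (simp add: ml_kernel_def)

lemma riesz_0 [simp]: "riesz \<beta> 0 = 0"
  by (simp add: riesz_def)

text \<open>The semigroup law is applied to each term; exchanging sum and integral is justified by the same
  series with \<open>\<bar>\<kappa>\<bar>\<close> in place of \<open>- \<kappa>\<close>.\<close>

lemma riesz_conv_ml:
  assumes "0 < \<alpha>" "0 < \<beta>" "0 < \<gamma>" "0 < t"
  shows "has_bochner_integral (restrict_space lborel {0..t})
           (\<lambda>\<tau>. riesz \<gamma> (t - \<tau>) * ml_kernel \<alpha> \<kappa> \<beta> \<tau>) (ml_kernel \<alpha> \<kappa> (\<beta> + \<gamma>) t)"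
proof -
  let ?M = "restrict_space lborel {0..t}"
  define F where "F n \<tau> = (- \<kappa>) ^ n * (riesz \<gamma> (t - \<tau>) * riesz (\<alpha> * real n + \<beta>) \<tau>)" for n \<tau>
  have pos: "0 < \<alpha> * real n + \<beta>" for n using assms by (intro add_nonneg_pos) auto
  have conv: "has_bochner_integral ?M (\<lambda>\<tau>. c * (riesz \<gamma> (t - \<tau>) * riesz (\<alpha> * real n + \<beta>) \<tau>))
      (c * riesz (\<alpha> * real n + (\<beta> + \<gamma>)) t)" for n c
    using riesz_conv_riesz[OF assms(3) pos assms(4), of n]
    by (intro has_bochner_integral_mult_right) (simp add: add.assoc)
  have int: "integrable ?M (F n)" for n
    unfolding F_def using conv by (rule integrable.intros)
  have abs_F: "norm (F n \<tau>) = \<bar>\<kappa>\<bar> ^ n * (riesz \<gamma> (t - \<tau>) * riesz (\<alpha> * real n + \<beta>) \<tau>)" for n \<tau>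
    using pos[of n] assms by (simp add: F_def abs_mult power_abs riesz_nonneg)
  have sF: "F n \<tau> = riesz \<gamma> (t - \<tau>) * ((- \<kappa>) ^ n * riesz (\<alpha> * real n + \<beta>) \<tau>)" for n \<tau>
    by (simp add: F_def)
  have sum1: "summable (\<lambda>n. norm (F n \<tau>))" if "\<tau> \<in> space ?M" for \<tau>
  proof (cases "\<tau> = 0")
    case False
    then have "0 < \<tau>" using that by (auto simp: space_restrict_space)
    then have "summable (\<lambda>n. riesz \<gamma> (t - \<tau>) * (\<bar>\<kappa>\<bar> ^ n * riesz (\<alpha> * real n + \<beta>) \<tau>))"
      by (intro summable_mult summable_riesz assms)
    then show ?thesis unfolding abs_F by (simp only: mult.left_commute)
  qed (simp add: F_def)
  have sum2: "summable (\<lambda>n. \<integral>\<tau>. norm (F n \<tau>) \<partial>?M)"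
    unfolding abs_F using assms
    by (subst has_bochner_integral_integral_eq[OF conv]) (rule summable_riesz, auto)
  have eqF: "(\<Sum>n. F n \<tau>) = riesz \<gamma> (t - \<tau>) * ml_kernel \<alpha> \<kappa> \<beta> \<tau>" if "\<tau> \<in> space ?M" for \<tau>
  proof (cases "\<tau> = 0")
    case False
    then have "0 < \<tau>" using that by (auto simp: space_restrict_space)
    from sums_mult[OF ml_sums[OF assms(1,2) this]] show ?thesis
      unfolding sF by (rule sums_unique[symmetric])
  qed (simp add: F_def)
  have ae: "AE \<tau> in ?M. summable (\<lambda>n. norm (F n \<tau>))"
    using sum1 by (rule AE_I2)
  have "integrable ?M (\<lambda>\<tau>. \<Sum>n. F n \<tau>)"
    by (rule integrable_suminf[OF int ae sum2])
  moreover have "(\<integral>\<tau>. (\<Sum>n. F n \<tau>) \<partial>?M) = (\<Sum>n. integral\<^sup>L ?M (F n))"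
    by (rule integral_suminf[OF int ae sum2])
  moreover have "(\<Sum>n. integral\<^sup>L ?M (F n)) = ml_kernel \<alpha> \<kappa> (\<beta> + \<gamma>) t"
  proof -
    have "integral\<^sup>L ?M (F n) = (- \<kappa>) ^ n * riesz (\<alpha> * real n + (\<beta> + \<gamma>)) t" for n
      unfolding F_def using conv by (rule has_bochner_integral_integral_eq)
    then show ?thesis
      using ml_sums[of \<alpha> "\<beta> + \<gamma>" t \<kappa>] assms by (simp add: sums_iff)
  qed
  ultimately have "has_bochner_integral ?M (\<lambda>\<tau>. \<Sum>n. F n \<tau>) (ml_kernel \<alpha> \<kappa> (\<beta> + \<gamma>) t)"
    by (simp add: has_bochner_integral_iff)
  then show ?thesis
    by (subst has_bochner_integral_cong[OF refl eqF[symmetric] refl]) auto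
qed

section \<open>Positivity and two-sided decay of the relaxation function\<close>

lemma AE_restrict_lborel_neq: "AE \<tau> in restrict_space lborel {a..b::real}. \<tau> \<noteq> c"
  using AE_lborel_singleton[of c] by (auto simp: AE_restrict_space_iff elim: eventually_mono)

lemma riesz_1 [simp]: "0 < t \<Longrightarrow> riesz 1 t = 1"
  by (simp add: riesz_def)

lemma measurable_restrict_lborel:
  "f \<in> borel_measurable borel \<Longrightarrow> f \<in> borel_measurable (restrict_space lborel A)"
  by (rule measurable_restrict_space1) simp

lemma has_bochner_integral_restrict_lborel_eq:
  fixes f g :: "real \<Rightarrow> real"
  assumes "has_bochner_integral (restrict_space lborel {a..b}) f I"
    and "\<And>\<tau>. \<lbrakk>a \<le> \<tau>; \<tau> \<le> b; \<tau> \<noteq> c\<rbrakk> \<Longrightarrow> f \<tau> = g \<tau>" and "g \<in> borel_measurable borel"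
  shows "has_bochner_integral (restrict_space lborel {a..b}) g I"
proof -
  have "AE \<tau> in restrict_space lborel {a..b}. f \<tau> = g \<tau>"
    using AE_conjI[OF AE_restrict_lborel_neq[of c a b] AE_space]
    by (rule eventually_mono) (use assms(2) in \<open>auto simp: space_restrict_space\<close>)
  from has_bochner_integral_cong_AE[OF borel_measurable_has_bochner_integral[OF assms(1)] measurable_restrict_lborel[OF assms(3)] this]
    assms(1) show ?thesis by simp
qed

lemma integral_ml:
  assumes "0 < \<alpha>" "0 < \<beta>" "0 < t"
  shows "has_bochner_integral (restrict_space lborel {0..t}) (ml_kernel \<alpha> \<kappa> \<beta>) (ml_kernel \<alpha> \<kappa> (\<beta> + 1) t)"
  by (rule has_bochner_integral_restrict_lborel_eq[OF riesz_conv_ml[OF assms(1,2) zero_less_one assms(3)], of t])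
     (use assms in auto)

lemma integral_riesz:
  assumes "0 < \<gamma>" "0 < t"
  shows "has_bochner_integral (restrict_space lborel {0..t}) (\<lambda>\<tau>. riesz \<gamma> (t - \<tau>)) (riesz (1 + \<gamma>) t)"
  by (rule has_bochner_integral_restrict_lborel_eq[OF riesz_conv_riesz[OF assms(1) zero_less_one assms(2)], of 0])
     (use assms in auto)

lemma riesz_decreasing:
  assumes "0 < \<alpha>" "\<alpha> < 1" "0 < x" "x \<le> y"
  shows "riesz (1 - \<alpha>) y \<le> riesz (1 - \<alpha>) x"
  using assms unfolding riesz_def by (intro divide_right_mono powr_mono2') (auto simp: less_imp_le)

lemma riesz_difference_ge:
  assumes "0 < \<alpha>" "\<alpha> < 1" "0 < h" "h < x" "x \<le> T"
  shows "riesz (1 - \<alpha>) (x - h) - riesz (1 - \<alpha>) x \<ge> h * (\<alpha> * T powr (- \<alpha> - 1) / Gamma (1 - \<alpha>))"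
proof -
  have "\<exists>z. x - h < z \<and> z < x \<and> x powr (- \<alpha>) - (x - h) powr (- \<alpha>) = (x - (x - h)) * (- \<alpha> * z powr (- \<alpha> - 1))"
    using assms by (intro MVT2) (auto intro!: derivative_eq_intros)
  then obtain z where z: "x - h < z" "z < x" "x powr (- \<alpha>) - (x - h) powr (- \<alpha>) = h * (- \<alpha> * z powr (- \<alpha> - 1))"
    by auto
  have "T powr (- \<alpha> - 1) \<le> z powr (- \<alpha> - 1)"
    using z assms by (intro powr_mono2') auto
  then have "h * (\<alpha> * T powr (- \<alpha> - 1)) \<le> h * (\<alpha> * z powr (- \<alpha> - 1))"
    using assms by (intro mult_left_mono) auto
  also have "\<dots> = (x - h) powr (- \<alpha>) - x powr (- \<alpha>)" using z by simp
  finally have "h * (\<alpha> * T powr (- \<alpha> - 1)) / Gamma (1 - \<alpha>) \<le> ((x - h) powr (- \<alpha>) - x powr (- \<alpha>)) / Gamma (1 - \<alpha>)"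
    using assms by (intro divide_right_mono) (auto simp: less_imp_le)
  then show ?thesis by (simp add: riesz_def diff_divide_distrib)
qed

lemma has_bochner_integral_restrict_iff:
  fixes f :: "real \<Rightarrow> real"
  shows "has_bochner_integral (restrict_space lborel {a..b}) f I
    \<longleftrightarrow> has_bochner_integral lborel (\<lambda>x. indicator {a..b} x * f x) I"
  by (simp add: has_bochner_integral_iff integrable_restrict_space integral_restrict_space)

lemma integral_riesz_shift:
  assumes "0 < \<gamma>" "0 < h"
  shows "has_bochner_integral lborel (\<lambda>\<tau>. indicator {t - h..t} \<tau> * riesz \<gamma> (t - \<tau>)) (riesz (1 + \<gamma>) h)"
proof -
  have "has_bochner_integral lborel (\<lambda>\<tau>. indicator {0..h} \<tau> * riesz \<gamma> (h - \<tau>)) (riesz (1 + \<gamma>) h)"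
    using integral_riesz[OF assms] by (simp add: has_bochner_integral_restrict_iff)
  then have "has_bochner_integral lborel (\<lambda>\<tau>. indicator {0..h} (h - t + 1 * \<tau>) * riesz \<gamma> (h - (h - t + 1 * \<tau>)))
      (riesz (1 + \<gamma>) h /\<^sub>R \<bar>1\<bar>)"
    by (subst (asm) lborel_has_bochner_integral_real_affine_iff[of 1 _ _ "h - t"]) auto
  moreover have "indicator {0..h} (h - t + 1 * \<tau>) * riesz \<gamma> (h - (h - t + 1 * \<tau>))
      = indicator {t - h..t} \<tau> * riesz \<gamma> (t - \<tau>)" for \<tau>
    by (auto simp: indicator_def)
  ultimately have "has_bochner_integral lborel (\<lambda>\<tau>. indicator {t - h..t} \<tau> * riesz \<gamma> (t - \<tau>)) (riesz (1 + \<gamma>) h /\<^sub>R \<bar>1\<bar>)"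
    by (simp only:)
  then show ?thesis by simp
qed

lemma has_bochner_integral_le_AE:
  fixes f g :: "'a \<Rightarrow> real"
  assumes "has_bochner_integral M f x" "has_bochner_integral M g y" "AE \<tau> in M. f \<tau> \<le> g \<tau>"
  shows "x \<le> y"
  using assms integral_mono_AE[of M f g] by (auto simp: has_bochner_integral_iff)

lemma has_bochner_integral_le:
  fixes f g :: "'a \<Rightarrow> real"
  assumes "has_bochner_integral M f x" "has_bochner_integral M g y" "\<And>\<tau>. f \<tau> \<le> g \<tau>"
  shows "x \<le> y"
  using assms by (intro has_bochner_integral_le_AE) auto

text \<open>Write \<open>r\<close> for this function, \<open>k\<close> for \<open>riesz (1 - \<alpha>)\<close> and \<open>y = k * r = 1 - \<kappa> (1 * r)\<close>. Near 0
  the function \<open>r\<close> is positive. Let \<open>t0\<close> be its first zero. Then \<open>y\<close> is flat at \<open>t0\<close>, because its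
  derivative is \<open>- \<kappa> r(t0) = 0\<close>. On the other hand, moving back from \<open>t0\<close> by \<open>h\<close> increases
  \<open>k * r\<close> by at least a multiple of \<open>h\<close>: the decreasing kernel gains on the part of
  \<open>r\<close> left behind, and the part of \<open>r\<close> that is cut off is small, since \<open>r\<close> vanishes to first order at
  \<open>t0\<close> and \<open>k\<close> has an integrable singularity.\<close>

lemma ml_pos:
  assumes \<alpha>: "0 < \<alpha>" "\<alpha> < 1" and \<kappa>: "0 \<le> \<kappa>" and t: "0 < t"
  shows "0 < ml_kernel \<alpha> \<kappa> \<alpha> t"
proof (rule ccontr)
  assume neg: "\<not> 0 < ml_kernel \<alpha> \<kappa> \<alpha> t"
  define m where "m \<tau> = mittag_leffler \<alpha> \<alpha> (- \<kappa> * \<tau> powr \<alpha>)" for \<tau>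
  have r_eq: "ml_kernel \<alpha> \<kappa> \<alpha> \<tau> = \<tau> powr (\<alpha> - 1) * m \<tau>" for \<tau>
    by (simp add: ml_kernel_def m_def)
  have "continuous_on UNIV (mittag_leffler \<alpha> \<alpha>)"
    using mittag_leffler_differentiable[OF \<alpha>(1) \<alpha>(1)] by (meson DERIV_isCont continuous_at_imp_continuous_on)
  then have cm: "continuous_on {0..} m"
    unfolding m_def[abs_def]
    by (rule continuous_on_compose2) (use \<alpha> in \<open>auto intro!: continuous_intros continuous_on_powr'\<close>)
  have m0: "m 0 > 0"
  proof -
    have "mittag_leffler \<alpha> \<alpha> 0 = 1 / Gamma \<alpha>"
      unfolding mittag_leffler_def by (subst suminf_finite[of "{0}"]) auto
    then show ?thesis using \<alpha> by (simp add: m_def)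
  qed
  define S where "S = {0..t} \<inter> m -` {..0}"
  have "closed S"
    unfolding S_def by (intro continuous_closed_preimage continuous_on_subset[OF cm]) auto
  moreover have "t \<in> S"
    using neg t by (simp add: S_def r_eq zero_less_mult_iff not_less)
  moreover have bdd: "bdd_below S" by (auto simp: S_def bdd_below_def)
  ultimately have InfS: "Inf S \<in> S" by (intro closed_contains_Inf) auto
  define t0 where "t0 = Inf S"
  have t0: "0 < t0" "m t0 \<le> 0"
    using InfS m0 by (auto simp: S_def t0_def less_le)
  have m_pos: "0 < m \<tau>" if "0 \<le> \<tau>" "\<tau> < t0" for \<tau>
  proof (rule ccontr)
    assume "\<not> 0 < m \<tau>"
    then have "\<tau> \<in> S" using that InfS by (auto simp: S_def t0_def)
    then have "t0 \<le> \<tau>" unfolding t0_def by (rule cInf_lower[OF _ bdd])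
    with that show False by simp
  qed
  have "m t0 = 0"
  proof -
    have "isCont m t0"
      using continuous_on_interior[OF cm, of t0] t0 by simp
    then have "(m \<longlongrightarrow> m t0) (at_left t0)"
      by (auto simp: isCont_def intro: filterlim_at_split[THEN iffD1, THEN conjunct1])
    moreover have "eventually (\<lambda>\<tau>. 0 \<le> m \<tau>) (at_left t0)"
      using eventually_at_left[of 0 t0] t0 m_pos by (auto intro!: exI[of _ 0] less_imp_le)
    ultimately have "0 \<le> m t0" by (intro tendsto_lowerbound) auto
    with t0 show ?thesis by simp
  qed
  define r where "r = ml_kernel \<alpha> \<kappa> \<alpha>"
  define k where "k = riesz (1 - \<alpha>)"
  have [measurable]: "r \<in> borel_measurable borel" "k \<in> borel_measurable borel"
    using \<alpha> by (auto simp: r_def k_def)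
  have r0: "r t0 = 0" using \<open>m t0 = 0\<close> by (simp add: r_def r_eq)
  have r_pos: "0 < r \<tau>" if "0 < \<tau>" "\<tau> < t0" for \<tau>
    using m_pos[of \<tau>] that by (simp add: r_def r_eq)
  have r_nonneg: "0 \<le> r \<tau>" if "0 \<le> \<tau>" "\<tau> \<le> t0" for \<tau>
    using r_pos[of \<tau>] r0 that by (cases "\<tau> = 0"; cases "\<tau> = t0") (auto simp: r_def)
  have k_nonneg: "0 \<le> k \<tau>" for \<tau> using \<alpha> by (simp add: k_def riesz_nonneg)
  obtain D where D: "(r has_field_derivative D) (at t0)"
    using ml_differentiable[OF \<alpha>(1) \<alpha>(1) t0(1)] unfolding r_def by blast
  define M where "M = \<bar>D\<bar> + 1"
  \<comment> \<open>first order vanishing at \<open>t0\<close>, from differentiability\<close>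
  obtain \<delta> where \<delta>: "\<delta> > 0" "\<And>\<tau>. \<bar>\<tau> - t0\<bar> < \<delta> \<Longrightarrow> r \<tau> \<le> M * \<bar>\<tau> - t0\<bar>"
  proof -
    have "((\<lambda>\<tau>. (r \<tau> - r t0) / (\<tau> - t0)) \<longlongrightarrow> D) (at t0)"
      using D by (simp add: has_field_derivative_iff)
    then have "eventually (\<lambda>\<tau>. dist ((r \<tau> - r t0) / (\<tau> - t0)) D < 1) (at t0)"
      by (rule tendstoD) simp
    then obtain \<delta> where \<delta>: "\<delta> > 0" "\<And>\<tau>. \<tau> \<noteq> t0 \<Longrightarrow> dist \<tau> t0 < \<delta> \<Longrightarrow> dist ((r \<tau> - r t0) / (\<tau> - t0)) D < 1"
      unfolding eventually_at by auto
    have "r \<tau> \<le> M * \<bar>\<tau> - t0\<bar>" if "\<bar>\<tau> - t0\<bar> < \<delta>" for \<tau>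
    proof (cases "\<tau> = t0")
      case False
      then have "\<bar>r \<tau> / (\<tau> - t0) - D\<bar> < 1" using \<delta>(2)[of \<tau>] that r0 by (simp add: dist_real_def)
      then have "\<bar>r \<tau> / (\<tau> - t0)\<bar> \<le> M" unfolding M_def by linarith
      then have "\<bar>r \<tau>\<bar> \<le> M * \<bar>\<tau> - t0\<bar>" using False by (simp add: field_simps)
      then show ?thesis by linarith
    qed (simp add: r0)
    with \<delta>(1) show thesis by (rule that)
  qed
  have M: "0 < M" by (simp add: M_def)
  obtain \<rho> where \<rho>: "0 < \<rho>" "\<And>\<tau>. t0 / 4 \<le> \<tau> \<Longrightarrow> \<tau> \<le> t0 / 2 \<Longrightarrow> \<rho> \<le> r \<tau>"
  proof -
    have "continuous_on {t0 / 4..t0 / 2} r"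
      unfolding r_def using t0 \<alpha> by (intro continuous_on_subset[OF continuous_on_ml]) auto
    then obtain x where x: "x \<in> {t0 / 4..t0 / 2}" "\<forall>y\<in>{t0 / 4..t0 / 2}. r x \<le> r y"
      using continuous_attains_inf[of "{t0 / 4..t0 / 2}" r] t0 by auto
    with r_pos[of x] t0 show thesis by (intro that[of "r x"]) auto
  qed
  define c where "c = \<alpha> * t0 powr (- \<alpha> - 1) / Gamma (1 - \<alpha>)"
  have c: "0 < c" using \<alpha> t0 by (simp add: c_def)
  have y_eq: "ml_kernel \<alpha> \<kappa> 1 s = 1 - \<kappa> * ml_kernel \<alpha> \<kappa> (\<alpha> + 1) s" if "0 < s" for s
    using ml_recurrence[of \<alpha> 1 s \<kappa>] that \<alpha> by (simp add: add.commute)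
  have I1: "has_bochner_integral lborel (\<lambda>\<tau>. indicator {0..s} \<tau> * (k (s - \<tau>) * r \<tau>)) (1 - \<kappa> * ml_kernel \<alpha> \<kappa> (\<alpha> + 1) s)"
    if "0 < s" for s
    using riesz_conv_ml[of \<alpha> \<alpha> "1 - \<alpha>" s \<kappa>] that \<alpha> y_eq[OF that]
    by (simp add: has_bochner_integral_restrict_iff r_def k_def)
  have I2: "has_bochner_integral lborel (\<lambda>\<tau>. indicator {0..s} \<tau> * r \<tau>) (ml_kernel \<alpha> \<kappa> (\<alpha> + 1) s)"
    if "0 < s" for s
    using integral_ml[of \<alpha> \<alpha> s \<kappa>] that \<alpha>
    by (simp add: has_bochner_integral_restrict_iff r_def)
  have main: "c * \<rho> * (t0 / 4) \<le> M * riesz (2 - \<alpha>) h + \<kappa> * M * h"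
    if h: "0 < h" "h < \<delta>" "h < t0 / 2" for h
  proof -
    define a where "a = t0 - h"
    have a: "t0 / 2 < a" "a < t0" "0 < a" using h t0 by (auto simp: a_def)
    have r_le: "r \<tau> \<le> M * h" if "a \<le> \<tau>" "\<tau> \<le> t0" for \<tau>
    proof -
      have "r \<tau> \<le> M * \<bar>\<tau> - t0\<bar>" using \<delta>(2)[of \<tau>] that h by (simp add: a_def)
      also have "\<dots> \<le> M * h" using that M by (intro mult_left_mono) (auto simp: a_def)
      finally show ?thesis .
    qed
    \<comment> \<open>a lower bound for the change of the integrand of \<open>k * r\<close>: the gain on \<open>[t0/4, t0/2]\<close> minus the
        part cut off\<close>
    define L where "L \<tau> = h * c * \<rho> * indicator {t0 / 4..t0 / 2} \<tau> - M * h * (indicator {t0 - h..t0} \<tau> * k (t0 - \<tau>))" for \<tau>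
    have IL: "has_bochner_integral lborel L (h * c * \<rho> * (t0 / 4) - M * h * riesz (1 + (1 - \<alpha>)) h)"
    proof -
      have "has_bochner_integral lborel (indicator {t0 / 4..t0 / 2}) (measure lborel {t0 / 4..t0 / 2})"
        using t0 by (intro has_bochner_integral_real_indicator) auto
      then have "has_bochner_integral lborel (indicator {t0 / 4..t0 / 2}) (t0 / 4)"
        using t0 by simp
      from has_bochner_integral_diff[OF has_bochner_integral_mult_right[OF this, of "h * c * \<rho>"]
          has_bochner_integral_mult_right[OF integral_riesz_shift[of "1 - \<alpha>" h t0], of "M * h"]]
      show ?thesis
        unfolding L_def[abs_def] k_def using \<alpha> h by simp
    qed
    have le: "L \<tau> \<le> indicator {0..a} \<tau> * (k (a - \<tau>) * r \<tau>) - indicator {0..t0} \<tau> * (k (t0 - \<tau>) * r \<tau>)" for \<tau>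
    proof -
      consider "\<tau> < 0 \<or> t0 < \<tau>" | "0 \<le> \<tau>" "\<tau> < a" | "a \<le> \<tau>" "\<tau> \<le> t0" by linarith
      then show ?thesis
      proof cases
        case 1
        then show ?thesis using t0 h a by (auto simp: L_def indicator_def)
      next
        case 2
        have diff: "k (a - \<tau>) - k (t0 - \<tau>) \<ge> h * c"
          using riesz_difference_ge[of \<alpha> h "t0 - \<tau>" t0] \<alpha> h 2 by (simp add: k_def c_def a_def algebra_simps)
        have rn: "0 \<le> r \<tau>" using 2 a by (intro r_nonneg) auto
        have "L \<tau> \<le> h * c * r \<tau>"
          using \<rho>(2)[of \<tau>] rn 2 a h c by (auto simp: L_def indicator_def a_def)
        also have "\<dots> \<le> (k (a - \<tau>) - k (t0 - \<tau>)) * r \<tau>"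
          using diff rn by (intro mult_right_mono) auto
        finally show ?thesis using 2 a by (simp add: indicator_def algebra_simps)
      next
        case 3
        have "k (t0 - \<tau>) * r \<tau> \<le> k (t0 - \<tau>) * (M * h)"
          using 3 k_nonneg by (intro mult_left_mono r_le) auto
        moreover have z: "indicator {0..a} \<tau> * (k (a - \<tau>) * r \<tau>) = 0"
          using 3 by (cases "\<tau> = a") (auto simp: k_def indicator_def)
        moreover have l: "L \<tau> = - (k (t0 - \<tau>) * (M * h))"
          using 3 a by (simp add: L_def a_def)
        moreover have i: "indicator {0..t0} \<tau> = (1::real)"
          using 3 a by simp
        ultimately show ?thesis unfolding z l i by linarith
      qed
    qed
    have "h * c * \<rho> * (t0 / 4) - M * h * riesz (1 + (1 - \<alpha>)) h
        \<le> (1 - \<kappa> * ml_kernel \<alpha> \<kappa> (\<alpha> + 1) a) - (1 - \<kappa> * ml_kernel \<alpha> \<kappa> (\<alpha> + 1) t0)"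
      using le
      by (intro has_bochner_integral_le[OF IL has_bochner_integral_diff[OF I1[OF a(3)] I1[OF t0(1)]]])
    also have "\<dots> = \<kappa> * (ml_kernel \<alpha> \<kappa> (\<alpha> + 1) t0 - ml_kernel \<alpha> \<kappa> (\<alpha> + 1) a)"
      by (simp add: algebra_simps)
    also have "\<dots> \<le> \<kappa> * (M * h * h)"
    proof (intro mult_left_mono \<kappa>)
      have "has_bochner_integral lborel (indicator {a..t0}) (measure lborel {a..t0})"
        using a by (intro has_bochner_integral_real_indicator) auto
      then have "has_bochner_integral lborel (indicator {a..t0}) h"
        using h by (simp add: a_def)
      then have "has_bochner_integral lborel (\<lambda>\<tau>. M * h * indicator {a..t0} \<tau>) (M * h * h)"
        by (rule has_bochner_integral_mult_right) 
      from has_bochner_integral_diff[OF I2[OF t0(1)] I2[OF a(3)]] this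
      show "ml_kernel \<alpha> \<kappa> (\<alpha> + 1) t0 - ml_kernel \<alpha> \<kappa> (\<alpha> + 1) a \<le> M * h * h"
        by (rule has_bochner_integral_le) (use a r_le M h in \<open>auto simp: indicator_def\<close>)
    qed
    finally have "h * (c * \<rho> * (t0 / 4)) \<le> h * (M * riesz (2 - \<alpha>) h + \<kappa> * M * h)"
      by (simp add: algebra_simps)
    then show ?thesis using h by simp
  qed
  have "((\<lambda>h. M * riesz (2 - \<alpha>) h + \<kappa> * M * h) \<longlongrightarrow> 0) (at_right 0)"
  proof -
    have "((\<lambda>h::real. h powr (1 - \<alpha>)) \<longlongrightarrow> 0) (at_right 0)"
      using \<alpha> by (intro tendsto_zero_powrI[where b = "1 - \<alpha>"]) (auto intro!: tendsto_eq_intros simp: eventually_at_filter)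
    then have "((\<lambda>h. M * (h powr (1 - \<alpha>) / Gamma (2 - \<alpha>)) + \<kappa> * M * h) \<longlongrightarrow> 0) (at_right 0)"
      by (intro tendsto_add_zero tendsto_mult_right_zero tendsto_divide_zero tendsto_ident_at)
    then show ?thesis by (simp add: riesz_def)
  qed
  moreover have "0 < c * \<rho> * (t0 / 4)" using c \<rho> t0 by simp
  ultimately have "eventually (\<lambda>h. M * riesz (2 - \<alpha>) h + \<kappa> * M * h < c * \<rho> * (t0 / 4)) (at_right 0)"
    by (rule order_tendstoD)
  moreover have "eventually (\<lambda>h. 0 < h \<and> h < min \<delta> (t0 / 2)) (at_right 0)"
    unfolding eventually_at_right_field using \<delta>(1) t0 by (intro exI[of _ "min \<delta> (t0 / 2)"]) auto
  ultimately have "eventually (\<lambda>h. False) (at_right (0::real))"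
  proof eventually_elim
    case (elim h)
    with main[of h] show ?case by simp
  qed
  then show False by simp
qed

text \<open>The solution of the scalar problem with initial value 1. For \<open>t > 0\<close> it is
  \<open>ml_kernel \<alpha> \<kappa> 1 t\<close> (lemma \<open>relax_eq_ml\<close>); the form chosen here is also right at \<open>t = 0\<close>,
  where the factor \<open>0 powr 0\<close> of the series is 0.\<close>

definition relax :: "real \<Rightarrow> real \<Rightarrow> real \<Rightarrow> real" where
  "relax \<alpha> \<kappa> t = 1 - \<kappa> * ml_kernel \<alpha> \<kappa> (1 + \<alpha>) t"

context
  fixes \<alpha> \<kappa> :: real
  assumes \<alpha>: "0 < \<alpha>" "\<alpha> < 1" and \<kappa>: "0 \<le> \<kappa>"
begin

lemma relax_0 [simp]: "relax \<alpha> \<kappa> 0 = 1"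
  by (simp add: relax_def)

lemma relax_eq_ml: "0 < t \<Longrightarrow> relax \<alpha> \<kappa> t = ml_kernel \<alpha> \<kappa> 1 t"
  using ml_recurrence[of \<alpha> 1 t \<kappa>] \<alpha> by (simp add: relax_def)

lemma continuous_on_relax: "continuous_on {0..} (relax \<alpha> \<kappa>)"
proof -
  have "continuous_on UNIV (mittag_leffler \<alpha> (1 + \<alpha>))"
    using mittag_leffler_differentiable[of \<alpha> "1 + \<alpha>"] \<alpha> by (metis DERIV_isCont add_pos_pos continuous_at_imp_continuous_on zero_less_one)
  then have "continuous_on {0..} (\<lambda>t. mittag_leffler \<alpha> (1 + \<alpha>) (- \<kappa> * t powr \<alpha>))"
    by (rule continuous_on_compose2) (use \<alpha> in \<open>auto intro!: continuous_intros continuous_on_powr'\<close>)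
  then show ?thesis
    unfolding relax_def[abs_def] ml_kernel_def using \<alpha> by (auto intro!: continuous_intros continuous_on_powr')
qed

lemma borel_measurable_relax [measurable]: "relax \<alpha> \<kappa> \<in> borel_measurable borel"
  unfolding relax_def[abs_def] using \<alpha> by (intro borel_measurable_diff borel_measurable_times borel_measurable_ml) auto

lemma integral_ml_\<alpha>: "0 < t \<Longrightarrow>
    has_bochner_integral lborel (\<lambda>\<tau>. indicator {0..t} \<tau> * ml_kernel \<alpha> \<kappa> \<alpha> \<tau>) (ml_kernel \<alpha> \<kappa> (1 + \<alpha>) t)"
  using integral_ml[of \<alpha> \<alpha> t \<kappa>] \<alpha> by (simp add: has_bochner_integral_restrict_iff add.commute)

lemma ml_nonneg: "0 \<le> t \<Longrightarrow> 0 \<le> ml_kernel \<alpha> \<kappa> \<alpha> t"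
  using ml_pos[OF \<alpha> \<kappa>, of t] by (cases "t = 0") auto

lemma relax_antimono:
  assumes "0 \<le> s" "s \<le> t"
  shows "relax \<alpha> \<kappa> t \<le> relax \<alpha> \<kappa> s"
proof -
  have "ml_kernel \<alpha> \<kappa> (1 + \<alpha>) s \<le> ml_kernel \<alpha> \<kappa> (1 + \<alpha>) t"
  proof (cases "s = 0 \<or> t = 0")
    case True
    have "0 \<le> ml_kernel \<alpha> \<kappa> (1 + \<alpha>) t" if "0 < t"
      using has_bochner_integral_zero integral_ml_\<alpha>[OF that]
      by (rule has_bochner_integral_le) (auto simp: indicator_def ml_nonneg)
    then show ?thesis using True assms by (cases "t = 0") auto
  next
    case False
    then show ?thesis using assms
      by (intro has_bochner_integral_le[OF integral_ml_\<alpha> integral_ml_\<alpha>]) (auto simp: indicator_def ml_nonneg)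
  qed
  then show ?thesis using \<kappa> by (simp add: relax_def mult_left_mono)
qed

lemma relax_le_1: "0 \<le> t \<Longrightarrow> relax \<alpha> \<kappa> t \<le> 1"
  using relax_antimono[of 0 t] by simp

text \<open>The function \<open>ml_kernel \<alpha> \<kappa> \<alpha>\<close> is the derivative of \<open>relax\<close> divided by \<open>- \<kappa>\<close>, so this is the Caputo
  form \<open>k * y' = - \<kappa> y\<close> of the relaxation equation.\<close>

lemma relax_convolution:
  "0 < t \<Longrightarrow> has_bochner_integral (restrict_space lborel {0..t})
     (\<lambda>\<tau>. riesz (1 - \<alpha>) (t - \<tau>) * ml_kernel \<alpha> \<kappa> \<alpha> \<tau>) (relax \<alpha> \<kappa> t)"
  using riesz_conv_ml[of \<alpha> \<alpha> "1 - \<alpha>" t \<kappa>] \<alpha> by (simp add: relax_eq_ml)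

lemma relax_nonneg: "0 \<le> t \<Longrightarrow> 0 \<le> relax \<alpha> \<kappa> t"
proof (cases "t = 0")
  case False
  assume "0 \<le> t"
  with False have "0 < t" by simp
  show ?thesis
    using has_bochner_integral_zero relax_convolution[OF \<open>0 < t\<close>] unfolding has_bochner_integral_restrict_iff
    by (rule has_bochner_integral_le) (use \<alpha> in \<open>auto simp: indicator_def riesz_nonneg ml_nonneg\<close>)
qed simp

lemma integral_relax:
  "0 < t \<Longrightarrow> has_bochner_integral (restrict_space lborel {0..t}) (relax \<alpha> \<kappa>) (ml_kernel \<alpha> \<kappa> 2 t)"
  by (rule has_bochner_integral_restrict_lborel_eq[of 0 t "ml_kernel \<alpha> \<kappa> 1" _ 0])
     (use integral_ml[of \<alpha> 1 t \<kappa>] \<alpha> in \<open>auto simp: relax_eq_ml\<close>)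

text \<open>The relaxation equation in integrated form: the right-hand side is \<open>- \<kappa>\<close> times the
  integral of \<open>relax \<alpha> \<kappa>\<close> over \<open>[0, t]\<close> (lemma \<open>integral_relax\<close>).\<close>

lemma relax_fractional_equation:
  assumes "0 < t"
  shows "has_bochner_integral (restrict_space lborel {0..t})
     (\<lambda>\<tau>. riesz (1 - \<alpha>) (t - \<tau>) * (relax \<alpha> \<kappa> \<tau> - 1)) (- \<kappa> * ml_kernel \<alpha> \<kappa> 2 t)"
proof -
  have "has_bochner_integral (restrict_space lborel {0..t})
     (\<lambda>\<tau>. - \<kappa> * (riesz (1 - \<alpha>) (t - \<tau>) * ml_kernel \<alpha> \<kappa> (1 + \<alpha>) \<tau>)) (- \<kappa> * ml_kernel \<alpha> \<kappa> (1 + \<alpha> + (1 - \<alpha>)) t)"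
    using assms \<alpha> by (intro has_bochner_integral_mult_right riesz_conv_ml) auto
  then show ?thesis by (simp add: relax_def algebra_simps)
qed

lemma ml_2_bounds:
  assumes "0 < t"
  shows "0 \<le> \<kappa> * ml_kernel \<alpha> \<kappa> 2 t" "\<kappa> * ml_kernel \<alpha> \<kappa> 2 t \<le> riesz (1 + (1 - \<alpha>)) t"
proof -
  have 1: "has_bochner_integral lborel (\<lambda>\<tau>. - (indicator {0..t} \<tau> * (riesz (1 - \<alpha>) (t - \<tau>) * (relax \<alpha> \<kappa> \<tau> - 1))))
      (- (- \<kappa> * ml_kernel \<alpha> \<kappa> 2 t))"
    using relax_fractional_equation[OF assms] unfolding has_bochner_integral_restrict_iff
    by (rule has_bochner_integral_minus)
  have 2: "has_bochner_integral lborel (\<lambda>\<tau>. indicator {0..t} \<tau> * riesz (1 - \<alpha>) (t - \<tau>)) (riesz (1 + (1 - \<alpha>)) t)"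
    using integral_riesz[of "1 - \<alpha>" t] \<alpha> assms by (simp add: has_bochner_integral_restrict_iff)
  have k: "0 \<le> riesz (1 - \<alpha>) (t - \<tau>)" for \<tau>
    using \<alpha> by (simp add: riesz_nonneg)
  have pt: "0 \<le> riesz (1 - \<alpha>) (t - \<tau>) * (1 - relax \<alpha> \<kappa> \<tau>)"
    "riesz (1 - \<alpha>) (t - \<tau>) * (1 - relax \<alpha> \<kappa> \<tau>) \<le> riesz (1 - \<alpha>) (t - \<tau>)" if "0 \<le> \<tau>" for \<tau>
    using k[of \<tau>] relax_le_1[OF that] relax_nonneg[OF that] mult_left_mono[of "1 - relax \<alpha> \<kappa> \<tau>" 1, OF _ k[of \<tau>]]
    by simp_all
  have "0 \<le> - (- \<kappa> * ml_kernel \<alpha> \<kappa> 2 t)"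
    using has_bochner_integral_zero 1
    by (rule has_bochner_integral_le) (use pt(1) in \<open>auto simp: indicator_def algebra_simps\<close>)
  moreover have "- (- \<kappa> * ml_kernel \<alpha> \<kappa> 2 t) \<le> riesz (1 + (1 - \<alpha>)) t"
    using 1 2 by (rule has_bochner_integral_le) (use pt(2) in \<open>auto simp: indicator_def algebra_simps\<close>)
  ultimately show "0 \<le> \<kappa> * ml_kernel \<alpha> \<kappa> 2 t" "\<kappa> * ml_kernel \<alpha> \<kappa> 2 t \<le> riesz (1 + (1 - \<alpha>)) t"
    by simp_all
qed

text \<open>As \<open>y\<close> decreases, \<open>t y(t)\<close> is at most the integral of \<open>y\<close>; by the integrated equation
  \<open>\<kappa>\<close> times the latter is the integral of \<open>k(t - \<tau>) (1 - y(\<tau>))\<close>, which is at most that of \<open>k\<close>.\<close>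

lemma relax_upper:
  assumes "0 < t"
  shows "\<kappa> * relax \<alpha> \<kappa> t \<le> t powr (- \<alpha>) / Gamma (2 - \<alpha>)"
proof -
  have m: "has_bochner_integral lborel (indicator {0..t}) t"
    using has_bochner_integral_real_indicator[of "{0..t}" lborel] assms by simp
  have "relax \<alpha> \<kappa> t * t \<le> ml_kernel \<alpha> \<kappa> 2 t"
    using has_bochner_integral_mult_right[OF m, of "relax \<alpha> \<kappa> t"] integral_relax[OF assms]
    unfolding has_bochner_integral_restrict_iff
    by (rule has_bochner_integral_le) (auto simp: indicator_def relax_antimono)
  then have "\<kappa> * (relax \<alpha> \<kappa> t * t) \<le> \<kappa> * ml_kernel \<alpha> \<kappa> 2 t"
    using \<kappa> by (intro mult_left_mono)
  also have "\<dots> \<le> riesz (1 + (1 - \<alpha>)) t"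
    using ml_2_bounds[OF assms] by simp
  also have "\<dots> = t * (t powr (- \<alpha>) / Gamma (2 - \<alpha>))"
    using powr_mult_base[of t "- \<alpha>"] assms by (simp add: riesz_def)
  finally have "t * (\<kappa> * relax \<alpha> \<kappa> t) \<le> t * (t powr (- \<alpha>) / Gamma (2 - \<alpha>))"
    by (simp only: mult_ac)
  then show ?thesis using assms by (rule mult_left_le_imp_le)
qed

text \<open>As \<open>k\<close> decreases, \<open>y(t) = (k * r)(t) \<ge> k(t) \<integral> r\<close>, and \<open>\<kappa> \<integral> r = 1 - y(t)\<close>.\<close>

lemma relax_lower:
  assumes "0 < t"
  shows "riesz (1 - \<alpha>) t \<le> (\<kappa> + riesz (1 - \<alpha>) t) * relax \<alpha> \<kappa> t"
proof -
  let ?k = "riesz (1 - \<alpha>)"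
  have "?k t * ml_kernel \<alpha> \<kappa> (1 + \<alpha>) t \<le> relax \<alpha> \<kappa> t"
  proof -
    have "has_bochner_integral (restrict_space lborel {0..t}) (ml_kernel \<alpha> \<kappa> \<alpha>) (ml_kernel \<alpha> \<kappa> (1 + \<alpha>) t)"
      using integral_ml[OF \<alpha>(1) \<alpha>(1) assms] by (simp add: add.commute)
    then have 1: "has_bochner_integral (restrict_space lborel {0..t}) (\<lambda>\<tau>. ?k t * ml_kernel \<alpha> \<kappa> \<alpha> \<tau>) (?k t * ml_kernel \<alpha> \<kappa> (1 + \<alpha>) t)"
      by (rule has_bochner_integral_mult_right)
    have "AE \<tau> in restrict_space lborel {0..t}. ?k t * ml_kernel \<alpha> \<kappa> \<alpha> \<tau> \<le> ?k (t - \<tau>) * ml_kernel \<alpha> \<kappa> \<alpha> \<tau>"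
      using AE_conjI[OF AE_restrict_lborel_neq[of t 0 t] AE_space]
    proof (rule eventually_mono)
      fix \<tau> assume "\<tau> \<noteq> t \<and> \<tau> \<in> space (restrict_space lborel {0..t})"
      then have "0 \<le> \<tau>" "\<tau> < t" by (auto simp: space_restrict_space)
      then show "?k t * ml_kernel \<alpha> \<kappa> \<alpha> \<tau> \<le> ?k (t - \<tau>) * ml_kernel \<alpha> \<kappa> \<alpha> \<tau>"
        using \<alpha> by (intro mult_right_mono riesz_decreasing ml_nonneg) auto
    qed
    then show ?thesis
      by (rule has_bochner_integral_le_AE[OF 1 relax_convolution[OF assms]])
  qed
  then have "\<kappa> * (?k t * ml_kernel \<alpha> \<kappa> (1 + \<alpha>) t) \<le> \<kappa> * relax \<alpha> \<kappa> t"
    using \<kappa> by (intro mult_left_mono)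
  then show ?thesis by (simp add: relax_def algebra_simps)
qed

end

section \<open>Uniqueness for the scalar fractional equation\<close>

lemma Sonine_identity:
  assumes "0 < \<alpha>" "\<alpha> < 1" "\<tau> < t"
  shows "has_bochner_integral lborel (\<lambda>s. indicator {\<tau>..t} s * (riesz \<alpha> (t - s) * riesz (1 - \<alpha>) (s - \<tau>))) 1"
proof -
  have "has_bochner_integral lborel (\<lambda>s. indicator {0..t - \<tau>} s * (riesz \<alpha> (t - \<tau> - s) * riesz (1 - \<alpha>) s)) 1"
    using riesz_conv_riesz[of \<alpha> "1 - \<alpha>" "t - \<tau>"] assms by (simp add: has_bochner_integral_restrict_iff)
  then have "has_bochner_integral lborel (\<lambda>s. indicator {0..t - \<tau>} (- \<tau> + 1 * s) *
      (riesz \<alpha> (t - \<tau> - (- \<tau> + 1 * s)) * riesz (1 - \<alpha>) (- \<tau> + 1 * s))) (1 /\<^sub>R \<bar>1\<bar>)"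
    by (subst (asm) lborel_has_bochner_integral_real_affine_iff[of 1 _ _ "- \<tau>"]) auto
  moreover have "indicator {0..t - \<tau>} (- \<tau> + 1 * s) *
      (riesz \<alpha> (t - \<tau> - (- \<tau> + 1 * s)) * riesz (1 - \<alpha>) (- \<tau> + 1 * s))
      = indicator {\<tau>..t} s * (riesz \<alpha> (t - s) * riesz (1 - \<alpha>) (s - \<tau>))" for s
    by (auto simp: indicator_def)
  ultimately have "has_bochner_integral lborel (\<lambda>s. indicator {\<tau>..t} s * (riesz \<alpha> (t - s) * riesz (1 - \<alpha>) (s - \<tau>))) (1 /\<^sub>R \<bar>1\<bar>)"
    by (simp only:)
  then show ?thesis by simp
qed

text \<open>By Fubini \<open>g * (k * z) = (g * k) * z\<close> for \<open>g = riesz \<alpha>\<close> and \<open>k = riesz (1 - \<alpha>)\<close>, and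
  \<open>g * k = 1\<close>: this recovers the primitive of \<open>z\<close> from \<open>k * z\<close>.\<close>

lemma Sonine_inversion:
  fixes z J :: "real \<Rightarrow> complex"
  assumes \<alpha>: "0 < \<alpha>" "\<alpha> < 1" and z: "continuous_on {0..} z" and t: "0 < t"
    and J: "\<And>r. 0 < r \<Longrightarrow> has_bochner_integral (restrict_space lborel {0..r}) (\<lambda>\<tau>. riesz (1 - \<alpha>) (r - \<tau>) *\<^sub>R z \<tau>) (J r)"
  shows "has_bochner_integral lborel (\<lambda>s. indicator {0..t} s *\<^sub>R riesz \<alpha> (t - s) *\<^sub>R J s) (integral {0..t} z)"
proof -
  define z' where "z' \<tau> = indicator {0..t} \<tau> *\<^sub>R z \<tau>" for \<tau>
  have ct: "continuous_on {0..t} z" using z by (rule continuous_on_subset) auto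
  have [measurable]: "z' \<in> borel_measurable borel"
    unfolding z'_def[abs_def] using ct by (rule borel_measurable_continuous_on_indicator[rotated]) auto
  obtain B where B: "\<And>\<tau>. norm (z' \<tau>) \<le> B" "0 \<le> B"
  proof -
    have "compact (z ` {0..t})" using ct by (intro compact_continuous_image) auto
    then obtain B where "\<forall>x\<in>z ` {0..t}. norm x \<le> B" using compact_imp_bounded bounded_iff by metis
    then have "norm (z' \<tau>) \<le> \<bar>B\<bar>" for \<tau> by (force simp: z'_def indicator_def)
    then show thesis by (intro that[of "\<bar>B\<bar>"]) auto
  qed
  \<comment> \<open>the kernel of the double convolution on the triangle \<open>0 \<le> \<tau> \<le> s \<le> t\<close>; it is integrable
      because integrating over \<open>\<tau>\<close> first gives a product of Riesz kernels\<close>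
  define \<Psi> where "\<Psi> = (\<lambda>(s, \<tau>). indicator {0..t} s * riesz \<alpha> (t - s) * (if 0 \<le> \<tau> \<and> \<tau> \<le> s then riesz (1 - \<alpha>) (s - \<tau>) else 0))"
  define \<Phi> where "\<Phi> = (\<lambda>(s, \<tau>). \<Psi> (s, \<tau>) *\<^sub>R z' \<tau>)"
  have \<Psi>_nonneg: "0 \<le> \<Psi> p" for p
    using \<alpha> by (cases p) (auto simp: \<Psi>_def riesz_nonneg)
  have [measurable]: "\<Psi> \<in> borel_measurable (lborel \<Otimes>\<^sub>M lborel)"
    unfolding \<Psi>_def by measurable
  have [measurable]: "\<Phi> \<in> borel_measurable (lborel \<Otimes>\<^sub>M lborel)"
    unfolding \<Phi>_def by measurable
  have in1: "(\<integral>\<^sup>+\<tau>. ennreal (\<Psi> (s, \<tau>)) \<partial>lborel) = ennreal (indicator {0..t} s * (riesz \<alpha> (t - s) * riesz (1 + (1 - \<alpha>)) s))"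
    if "s \<noteq> 0" for s
  proof (cases "0 < s \<and> s \<le> t")
    case True
    have "has_bochner_integral lborel (\<lambda>\<tau>. riesz \<alpha> (t - s) * (indicator {0..s} \<tau> * riesz (1 - \<alpha>) (s - \<tau>))) (riesz \<alpha> (t - s) * riesz (1 + (1 - \<alpha>)) s)"
      using integral_riesz[of "1 - \<alpha>" s] True \<alpha>
      by (intro has_bochner_integral_mult_right) (simp add: has_bochner_integral_restrict_iff)
    also have "(\<lambda>\<tau>. riesz \<alpha> (t - s) * (indicator {0..s} \<tau> * riesz (1 - \<alpha>) (s - \<tau>))) = (\<lambda>\<tau>. \<Psi> (s, \<tau>))"
      using True by (auto simp: \<Psi>_def indicator_def)
    finally show ?thesis using True
      by (subst nn_integral_eq_integral) (auto simp: has_bochner_integral_iff \<Psi>_nonneg)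
  next
    case False
    then have "\<Psi> (s, \<tau>) = 0" for \<tau> using that by (auto simp: \<Psi>_def indicator_def)
    moreover have "indicator {0..t} s = (0::real)" using False that by (auto simp: indicator_def)
    ultimately show ?thesis by simp
  qed
  have \<Psi>_fin: "(\<integral>\<^sup>+p. ennreal (\<Psi> p) \<partial>(lborel \<Otimes>\<^sub>M lborel)) < \<infinity>"
  proof -
    have "(\<integral>\<^sup>+p. ennreal (\<Psi> p) \<partial>(lborel \<Otimes>\<^sub>M lborel)) = (\<integral>\<^sup>+s. \<integral>\<^sup>+\<tau>. ennreal (\<Psi> (s, \<tau>)) \<partial>lborel \<partial>lborel)"
      by (rule lborel.nn_integral_fst[symmetric]) measurable
    also have "\<dots> = (\<integral>\<^sup>+s. ennreal (indicator {0..t} s * (riesz \<alpha> (t - s) * riesz (1 + (1 - \<alpha>)) s)) \<partial>lborel)"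
      using AE_lborel_singleton[of 0] by (intro nn_integral_cong_AE) (auto simp: in1 elim: eventually_mono)
    also have "\<dots> < \<infinity>"
      using riesz_conv_riesz[of \<alpha> "1 + (1 - \<alpha>)" t, THEN has_bochner_integral_restrict_iff[THEN iffD1]] \<alpha> t
      by (subst nn_integral_eq_integral) (auto simp: riesz_nonneg has_bochner_integral_iff)
    finally show ?thesis .
  qed
  have \<Phi>_int: "integrable (lborel \<Otimes>\<^sub>M lborel) \<Phi>"
  proof (rule Bochner_Integration.integrable_bound)
    show "integrable (lborel \<Otimes>\<^sub>M lborel) (\<lambda>p. B * \<Psi> p)"
      using \<Psi>_fin by (intro integrable_mult_right integrableI_nonneg) (auto simp: \<Psi>_nonneg)
    show "AE p in lborel \<Otimes>\<^sub>M lborel. norm (\<Phi> p) \<le> norm (B * \<Psi> p)"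
      using B \<Psi>_nonneg by (intro AE_I2) (auto simp: \<Phi>_def abs_mult mult.commute[of B] intro!: mult_left_mono)
  qed measurable
  have in2: "(\<integral>\<tau>. \<Phi> (s, \<tau>) \<partial>lborel) = indicator {0..t} s *\<^sub>R riesz \<alpha> (t - s) *\<^sub>R J s" if "s \<noteq> 0" for s
  proof (cases "0 < s \<and> s \<le> t")
    case True
    then have "(\<integral>\<tau>. indicator {0..s} \<tau> *\<^sub>R riesz (1 - \<alpha>) (s - \<tau>) *\<^sub>R z \<tau> \<partial>lborel) = J s"
      using J[of s] by (simp add: has_bochner_integral_iff integral_restrict_space)
    then have "(\<integral>\<tau>. riesz \<alpha> (t - s) *\<^sub>R indicator {0..s} \<tau> *\<^sub>R riesz (1 - \<alpha>) (s - \<tau>) *\<^sub>R z \<tau> \<partial>lborel) = riesz \<alpha> (t - s) *\<^sub>R J s"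
      by (simp only: integral_scaleR_right)
    also have "(\<lambda>\<tau>. riesz \<alpha> (t - s) *\<^sub>R indicator {0..s} \<tau> *\<^sub>R riesz (1 - \<alpha>) (s - \<tau>) *\<^sub>R z \<tau>) = (\<lambda>\<tau>. \<Phi> (s, \<tau>))"
      using True by (auto simp: \<Phi>_def \<Psi>_def z'_def indicator_def)
    finally show ?thesis using True by simp
  next
    case False
    then have "\<Phi> (s, \<tau>) = 0" for \<tau> using that by (auto simp: \<Phi>_def \<Psi>_def indicator_def)
    moreover have "indicator {0..t} s = (0::real)" using False that by (auto simp: indicator_def)
    ultimately show ?thesis by simp
  qed
  have in3: "(\<integral>s. \<Phi> (s, \<tau>) \<partial>lborel) = z' \<tau>" if "\<tau> \<noteq> t" for \<tau>
  proof (cases "0 \<le> \<tau> \<and> \<tau> < t")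
    case True
    have "has_bochner_integral lborel (\<lambda>s. (indicator {\<tau>..t} s * (riesz \<alpha> (t - s) * riesz (1 - \<alpha>) (s - \<tau>))) *\<^sub>R z' \<tau>) (1 *\<^sub>R z' \<tau>)"
      using True \<alpha> by (intro has_bochner_integral_scaleR_left Sonine_identity) auto
    also have "(\<lambda>s. (indicator {\<tau>..t} s * (riesz \<alpha> (t - s) * riesz (1 - \<alpha>) (s - \<tau>))) *\<^sub>R z' \<tau>) = (\<lambda>s. \<Phi> (s, \<tau>))"
      using True by (auto simp: \<Phi>_def \<Psi>_def indicator_def)
    finally show ?thesis by (simp add: has_bochner_integral_iff)
  next
    case False
    then have "z' \<tau> = 0" using that by (auto simp: z'_def indicator_def)
    then show ?thesis by (simp add: \<Phi>_def)
  qed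
  have meas: "(\<lambda>s. \<integral>\<tau>. \<Phi> (s, \<tau>) \<partial>lborel) \<in> borel_measurable lborel"
    by measurable
  have J_meas: "(\<lambda>s. indicator {0..t} s *\<^sub>R riesz \<alpha> (t - s) *\<^sub>R J s) \<in> borel_measurable lborel"
  proof -
    have "(\<lambda>s. if s = 0 then (riesz \<alpha> t *\<^sub>R J 0) else (\<integral>\<tau>. \<Phi> (s, \<tau>) \<partial>lborel)) \<in> borel_measurable lborel"
      by measurable
    also have "(\<lambda>s. if s = 0 then (riesz \<alpha> t *\<^sub>R J 0) else (\<integral>\<tau>. \<Phi> (s, \<tau>) \<partial>lborel)) = (\<lambda>s. indicator {0..t} s *\<^sub>R riesz \<alpha> (t - s) *\<^sub>R J s)"
      using in2 t by auto
    finally show ?thesis .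
  qed
  have "has_bochner_integral lborel (\<lambda>s. \<integral>\<tau>. \<Phi> (s, \<tau>) \<partial>lborel) (\<integral>\<tau>. (\<integral>s. \<Phi> (s, \<tau>) \<partial>lborel) \<partial>lborel)"
    using lborel_pair.integrable_fst[of "\<lambda>s \<tau>. \<Phi> (s, \<tau>)"] lborel_pair.Fubini_integral[of "\<lambda>s \<tau>. \<Phi> (s, \<tau>)"] \<Phi>_int
    by (simp add: has_bochner_integral_iff)
  moreover have "(\<integral>\<tau>. (\<integral>s. \<Phi> (s, \<tau>) \<partial>lborel) \<partial>lborel) = integral\<^sup>L lborel z'"
    using AE_lborel_singleton[of t] by (intro integral_cong_AE) (auto simp: in3 elim: eventually_mono)
  moreover have "integral\<^sup>L lborel z' = integral {0..t} z"
    using set_borel_integral_eq_integral(2)[OF borel_integrable_atLeastAtMost'[OF ct]]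
    by (simp add: set_lebesgue_integral_def z'_def[abs_def])
  ultimately have *: "has_bochner_integral lborel (\<lambda>s. \<integral>\<tau>. \<Phi> (s, \<tau>) \<partial>lborel) (integral {0..t} z)"
    by simp
  have "AE s in lborel. (\<integral>\<tau>. \<Phi> (s, \<tau>) \<partial>lborel) = indicator {0..t} s *\<^sub>R riesz \<alpha> (t - s) *\<^sub>R J s"
    using AE_lborel_singleton[of 0] by (auto simp: in2 elim: eventually_mono)
  from has_bochner_integral_cong_AE[OF meas J_meas this] * show ?thesis by simp
qed

text \<open>Iterating \<open>Z = c (riesz \<alpha> * Z)\<close> bounds \<open>\<bar>Z\<bar>\<close> by a constant times
  \<open>\<bar>c\<bar>\<^sup>n riesz (\<alpha> n + 1)\<close>, the general term of a convergent Mittag-Leffler series.\<close>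

lemma fractional_Gronwall:
  fixes Z :: "real \<Rightarrow> complex"
  assumes \<alpha>: "0 < \<alpha>" and Z: "continuous_on {0..} Z"
    and int: "\<And>t. 0 < t \<Longrightarrow> has_bochner_integral lborel (\<lambda>s. indicator {0..t} s *\<^sub>R riesz \<alpha> (t - s) *\<^sub>R (c * Z s)) (Z t)"
    and t: "0 < t"
  shows "Z t = 0"
proof -
  have "compact (Z ` {0..t})"
    by (intro compact_continuous_image continuous_on_subset[OF Z]) auto
  then obtain B where B: "\<And>s. s \<in> {0..t} \<Longrightarrow> norm (Z s) \<le> B"
    using compact_imp_bounded bounded_iff by (metis image_eqI)
  have bound: "norm (Z s) \<le> B * (cmod c ^ n * riesz (\<alpha> * real n + 1) s)" if "0 < s" "s \<le> t" for n s
    using that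
  proof (induction n arbitrary: s)
    case 0
    then show ?case using B[of s] by simp
  next
    case (Suc n)
    let ?G = "\<lambda>\<sigma>. indicator {0..s} \<sigma> *\<^sub>R riesz \<alpha> (s - \<sigma>) *\<^sub>R (c * Z \<sigma>)"
    have pos: "0 < \<alpha> * real n + 1" using \<alpha> by (simp add: add_nonneg_pos)
    have 1: "has_bochner_integral lborel (\<lambda>\<sigma>. B * cmod c ^ Suc n * (indicator {0..s} \<sigma> * (riesz \<alpha> (s - \<sigma>) * riesz (\<alpha> * real n + 1) \<sigma>)))
        (B * cmod c ^ Suc n * riesz (\<alpha> * real n + 1 + \<alpha>) s)"
      using riesz_conv_riesz[OF \<alpha> pos Suc.prems(1)]
      by (intro has_bochner_integral_mult_right) (simp add: has_bochner_integral_restrict_iff)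
    have int_norm: "has_bochner_integral lborel (\<lambda>\<sigma>. norm (?G \<sigma>))
        (\<integral>\<sigma>. norm (?G \<sigma>) \<partial>lborel)"
      using int[OF Suc.prems(1)] unfolding has_bochner_integral_iff by (simp only: integrable_norm simp_thms)
    have 2: "AE \<sigma> in lborel. norm (?G \<sigma>)
        \<le> B * cmod c ^ Suc n * (indicator {0..s} \<sigma> * (riesz \<alpha> (s - \<sigma>) * riesz (\<alpha> * real n + 1) \<sigma>))"
      using AE_lborel_singleton[of 0]
    proof (rule eventually_mono)
      fix \<sigma> :: real assume "\<sigma> \<noteq> 0"
      show "norm (?G \<sigma>)
        \<le> B * cmod c ^ Suc n * (indicator {0..s} \<sigma> * (riesz \<alpha> (s - \<sigma>) * riesz (\<alpha> * real n + 1) \<sigma>))"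
      proof (cases "0 \<le> \<sigma> \<and> \<sigma> \<le> s")
        case True
        then have "riesz \<alpha> (s - \<sigma>) * (cmod c * norm (Z \<sigma>)) \<le> riesz \<alpha> (s - \<sigma>) * (cmod c * (B * (cmod c ^ n * riesz (\<alpha> * real n + 1) \<sigma>)))"
          using Suc.IH[of \<sigma>] Suc.prems \<open>\<sigma> \<noteq> 0\<close> \<alpha> by (intro mult_left_mono riesz_nonneg) auto
        then show ?thesis using True \<alpha> by (simp add: norm_mult riesz_nonneg mult_ac)
      qed auto
    qed
    have "(\<integral>\<sigma>. norm (?G \<sigma>) \<partial>lborel) \<le> B * cmod c ^ Suc n * riesz (\<alpha> * real n + 1 + \<alpha>) s"
      by (rule has_bochner_integral_le_AE[OF int_norm 1 2])
    moreover have "norm (Z s) \<le> (\<integral>\<sigma>. norm (?G \<sigma>) \<partial>lborel)"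
      using integral_norm_bound[of lborel "?G"]
        has_bochner_integral_integral_eq[OF int[OF Suc.prems(1)]] by simp
    moreover have "\<alpha> * real n + 1 + \<alpha> = \<alpha> * real (Suc n) + 1" by (simp add: algebra_simps)
    ultimately show ?case by (simp add: mult.assoc)
  qed
  have "(\<lambda>n. B * (cmod c ^ n * riesz (\<alpha> * real n + 1) t)) \<longlonglongrightarrow> B * 0"
    using \<alpha> t by (intro tendsto_mult_left summable_LIMSEQ_zero summable_riesz) auto
  then have "norm (Z t) \<le> B * 0"
    by (rule LIMSEQ_le_const) (use bound t in auto)
  then show ?thesis by simp
qed

text \<open>Let \<open>Z\<close> be the primitive of \<open>z\<close>. The hypothesis on the derivative and \<open>J(0+) = 0\<close> give \<open>J = c Z\<close>.
  Convolving with \<open>riesz \<alpha>\<close> turns the left-hand side into \<open>Z\<close>, so \<open>Z\<close> solves the homogeneous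
  Volterra equation of the preceding lemma.\<close>

lemma fractional_ivp_unique:
  fixes z J :: "real \<Rightarrow> complex"
  assumes \<alpha>: "0 < \<alpha>" "\<alpha> < 1" and z: "continuous_on {0..} z"
    and J: "\<And>r. 0 < r \<Longrightarrow> has_bochner_integral (restrict_space lborel {0..r}) (\<lambda>\<tau>. riesz (1 - \<alpha>) (r - \<tau>) *\<^sub>R z \<tau>) (J r)"
    and deriv: "\<And>t. 0 < t \<Longrightarrow> ((\<lambda>h. (J (t + h) - J t) /\<^sub>R h) \<longlongrightarrow> c * z t) (at 0)"
    and t: "0 \<le> t"
  shows "z t = 0"
proof -
  define Z where "Z t = integral {0..t} z" for t
  have cz: "continuous_on {0..b} z" for b using z by (rule continuous_on_subset) auto
  have dZ_within: "(Z has_vector_derivative z t) (at t within {0..b})" if "0 \<le> t" "t \<le> b" for t b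
    unfolding Z_def using that by (intro integral_has_vector_derivative cz) auto
  have dZ: "(Z has_vector_derivative z t) (at t)" if "0 < t" for t
    using dZ_within[of t "t + 1"] that at_within_interior[of t "{0..t + 1}"] by simp
  have contZ: "continuous_on {0..} Z"
  proof (intro continuous_on_eq_continuous_within[THEN iffD2] ballI)
    fix x :: real assume "x \<in> {0..}"
    then have "continuous (at x within {0..x + 1}) Z"
      using dZ_within[of x "x + 1"] has_vector_derivative_continuous by auto
    moreover have "at x within {0..x + 1} = at x within {0..}"
      by (rule at_within_nhd[of _ "{x - 1<..<x + 1}"]) auto
    ultimately show "continuous (at x within {0..}) Z" by simp
  qed
  have dJ: "(J has_vector_derivative c * z t) (at t)" if "0 < t" for t
    unfolding has_vector_derivative_def has_derivative_at
  proof (intro conjI bounded_linear_scaleR_left)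
    have "((\<lambda>h. norm ((J (t + h) - J t) /\<^sub>R h - c * z t)) \<longlongrightarrow> 0) (at 0)"
      using deriv[OF that] by (simp add: tendsto_norm_zero_iff LIM_zero_iff)
    moreover have "eventually (\<lambda>h. norm ((J (t + h) - J t) /\<^sub>R h - c * z t) = norm (J (t + h) - J t - h *\<^sub>R (c * z t)) / norm h) (at 0)"
      unfolding eventually_at_filter
    proof (intro always_eventually allI impI)
      fix h :: real assume "h \<noteq> 0"
      then have "(J (t + h) - J t) /\<^sub>R h - c * z t = (J (t + h) - J t - h *\<^sub>R (c * z t)) /\<^sub>R h"
        by (simp add: scaleR_diff_right)
      then show "norm ((J (t + h) - J t) /\<^sub>R h - c * z t) = norm (J (t + h) - J t - h *\<^sub>R (c * z t)) / norm h"
        by (simp add: divide_inverse mult.commute)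
    qed
    ultimately show "((\<lambda>h. norm (J (t + h) - J t - h *\<^sub>R (c * z t)) / norm h) \<longlongrightarrow> 0) (at 0)"
      by (rule Lim_transform_eventually)
  qed
  have dJZ: "((\<lambda>x. J x - c * Z x) has_vector_derivative 0) (at x within {0<..})" if "x \<in> {0<..}" for x
  proof -
    have "((\<lambda>x. J x - c * Z x) has_vector_derivative (c * z x - c * z x)) (at x)"
      using that by (intro has_vector_derivative_diff has_vector_derivative_mult_right dJ dZ) auto
    then show ?thesis by (simp add: has_vector_derivative_at_within)
  qed
  obtain d where d: "\<And>x. 0 < x \<Longrightarrow> J x - c * Z x = d"
    using has_vector_derivative_zero_constant[OF convex_real_interval(3) dJZ] by (metis greaterThan_iff)
  have "compact (z ` {0..1})" by (intro compact_continuous_image cz) auto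
  then obtain B where B: "\<And>s. s \<in> {0..1} \<Longrightarrow> norm (z s) \<le> B"
    using compact_imp_bounded bounded_iff by (metis image_eqI)
  have J_le: "norm (J r) \<le> riesz (1 + (1 - \<alpha>)) r * B" if r: "0 < r" "r < 1" for r
  proof -
    have 1: "has_bochner_integral (restrict_space lborel {0..r}) (\<lambda>\<tau>. riesz (1 - \<alpha>) (r - \<tau>) * B) (riesz (1 + (1 - \<alpha>)) r * B)"
      using integral_riesz[of "1 - \<alpha>" r] \<alpha> r by (intro has_bochner_integral_mult_left) auto
    have "norm (J r) \<le> (\<integral>\<tau>. norm (riesz (1 - \<alpha>) (r - \<tau>) *\<^sub>R z \<tau>) \<partial>restrict_space lborel {0..r})"
      using integral_norm_bound[of "restrict_space lborel {0..r}" "\<lambda>\<tau>. riesz (1 - \<alpha>) (r - \<tau>) *\<^sub>R z \<tau>"]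
        has_bochner_integral_integral_eq[OF J[OF r(1)]] by simp
    also have "\<dots> \<le> (\<integral>\<tau>. riesz (1 - \<alpha>) (r - \<tau>) * B \<partial>restrict_space lborel {0..r})"
    proof (rule integral_mono)
      show "integrable (restrict_space lborel {0..r}) (\<lambda>\<tau>. norm (riesz (1 - \<alpha>) (r - \<tau>) *\<^sub>R z \<tau>))"
        using J[OF r(1)] by (intro integrable_norm) (simp add: has_bochner_integral_iff)
      show "integrable (restrict_space lborel {0..r}) (\<lambda>\<tau>. riesz (1 - \<alpha>) (r - \<tau>) * B)"
        using 1 unfolding has_bochner_integral_iff by (rule conjunct1)
    qed (use B r \<alpha> in \<open>auto simp: space_restrict_space riesz_nonneg intro!: mult_left_mono\<close>)
    also have "\<dots> = riesz (1 + (1 - \<alpha>)) r * B"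
      using 1 by (simp add: has_bochner_integral_iff)
    finally show ?thesis .
  qed
  have "d = 0"
  proof -
    have "((\<lambda>r::real. r powr (1 - \<alpha>)) \<longlongrightarrow> 0) (at_right 0)"
      using \<alpha> by (intro tendsto_zero_powrI[where b = "1 - \<alpha>"]) (auto intro!: tendsto_eq_intros simp: eventually_at_filter)
    then have "((\<lambda>r. r powr (1 - \<alpha>) / Gamma (2 - \<alpha>) * B) \<longlongrightarrow> 0) (at_right 0)"
      by (intro tendsto_mult_left_zero tendsto_divide_zero)
    then have 1: "((\<lambda>r. riesz (1 + (1 - \<alpha>)) r * B) \<longlongrightarrow> 0) (at_right 0)"
      by (simp add: riesz_def)
    have "eventually (\<lambda>r::real. 0 < r \<and> r < 1) (at_right 0)"
      by (auto simp: eventually_at_right_field intro!: exI[of _ 1])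
    then have "eventually (\<lambda>r. norm (J r) \<le> riesz (1 + (1 - \<alpha>)) r * B) (at_right 0)"
      by (rule eventually_mono) (use J_le in blast)
    then have "(J \<longlongrightarrow> 0) (at_right 0)"
      using 1 by (rule Lim_null_comparison)
    moreover have "(Z \<longlongrightarrow> Z 0) (at_right 0)"
      using contZ by (intro tendsto_within_subset[of Z _ 0 "{0..}" "{0<..}"]) (auto simp: continuous_on_def)
    then have "((\<lambda>r. c * Z r) \<longlongrightarrow> c * Z 0) (at_right 0)" by (rule tendsto_mult_left)
    ultimately have "((\<lambda>r. J r - c * Z r) \<longlongrightarrow> 0 - c * Z 0) (at_right 0)"
      by (rule tendsto_diff)
    moreover have "((\<lambda>r. J r - c * Z r) \<longlongrightarrow> d) (at_right 0)"
      by (rule tendsto_eventually) (auto simp: eventually_at_filter d)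
    ultimately have "d = 0 - c * Z 0" by (intro tendsto_unique[of "at_right 0"]) auto
    then show ?thesis by (simp add: Z_def)
  qed
  have "Z t = 0" if "0 < t" for t
  proof (rule fractional_Gronwall[OF \<alpha>(1) contZ _ that])
    fix t :: real assume t: "0 < t"
    have 1: "has_bochner_integral lborel (\<lambda>s. indicator {0..t} s *\<^sub>R riesz \<alpha> (t - s) *\<^sub>R J s) (Z t)"
      unfolding Z_def by (rule Sonine_inversion[OF \<alpha> z t J])
    have 2: "AE s in lborel. indicator {0..t} s *\<^sub>R riesz \<alpha> (t - s) *\<^sub>R J s = indicator {0..t} s *\<^sub>R riesz \<alpha> (t - s) *\<^sub>R (c * Z s)"
      using AE_lborel_singleton[of 0]
    proof (rule eventually_mono)
      fix s :: real assume "s \<noteq> 0"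
      then show "indicator {0..t} s *\<^sub>R riesz \<alpha> (t - s) *\<^sub>R J s = indicator {0..t} s *\<^sub>R riesz \<alpha> (t - s) *\<^sub>R (c * Z s)"
        using d[of s] \<open>d = 0\<close> by (cases "0 < s") (auto simp: indicator_def)
    qed
    have 3: "(\<lambda>s. indicator {0..t} s *\<^sub>R riesz \<alpha> (t - s) *\<^sub>R (c * Z s)) \<in> borel_measurable lborel"
    proof -
      have [measurable]: "(\<lambda>s. indicator {0..t} s *\<^sub>R Z s) \<in> borel_measurable borel"
        by (rule borel_measurable_continuous_on_indicator[OF _ continuous_on_subset[OF contZ]]) auto
      have "(\<lambda>s. riesz \<alpha> (t - s) *\<^sub>R (c * (indicator {0..t} s *\<^sub>R Z s))) \<in> borel_measurable lborel"
        by measurable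
      then show ?thesis by (simp add: mult_ac scaleR_conv_of_real)
    qed
    show "has_bochner_integral lborel (\<lambda>s. indicator {0..t} s *\<^sub>R riesz \<alpha> (t - s) *\<^sub>R (c * Z s)) (Z t)"
      using has_bochner_integral_cong_AE[OF borel_measurable_has_bochner_integral[OF 1] 3 2] 1 by simp
  qed
  then have Z0: "Z t = 0" if "0 \<le> t" for t using that by (cases "t = 0") (auto simp: Z_def)
  have z0: "z t = 0" if "0 < t" for t
  proof -
    have "((\<lambda>_. 0) has_vector_derivative z t) (at t)"
      by (rule has_vector_derivative_transform_within_open[OF dZ[OF that], of "{0<..}"]) (use that Z0 in auto)
    then show ?thesis
      by (rule vector_derivative_unique_at[OF has_vector_derivative_const, symmetric])
  qed
  show ?thesis
  proof (cases "t = 0")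
    case True
    have "(z \<longlongrightarrow> z 0) (at_right 0)"
      using z by (intro tendsto_within_subset[of z _ 0 "{0..}" "{0<..}"]) (auto simp: continuous_on_def)
    moreover have "(z \<longlongrightarrow> 0) (at_right 0)"
      by (rule tendsto_eventually) (auto simp: eventually_at_filter z0)
    ultimately show ?thesis using True tendsto_unique[of "at_right (0::real)" z] by auto
  qed (use t z0 in auto)
qed

section \<open>Absolutely convergent series in the Hilbert space\<close>

lemma abs_sphere_L2_sum:
  assumes "\<And>n. n \<in> A \<Longrightarrow> square_integrable (f n)" "finite A"
  shows "square_integrable (\<lambda>x. \<Sum>n\<in>A. f n x) \<and>
    (\<Sum>n\<in>A. abs_sphere_L2 (f n)) = abs_sphere_L2 (\<lambda>x. \<Sum>n\<in>A. f n x)"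
  using assms(2,1)
proof (induction rule: finite_induct)
  case empty
  show ?case by (simp add: zero_sphere_L2_def square_integrable_def)
next
  case (insert a A)
  then show ?case
    by (auto simp: plus_sphere_L2.abs_eq L2_rel_def intro!: square_integrable_add)
qed

lemma norm_abs_sphere_L2:
  "square_integrable f \<Longrightarrow> norm (abs_sphere_L2 f) = sqrt (\<integral>x. (cmod (f x))\<^sup>2 \<partial>sph_measure)"
  by (simp add: norm_sphere_L2.abs_eq L2_rel_def)

lemma minus_abs_sphere_L2:
  assumes "square_integrable f" "square_integrable g"
  shows "abs_sphere_L2 f - abs_sphere_L2 g = abs_sphere_L2 (\<lambda>x. f x - g x)"
  using assms square_integrable_cmult[of g "-1"]
  by (simp add: minus_sphere_L2_def uminus_sphere_L2.abs_eq plus_sphere_L2.abs_eq L2_rel_def)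

text \<open>The argument of Riesz and Fischer: by monotone convergence the pointwise sum of the moduli is
  square integrable with norm at most the sum of the norms. So the series converges almost everywhere, and
  the squared distances to the partial sums are dominated by an integrable function.\<close>

lemma summable_sphere_L2:
  fixes g :: "nat \<Rightarrow> sphere_L2"
  assumes "summable (\<lambda>n. norm (g n))"
  shows "summable g"
proof -
  have "\<exists>f. square_integrable f \<and> abs_sphere_L2 f = u" for u
    by (induct u rule: sphere_L2.abs_induct) (auto simp: L2_rel_def)
  then have "\<forall>n. \<exists>f. square_integrable f \<and> abs_sphere_L2 f = g n" by blast
  from choice[OF this]
  obtain f where f: "\<And>n. square_integrable (f n)" "\<And>n. abs_sphere_L2 (f n) = g n"
    by blast
  have [measurable]: "f n \<in> borel_measurable sph_measure" for n
    using f(1)[of n] by (simp add: square_integrable_def)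
  define C where "C = (\<Sum>n. norm (g n))"
  define h where "h n x = complex_of_real (cmod (f n x))" for n x
  have h: "square_integrable (h n)" for n
    using f(1)[of n] by (simp add: square_integrable_def h_def[abs_def])
  have norm_h: "norm (abs_sphere_L2 (h n)) = norm (g n)" for n
    using norm_abs_sphere_L2[OF h[of n]] norm_abs_sphere_L2[OF f(1)[of n]] f(2)[of n] by (simp add: h_def)
  define H where "H N x = (\<Sum>n<N. cmod (f n x))" for N x
  have H_eq: "(\<lambda>x. \<Sum>n<N. h n x) = (\<lambda>x. complex_of_real (H N x))" for N
    by (simp add: h_def H_def)
  have H_int: "integrable sph_measure (\<lambda>x. (H N x)\<^sup>2)" and H_le: "(\<integral>x. (H N x)\<^sup>2 \<partial>sph_measure) \<le> C\<^sup>2" for N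
  proof -
    have sq: "square_integrable (\<lambda>x. complex_of_real (H N x))"
      and eq: "(\<Sum>n<N. abs_sphere_L2 (h n)) = abs_sphere_L2 (\<lambda>x. complex_of_real (H N x))"
      using abs_sphere_L2_sum[of "{..<N}" h] h by (simp_all add: H_eq)
    then show "integrable sph_measure (\<lambda>x. (H N x)\<^sup>2)"
      by (simp add: square_integrable_def)
    have "sqrt (\<integral>x. (H N x)\<^sup>2 \<partial>sph_measure) = norm (\<Sum>n<N. abs_sphere_L2 (h n))"
      using norm_abs_sphere_L2[OF sq] eq by simp
    also have "\<dots> \<le> (\<Sum>n<N. norm (g n))"
      using norm_sum[of "\<lambda>n. abs_sphere_L2 (h n)" "{..<N}"] by (simp add: norm_h)
    also have "\<dots> \<le> C"
      unfolding C_def by (rule sum_le_suminf[OF assms]) auto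
    finally have "(sqrt (\<integral>x. (H N x)\<^sup>2 \<partial>sph_measure))\<^sup>2 \<le> C\<^sup>2"
      by (rule power_mono) simp
    then show "(\<integral>x. (H N x)\<^sup>2 \<partial>sph_measure) \<le> C\<^sup>2" by simp
  qed
  have H_nonneg: "0 \<le> H N x" for N x by (auto simp: H_def intro: sum_nonneg)
  have H_mono: "H N x \<le> H N' x" if "N \<le> N'" for N N' x
    unfolding H_def using that by (intro sum_mono2) auto
  \<comment> \<open>finite almost everywhere, and then the square of the sum of the moduli is at most \<open>T x\<close>\<close>
  define T where "T x = (SUP N. ennreal ((H N x)\<^sup>2))" for x
  have [measurable]: "H N \<in> borel_measurable sph_measure" for N
    unfolding H_def[abs_def] by measurable
  have [measurable]: "T \<in> borel_measurable sph_measure"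
    unfolding T_def[abs_def] by measurable
  have "(\<integral>\<^sup>+x. T x \<partial>sph_measure) = (SUP N. \<integral>\<^sup>+x. ennreal ((H N x)\<^sup>2) \<partial>sph_measure)"
    unfolding T_def
    by (rule nn_integral_monotone_convergence_SUP)
       (auto simp: incseq_def le_fun_def intro!: ennreal_leI power_mono H_mono H_nonneg)
  also have "\<dots> \<le> ennreal (C\<^sup>2)"
  proof (rule SUP_least)
    fix N
    show "(\<integral>\<^sup>+x. ennreal ((H N x)\<^sup>2) \<partial>sph_measure) \<le> ennreal (C\<^sup>2)"
      using H_le by (subst nn_integral_eq_integral[OF H_int]) (auto intro: ennreal_leI)
  qed
  finally have T_int: "(\<integral>\<^sup>+x. T x \<partial>sph_measure) < \<infinity>"
    by (rule order.strict_trans1) simp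
  then have T_fin: "AE x in sph_measure. T x \<noteq> \<infinity>"
    by (intro nn_integral_noteq_infinite) auto
  define w where "w x = enn2real (T x)" for x
  have w_int: "integrable sph_measure w"
  proof (rule integrableI_nonneg)
    have "(\<integral>\<^sup>+x. ennreal (w x) \<partial>sph_measure) \<le> (\<integral>\<^sup>+x. T x \<partial>sph_measure)"
      unfolding w_def by (intro nn_integral_mono) (simp add: ennreal_enn2real_if)
    with T_int show "(\<integral>\<^sup>+x. ennreal (w x) \<partial>sph_measure) < \<infinity>" by (rule order.strict_trans1[rotated])
  qed (auto simp: w_def[abs_def])
  have H_w: "(H N x)\<^sup>2 \<le> w x" if "T x \<noteq> \<infinity>" for N x
  proof -
    have "ennreal ((H N x)\<^sup>2) \<le> T x" unfolding T_def by (rule SUP_upper) simp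
    also have "T x = ennreal (w x)" using that by (simp add: w_def ennreal_enn2real_if)
    finally show ?thesis by (subst (asm) ennreal_le_iff) (simp_all add: w_def)
  qed
  have sum_f: "summable (\<lambda>n. cmod (f n x))" if "T x \<noteq> \<infinity>" for x
  proof (rule summableI_nonneg_bounded)
    fix N
    have "H N x \<le> sqrt (w x)"
      using H_w[OF that, of N] H_nonneg real_le_rsqrt by blast
    then show "(\<Sum>n<N. cmod (f n x)) \<le> sqrt (w x)" by (simp add: H_def)
  qed simp
  define S where "S x = (\<Sum>n. f n x)" for x
  have [measurable]: "S \<in> borel_measurable sph_measure"
    unfolding S_def[abs_def] by measurable
  have suminf_w: "(\<Sum>n. cmod (f n x))\<^sup>2 \<le> w x" if "T x \<noteq> \<infinity>" for x
  proof -
    have "(\<lambda>N. (H N x)\<^sup>2) \<longlonglongrightarrow> (\<Sum>n. cmod (f n x))\<^sup>2"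
      unfolding H_def by (intro tendsto_power summable_LIMSEQ sum_f that)
    then show ?thesis by (rule LIMSEQ_le_const2) (use H_w[OF that] in auto)
  qed
  have diff_w: "(cmod (S x - (\<Sum>n<N. f n x)))\<^sup>2 \<le> w x" if "T x \<noteq> \<infinity>" for x N
  proof -
    have s: "summable (\<lambda>n. f n x)" using sum_f[OF that] by (rule summable_norm_cancel)
    have "S x - (\<Sum>n<N. f n x) = (\<Sum>n. f (n + N) x)"
      unfolding S_def using suminf_split_initial_segment[OF s, of N] by simp
    also have "cmod \<dots> \<le> (\<Sum>n. cmod (f (n + N) x))"
      by (rule summable_norm) (rule summable_ignore_initial_segment[OF sum_f[OF that]])
    also have "\<dots> \<le> (\<Sum>n. cmod (f n x))"
      using suminf_split_initial_segment[OF sum_f[OF that], of N] by (simp add: sum_nonneg)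
    finally have "(cmod (S x - (\<Sum>n<N. f n x)))\<^sup>2 \<le> (\<Sum>n. cmod (f n x))\<^sup>2"
      by (rule power_mono) simp
    with suminf_w[OF that] show ?thesis by linarith
  qed
  have S: "square_integrable S"
    unfolding square_integrable_def
  proof
    show "integrable sph_measure (\<lambda>x. (cmod (S x))\<^sup>2)"
    proof (rule Bochner_Integration.integrable_bound[OF w_int])
      show "AE x in sph_measure. norm ((cmod (S x))\<^sup>2) \<le> norm (w x)"
        using T_fin by eventually_elim (use diff_w[of _ 0] in \<open>simp add: w_def\<close>)
    qed measurable
  qed measurable
  have part: "square_integrable (\<lambda>x. \<Sum>n<N. f n x)" "(\<Sum>n<N. g n) = abs_sphere_L2 (\<lambda>x. \<Sum>n<N. f n x)" for N
    using abs_sphere_L2_sum[of "{..<N}" f] f by simp_all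
  have "(\<lambda>N. \<integral>x. (cmod (S x - (\<Sum>n<N. f n x)))\<^sup>2 \<partial>sph_measure) \<longlonglongrightarrow> (\<integral>x. 0 \<partial>sph_measure)"
  proof (rule integral_dominated_convergence[where w = w])
    show "AE x in sph_measure. (\<lambda>N. (cmod (S x - (\<Sum>n<N. f n x)))\<^sup>2) \<longlonglongrightarrow> 0"
      using T_fin
    proof eventually_elim
      case (elim x)
      have "(\<lambda>N. (\<Sum>n<N. f n x)) \<longlonglongrightarrow> S x"
        unfolding S_def by (intro summable_LIMSEQ summable_norm_cancel[OF sum_f[OF elim]])
      then have "(\<lambda>N. (cmod (S x - (\<Sum>n<N. f n x)))\<^sup>2) \<longlonglongrightarrow> (cmod (S x - S x))\<^sup>2"
        by (intro tendsto_intros)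
      then show ?case by simp
    qed
    show "AE x in sph_measure. norm ((cmod (S x - (\<Sum>n<N. f n x)))\<^sup>2) \<le> w x" for N
      using T_fin by eventually_elim (use diff_w in simp)
  qed (use w_int in measurable)
  then have "(\<lambda>N. sqrt (\<integral>x. (cmod (S x - (\<Sum>n<N. f n x)))\<^sup>2 \<partial>sph_measure)) \<longlonglongrightarrow> sqrt (\<integral>x. 0 \<partial>sph_measure)"
    by (rule tendsto_real_sqrt)
  also have "(\<lambda>N. sqrt (\<integral>x. (cmod (S x - (\<Sum>n<N. f n x)))\<^sup>2 \<partial>sph_measure)) = (\<lambda>N. norm (abs_sphere_L2 S - (\<Sum>n<N. g n)))"
  proof
    fix N
    have "square_integrable (\<lambda>x. S x - (\<Sum>n<N. f n x))"
      using square_integrable_add[OF S square_integrable_cmult[OF part(1), of "-1"]] by simp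
    then show "sqrt (\<integral>x. (cmod (S x - (\<Sum>n<N. f n x)))\<^sup>2 \<partial>sph_measure) = norm (abs_sphere_L2 S - (\<Sum>n<N. g n))"
      by (simp add: part(2) minus_abs_sphere_L2[OF S part(1)] norm_abs_sphere_L2)
  qed
  finally have "(\<lambda>N. norm ((\<Sum>n<N. g n) - abs_sphere_L2 S)) \<longlonglongrightarrow> 0"
    by (simp add: norm_minus_commute)
  then have "g sums abs_sphere_L2 S"
    unfolding sums_def by (simp add: LIM_zero_iff tendsto_norm_zero_iff)
  then show ?thesis by (rule sums_summable)
qed

text \<open>The Hilbert space is given as a real inner product space. Both parts of a complex coefficient are real
  inner products, which makes the coefficient a bounded real linear functional.\<close>

lemma fl_coeff_eq_inner:
  "fl_coeff f l m = Complex (inner f (sph_harm_L2 l m)) (inner f (\<i> *\<^sub>C sph_harm_L2 l m))"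
proof transfer
  fix f l m
  have "Re (\<integral>x. f x * cnj (\<i> * sph_harm l m x) \<partial>sph_measure) = Re (- \<i> * (\<integral>x. f x * cnj (sph_harm l m x) \<partial>sph_measure))"
    by (subst integral_mult_right_zero[symmetric]) (simp add: mult_ac)
  then show "(\<integral>x. f x * cnj (sph_harm l m x) \<partial>sph_measure) =
    Complex (Re (\<integral>x. f x * cnj (sph_harm l m x) \<partial>sph_measure)) (Re (\<integral>x. f x * cnj (\<i> * sph_harm l m x) \<partial>sph_measure))"
    by (simp add: complex_eq_iff)
qed

lemma norm_scaleC: "norm (c *\<^sub>C f) = cmod c * norm f"
  by transfer (simp add: norm_mult power_mult_distrib real_sqrt_mult)

lemma fl_coeff_scaleC [simp]: "fl_coeff (c *\<^sub>C f) l m = c * fl_coeff f l m"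
  by transfer (simp add: mult.assoc)

lemma bounded_linear_fl_coeff: "bounded_linear (\<lambda>f. fl_coeff f l m)"
proof -
  have "bounded_linear (\<lambda>f. of_real (inner f (sph_harm_L2 l m)) + \<i> * of_real (inner f (\<i> *\<^sub>C sph_harm_L2 l m)))"
    by (intro bounded_linear_add bounded_linear_const_mult bounded_linear_compose[OF bounded_linear_of_real] bounded_linear_inner_left)
  then show ?thesis by (simp add: fl_coeff_eq_inner Complex_eq)
qed

lemmas fl_coeff_scaleR [simp] = bounded_linear.linear[OF bounded_linear_fl_coeff, THEN linear_scale]
lemmas fl_coeff_diff [simp] = bounded_linear.linear[OF bounded_linear_fl_coeff, THEN linear_diff]
lemmas fl_coeff_0 [simp] = bounded_linear.linear[OF bounded_linear_fl_coeff, THEN linear_0]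
lemmas fl_coeff_sum = bounded_linear.linear[OF bounded_linear_fl_coeff, THEN linear_sum]

section \<open>Orthonormality of the spherical harmonics\<close>

abbreviation W :: "real poly" where "W \<equiv> [:-1, 0, 1:]"

definition poly_integral :: "real poly \<Rightarrow> real" where
  "poly_integral p = integral {-1..1} (poly p)"

lemma poly_integrable [simp, intro]: "poly p integrable_on {a..b}" for p :: "real poly"
  by (intro integrable_continuous_real continuous_intros)

lemma poly_integral_add: "poly_integral (p + q) = poly_integral p + poly_integral q"
proof -
  have "poly (p + q) = (\<lambda>x. poly p x + poly q x)" by auto
  then show ?thesis
    unfolding poly_integral_def by (simp add: Henstock_Kurzweil_Integration.integral_add[OF poly_integrable poly_integrable])
qed

lemma poly_integral_smult: "poly_integral (smult c p) = c * poly_integral p"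
proof -
  have "poly (smult c p) = (\<lambda>x. c * poly p x)" by auto
  then show ?thesis by (simp add: poly_integral_def)
qed

lemma poly_integral_0 [simp]: "poly_integral 0 = 0"
  using poly_integral_smult[of 0 0] by simp

lemma poly_integral_pderiv: "poly_integral (pderiv p) = poly p 1 - poly p (-1)"
  unfolding poly_integral_def
  by (intro integral_unique fundamental_theorem_of_calculus)
     (auto simp: has_real_derivative_iff_has_vector_derivative[symmetric] intro: DERIV_subset[OF poly_DERIV])

lemma poly_integral_by_parts:
  assumes "poly q 1 * poly p 1 = 0" "poly q (-1) * poly p (-1) = 0"
  shows "poly_integral (q * pderiv p) = - poly_integral (pderiv q * p)"
proof -
  have "poly_integral (pderiv (q * p)) = 0"
    unfolding poly_integral_pderiv poly_mult assms by simp
  then show ?thesis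
    by (simp add: pderiv_mult poly_integral_add mult.commute)
qed

lemma poly_integral_by_parts_iterated:
  assumes "\<And>j x. j < n \<Longrightarrow> x \<in> {-1, 1} \<Longrightarrow> poly ((pderiv ^^ j) q) x * poly ((pderiv ^^ (n - 1 - j)) p) x = 0"
  shows "poly_integral (q * (pderiv ^^ n) p) = (-1) ^ n * poly_integral ((pderiv ^^ n) q * p)"
  using assms
proof (induction n arbitrary: q)
  case (Suc n)
  have "poly_integral (q * (pderiv ^^ Suc n) p) = poly_integral (q * pderiv ((pderiv ^^ n) p))"
    by simp
  also have "\<dots> = - poly_integral (pderiv q * (pderiv ^^ n) p)"
    using Suc.prems[of 0] by (intro poly_integral_by_parts) auto
  also have "poly_integral (pderiv q * (pderiv ^^ n) p) = (-1) ^ n * poly_integral ((pderiv ^^ n) (pderiv q) * p)"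
  proof (rule Suc.IH)
    fix j and x :: real assume "j < n" "x \<in> {-1, 1}"
    then show "poly ((pderiv ^^ j) (pderiv q)) x * poly ((pderiv ^^ (n - 1 - j)) p) x = 0"
      using Suc.prems[of "Suc j" x] by (simp add: funpow_swap1)
  qed
  finally show ?case by (simp add: funpow_swap1)
qed simp

lemma poly_integral_W_power:
  "poly_integral (W ^ l) = (-1) ^ l * 2 ^ (2 * l + 1) * (fact l)\<^sup>2 / fact (2 * l + 1)"
proof (induction l)
  case 0
  have "poly_integral (pderiv [:0, 1:]) = 2"
    unfolding poly_integral_pderiv by simp
  then show ?case by (simp add: pderiv_pCons one_pCons)
next
  case (Suc l)
  \<comment> \<open>the derivative of \<open>x (x\<^sup>2 - 1)\<^sup>l\<^sup>+\<^sup>1\<close> has integral 0, which yields the recurrence\<close>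
  have "pderiv ([:0, 1:] * W ^ Suc l) = W ^ Suc l + [:0, 1:] * (smult (real (Suc l)) (W ^ l) * pderiv W)"
    unfolding pderiv_mult pderiv_power_Suc by (simp add: pderiv_pCons mult_ac)
  also have "[:0, 1:] * (smult (real (Suc l)) (W ^ l) * pderiv W) = smult (2 * real (Suc l)) (W ^ Suc l + W ^ l)"
  proof -
    have "[:0, 1:] * pderiv W = smult 2 (W + 1)"
      by (simp add: pderiv_pCons one_pCons)
    then have "smult (real (Suc l)) (W ^ l) * ([:0, 1:] * pderiv W) = smult (real (Suc l)) (W ^ l) * smult 2 (W + 1)"
      by simp
    then show ?thesis by (simp add: algebra_simps smult_add_right)
  qed
  finally have "poly_integral (pderiv ([:0, 1:] * W ^ Suc l))
      = poly_integral (W ^ Suc l) + 2 * real (Suc l) * (poly_integral (W ^ Suc l) + poly_integral (W ^ l))"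
    by (simp only: poly_integral_add poly_integral_smult)
  moreover have "poly_integral (pderiv ([:0, 1:] * W ^ Suc l)) = 0"
    unfolding poly_integral_pderiv by simp
  ultimately have "(2 * real l + 3) * poly_integral (W ^ Suc l) = - (2 * (real l + 1) * poly_integral (W ^ l))"
    by (simp add: algebra_simps)
  then have "poly_integral (W ^ Suc l) = - (2 * (real l + 1) / (2 * real l + 3)) * poly_integral (W ^ l)"
    by (simp add: field_simps)
  also have "\<dots> = (-1) ^ Suc l * (2 * (real l + 1) / (2 * real l + 3) * (2 ^ (2 * l + 1) * (fact l)\<^sup>2 / fact (2 * l + 1)))"
    unfolding Suc.IH by simp
  also have "2 * (real l + 1) / (2 * real l + 3) * (2 ^ (2 * l + 1) * (fact l)\<^sup>2 / fact (2 * l + 1))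
      = 2 ^ (2 * Suc l + 1) * (fact (Suc l))\<^sup>2 / fact (2 * Suc l + 1)"
  proof -
    define F :: real where "F = fact (2 * l + 1)"
    have f: "fact (2 * Suc l + 1) = (2 * real l + 3) * (2 * real l + 2) * F"
      by (simp add: F_def algebra_simps)
    have g: "fact (Suc l) = (real l + 1) * fact l" by simp
    have "F > 0" by (simp add: F_def)
    then show ?thesis
      unfolding f g F_def[symmetric] by (simp add: divide_simps power2_eq_square) (simp add: algebra_simps)
  qed
  finally show ?case by (simp only: mult.assoc times_divide_eq_right)
qed

lemma pochhammer_Suc_of_nat: "pochhammer (of_nat (Suc k)) n = (fact (k + n) / fact k :: real)"
  using pochhammer_product'[of "1::real" k n] by (simp add: pochhammer_fact[symmetric] add.commute)

lemma degree_W_power: "degree (W ^ l) = 2 * l"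
  by (simp add: degree_power_eq)

lemma lead_coeff_W_power: "coeff (W ^ l) (2 * l) = 1"
  using degree_W_power[of l] lead_coeff_power[of W l] by simp

lemma power_dvd_pderiv_funpow_mult:
  fixes p r :: "real poly"
  assumes "n \<le> l"
  shows "p ^ (l - n) dvd (pderiv ^^ n) (p ^ l * r)"
  using assms
proof (induction n)
  case (Suc n)
  then obtain q where q: "(pderiv ^^ n) (p ^ l * r) = p ^ (l - n) * q"
    by (auto simp: dvd_def)
  from Suc.prems have l: "l - n = Suc (l - Suc n)" by simp
  have "(pderiv ^^ Suc n) (p ^ l * r) = pderiv (p ^ (l - n) * q)"
    using q by simp
  also have "\<dots> = p ^ (l - Suc n) * (p * pderiv q + smult (of_nat (l - n)) (pderiv p * q))"
    unfolding l pderiv_mult pderiv_power_Suc by (simp add: algebra_simps)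
  finally show ?case by simp
qed simp

lemma poly_higher_pderiv_eq_0:
  fixes p r :: "real poly"
  assumes "n < l" "poly p x = 0"
  shows "poly ((pderiv ^^ n) (p ^ l * r)) x = 0"
proof -
  obtain q where "(pderiv ^^ n) (p ^ l * r) = p ^ (l - n) * q"
    using power_dvd_pderiv_funpow_mult[of n l p r] assms by (auto simp: dvd_def)
  then show ?thesis using assms by (simp add: poly_power)
qed

text \<open>The product of two associated Legendre functions of the same order \<open>m\<close> contains the weight
  \<open>(1 - x\<^sup>2)\<^sup>m\<close>, with a negative exponent for negative \<open>m\<close>. In either case it merges with one of the
  two derivatives of \<open>(x\<^sup>2 - 1)\<^sup>l\<close> into a polynomial of degree \<open>l + m\<close>: for negative \<open>m\<close> the derivative is
  divisible by \<open>(x\<^sup>2 - 1)\<^sup>-\<^sup>m\<close>, and for positive \<open>m\<close> the weight provides zeros at the endpoints.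
  So both signs can be treated alike.\<close>

lemma weighted_Rodrigues_polynomial:
  assumes "\<bar>m\<bar> \<le> int l"
  obtains q where
    "\<And>x. \<bar>x\<bar> < 1 \<Longrightarrow> (1 - x\<^sup>2) powi m * poly ((pderiv ^^ nat (int l + m)) (W ^ l)) x = poly q x"
    "degree q = nat (int l + m)"
    "coeff q (nat (int l + m)) = (-1) powi m * fact (2 * l) / fact (nat (int l - m))"
    "\<And>j x. int j < m \<Longrightarrow> x \<in> {-1, 1} \<Longrightarrow> poly ((pderiv ^^ j) q) x = 0"
proof -
  define D where "D = (pderiv ^^ nat (int l + m)) (W ^ l)"
  have deg_D: "degree D = nat (int l - m)"
    unfolding D_def degree_higher_pderiv degree_W_power using assms by auto
  have lc_D: "coeff D (nat (int l - m)) = fact (2 * l) / fact (nat (int l - m))"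
  proof -
    have e: "nat (int l - m) + nat (int l + m) = 2 * l" using assms by auto
    show ?thesis
      unfolding D_def coeff_higher_pderiv e pochhammer_Suc_of_nat lead_coeff_W_power by simp
  qed
  then have "D \<noteq> 0" by auto
  show thesis
  proof (cases "m \<ge> 0")
    case True
    define k where "k = nat m"
    have k: "m = int k" "k \<le> l" using True assms by (auto simp: k_def)
    define q where "q = W ^ k * smult ((-1) ^ k) D"
    show thesis
    proof (rule that)
      fix x :: real
      have "(1 - x\<^sup>2) ^ k = ((-1) * poly W x) ^ k" by (simp add: power2_eq_square)
      also have "\<dots> = (-1) ^ k * poly W x ^ k" by (rule power_mult_distrib)
      finally show "(1 - x\<^sup>2) powi m * poly ((pderiv ^^ nat (int l + m)) (W ^ l)) x = poly q x"
        by (simp add: k(1) q_def D_def poly_power)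
    next
      have "degree q = 2 * k + degree D"
        unfolding q_def using \<open>D \<noteq> 0\<close> by (subst degree_mult_eq) (auto simp: degree_W_power)
      then show dq: "degree q = nat (int l + m)" using deg_D k by simp
      have "coeff q (degree q) = (-1) ^ k * lead_coeff D"
        unfolding q_def lead_coeff_mult lead_coeff_smult using lead_coeff_W_power[of k] by (simp add: degree_W_power)
      then show "coeff q (nat (int l + m)) = (-1) powi m * fact (2 * l) / fact (nat (int l - m))"
        using lc_D deg_D by (simp add: dq k(1))
    next
      fix j :: nat and x :: real assume "int j < m" "x \<in> {-1, 1}"
      then show "poly ((pderiv ^^ j) q) x = 0"
        unfolding q_def by (intro poly_higher_pderiv_eq_0) (auto simp: k)
    qed
  next
    case False
    define k where "k = nat (- m)"
    have k: "m = - int k" "k \<le> l" "nat (int l + m) = l - k" using False assms by (auto simp: k_def)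
    obtain r where r: "D = W ^ k * r"
      using power_dvd_pderiv_funpow[of "l - k" l W] k by (auto simp: dvd_def D_def)
    then have "r \<noteq> 0" using \<open>D \<noteq> 0\<close> by auto
    have deg: "degree D = 2 * k + degree r"
      unfolding r using \<open>r \<noteq> 0\<close> by (subst degree_mult_eq) (auto simp: degree_W_power)
    show thesis
    proof (rule that)
      fix x :: real assume "\<bar>x\<bar> < 1"
      then have "x\<^sup>2 < 1" by (simp add: abs_square_less_1)
      have "poly D x = poly W x ^ k * poly r x"
        by (simp add: r poly_power)
      also have "poly W x = (-1) * (1 - x\<^sup>2)" by (simp add: power2_eq_square)
      finally have "poly D x = (-1) ^ k * (1 - x\<^sup>2) ^ k * poly r x"
        by (simp only: power_mult_distrib)
      moreover have "(1 - x\<^sup>2) powi m = inverse ((1 - x\<^sup>2) ^ k)"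
        by (simp add: k(1) power_int_minus)
      ultimately show "(1 - x\<^sup>2) powi m * poly ((pderiv ^^ nat (int l + m)) (W ^ l)) x = poly (smult ((-1) ^ k) r) x"
        unfolding D_def[symmetric] using \<open>x\<^sup>2 < 1\<close> by simp
    next
      show dq: "degree (smult ((-1) ^ k) r) = nat (int l + m)"
        using deg deg_D k by simp
      have "lead_coeff D = lead_coeff r"
        unfolding r lead_coeff_mult using lead_coeff_W_power[of k] by (simp add: degree_W_power)
      then have "lead_coeff r = fact (2 * l) / fact (nat (int l - m))"
        using lc_D deg_D by simp
      moreover have "degree r = nat (int l + m)" using dq by simp
      moreover have "(-1::real) powi m = (-1) ^ k"
        by (simp add: k(1) power_int_minus flip: power_inverse)
      ultimately show "coeff (smult ((-1) ^ k) r) (nat (int l + m)) = (-1) powi m * fact (2 * l) / fact (nat (int l - m))"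
        by simp
    next
      fix j :: nat and x :: real assume "int j < m" "x \<in> {-1, 1}"
      then show "poly ((pderiv ^^ j) (smult ((-1) ^ k) r)) x = 0" using False by auto
    qed
  qed
qed

text \<open>All derivatives are moved from \<open>(x\<^sup>2 - 1)\<^sup>l\<close> to \<open>q\<close>. At each step one of the two boundary factors
  vanishes: the derivative of \<open>q\<close> as long as fewer than \<open>m\<close> derivatives have been moved, and
  otherwise the derivative of \<open>(x\<^sup>2 - 1)\<^sup>l\<close>, whose order is then below \<open>l\<close>. What remains of \<open>q\<close> is 0 if
  \<open>l' < l\<close>, and a constant if \<open>l' = l\<close>.\<close>

lemma poly_integral_Rodrigues:
  assumes m: "\<bar>m\<bar> \<le> int l" "\<bar>m\<bar> \<le> int l'" and le: "l' \<le> l"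
    and q: "degree q = nat (int l' + m)"
      "coeff q (nat (int l' + m)) = (-1) powi m * fact (2 * l') / fact (nat (int l' - m))"
      "\<And>j x. int j < m \<Longrightarrow> x \<in> {-1, 1} \<Longrightarrow> poly ((pderiv ^^ j) q) x = 0"
  shows "poly_integral (q * (pderiv ^^ nat (int l + m)) (W ^ l)) =
    (if l = l' then (2 ^ l * fact l)\<^sup>2 * (2 / (2 * real l + 1)) * fact (nat (int l + m)) / fact (nat (int l - m)) else 0)"
proof -
  define n where "n = nat (int l + m)"
  have "poly_integral (q * (pderiv ^^ n) (W ^ l)) = (-1) ^ n * poly_integral ((pderiv ^^ n) q * W ^ l)"
  proof (rule poly_integral_by_parts_iterated)
    fix j and x :: real assume j: "j < n" and x: "x \<in> {-1, 1}"
    show "poly ((pderiv ^^ j) q) x * poly ((pderiv ^^ (n - 1 - j)) (W ^ l)) x = 0"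
    proof (cases "int j < m")
      case False
      then have "n - 1 - j < l" using j m by (auto simp: n_def)
      then have "poly ((pderiv ^^ (n - 1 - j)) (W ^ l * 1)) x = 0"
        using x by (intro poly_higher_pderiv_eq_0) auto
      then show ?thesis by simp
    qed (use q(3) x in auto)
  qed
  also have "\<dots> = (if l = l' then (2 ^ l * fact l)\<^sup>2 * (2 / (2 * real l + 1)) * fact n / fact (nat (int l - m)) else 0)"
  proof (cases "l = l'")
    case False
    then have "degree q < n" using q(1) le m by (auto simp: n_def)
    then have "(pderiv ^^ n) q = 0"
      by (intro poly_eqI) (simp add: coeff_higher_pderiv coeff_eq_0)
    with False show ?thesis by simp
  next
    case True
    then have dq: "degree q = n" using q(1) by (simp add: n_def)
    have "(pderiv ^^ n) q = [:fact n * coeff q n:]"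
    proof (rule poly_eqI)
      fix i
      show "coeff ((pderiv ^^ n) q) i = coeff [:fact n * coeff q n:] i"
        using dq pochhammer_Suc_of_nat[of 0 n]
        by (cases i) (simp_all add: coeff_higher_pderiv coeff_eq_0 pochhammer_fact)
    qed
    then have "poly_integral ((pderiv ^^ n) q * W ^ l) = fact n * coeff q n * poly_integral (W ^ l)"
      by (simp add: poly_integral_smult)
    also have "coeff q n = (-1) powi m * fact (2 * l) / fact (nat (int l - m))"
      using q(2) True by (simp add: n_def)
    finally have "(-1) ^ n * poly_integral ((pderiv ^^ n) q * W ^ l) =
      ((-1) ^ n * (-1) powi m * (-1) ^ l) * (fact n * fact (2 * l) / fact (nat (int l - m)) * (2 ^ (2 * l + 1) * (fact l)\<^sup>2 / fact (2 * l + 1)))"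
      unfolding poly_integral_W_power by (simp add: mult_ac)
    also have "(-1) ^ n * (-1) powi m * (-1) ^ l = (1 :: real)"
    proof -
      have "(-1::real) ^ n = (-1) powi (int l + m)"
        using m by (simp add: n_def power_int_def)
      also have "\<dots> = (-1) ^ l * (-1) powi m"
        by (subst power_int_add) auto
      finally have "(-1) ^ n * (-1) powi m * (-1) ^ l = ((-1) ^ l * (-1) ^ l) * ((-1) powi m * (-1) powi m :: real)"
        by (simp add: mult_ac)
      also have "(-1) ^ l * (-1) ^ l = (1::real)" by (simp flip: power_add)
      also have "(-1) powi m * (-1) powi m = (1::real)" by (simp flip: power_int_mult_distrib)
      finally show ?thesis by simp
    qed
    also have "1 * (fact n * fact (2 * l) / fact (nat (int l - m)) * (2 ^ (2 * l + 1) * (fact l)\<^sup>2 / fact (2 * l + 1)))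
      = (2 ^ l * fact l)\<^sup>2 * (2 / (2 * real l + 1)) * fact n / fact (nat (int l - m))"
    proof -
      define X F :: real where "X = fact (nat (int l - m))" and "F = fact (2 * l)"
      have "X > 0" "F > 0" by (simp_all add: X_def F_def)
      moreover have "fact (2 * l + 1) = (2 * real l + 1) * F" by (simp add: F_def)
      moreover have "2 ^ (2 * l + 1) * (fact l)\<^sup>2 = 2 * (2 ^ l * fact l :: real)\<^sup>2"
        by (simp add: power_mult_distrib power_mult[symmetric] mult.commute[of 2 l])
      moreover have "2 * real l + 1 > 0" by simp
      ultimately show ?thesis
        unfolding X_def[symmetric] F_def[symmetric] by (simp add: divide_simps)
    qed
    finally show ?thesis using True by simp
  qed
  finally show ?thesis by (simp add: n_def)
qed

lemma has_integral_sin_poly_cos: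
  "((\<lambda>\<theta>. sin \<theta> * poly p (cos \<theta>)) has_integral poly_integral p) {0..pi}"
proof -
  have "((\<lambda>x. - sin x *\<^sub>R poly p (cos x)) has_integral (integral {cos 0..cos pi} (poly p) - integral {cos pi..cos 0} (poly p))) {0..pi}"
    by (rule has_integral_substitution_general[of "{}" _ _ _ "-1" 1])
       (auto intro!: continuous_intros derivative_eq_intros)
  from has_integral_neg[OF this] show ?thesis by (simp add: poly_integral_def)
qed

lemma has_integral_assoc_legendre_le:
  assumes m: "\<bar>m\<bar> \<le> int l" "\<bar>m\<bar> \<le> int l'" and le: "l' \<le> l"
  shows "((\<lambda>\<theta>. sin \<theta> * (assoc_legendre l m (cos \<theta>) * assoc_legendre l' m (cos \<theta>))) has_integral
    (if l = l' then 2 / (2 * real l + 1) * fact (nat (int l + m)) / fact (nat (int l - m)) else 0)) {0..pi}"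
proof -
  obtain q where q: "\<And>x. \<bar>x\<bar> < 1 \<Longrightarrow> (1 - x\<^sup>2) powi m * poly ((pderiv ^^ nat (int l' + m)) (W ^ l')) x = poly q x"
    "degree q = nat (int l' + m)"
    "coeff q (nat (int l' + m)) = (-1) powi m * fact (2 * l') / fact (nat (int l' - m))"
    "\<And>j x. int j < m \<Longrightarrow> x \<in> {-1, 1} \<Longrightarrow> poly ((pderiv ^^ j) q) x = 0"
    using weighted_Rodrigues_polynomial[OF m(2)] by blast
  define P where "P = q * (pderiv ^^ nat (int l + m)) (W ^ l)"
  define c :: real where "c = 1 / (2 ^ l * fact l * (2 ^ l' * fact l'))"
  have eq: "assoc_legendre l m x * assoc_legendre l' m x = c * poly P x" if x: "\<bar>x\<bar> < 1" for x
  proof -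
    have "x\<^sup>2 < 1" using x by (simp add: abs_square_less_1)
    have s: "sqrt (1 - x\<^sup>2) powi m * sqrt (1 - x\<^sup>2) powi m = (1 - x\<^sup>2) powi m"
      using \<open>x\<^sup>2 < 1\<close> by (simp flip: power_int_mult_distrib)
    have t: "(-1) powi m * (-1) powi m = (1::real)" by (simp flip: power_int_mult_distrib)
    have "assoc_legendre l m x * assoc_legendre l' m x = c * ((-1) powi m * (-1) powi m) *
        ((sqrt (1 - x\<^sup>2) powi m * sqrt (1 - x\<^sup>2) powi m) * poly ((pderiv ^^ nat (int l' + m)) (W ^ l')) x)
        * poly ((pderiv ^^ nat (int l + m)) (W ^ l)) x"
      unfolding assoc_legendre_poly by (simp add: c_def mult_ac)
    also have "\<dots> = c * poly P x"
      unfolding s t q(1)[OF x] P_def by simp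
    finally show ?thesis .
  qed
  have eq': "c * (sin \<theta> * poly P (cos \<theta>)) = sin \<theta> * (assoc_legendre l m (cos \<theta>) * assoc_legendre l' m (cos \<theta>))" for \<theta>
  proof (cases "sin \<theta> = 0")
    case False
    then have "0 < (sin \<theta>)\<^sup>2" by simp
    then have "(cos \<theta>)\<^sup>2 < 1" using sin_cos_squared_add[of \<theta>] by linarith
    then have "\<bar>cos \<theta>\<bar> < 1" by (simp add: abs_square_less_1)
    then show ?thesis by (simp add: eq)
  qed simp
  have "((\<lambda>\<theta>. c * (sin \<theta> * poly P (cos \<theta>))) has_integral (c * poly_integral P)) {0..pi}"
    by (intro has_integral_mult_right has_integral_sin_poly_cos)
  moreover have I: "poly_integral P = (if l = l' then (2 ^ l * fact l)\<^sup>2 * (2 / (2 * real l + 1)) * fact (nat (int l + m)) / fact (nat (int l - m)) else 0)"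
    unfolding P_def by (rule poly_integral_Rodrigues[OF m le q(2-4)])
  moreover have "c * poly_integral P = (if l = l' then 2 / (2 * real l + 1) * fact (nat (int l + m)) / fact (nat (int l - m)) else 0)"
    unfolding I by (auto simp: c_def power2_eq_square)
  ultimately show ?thesis unfolding eq' by simp
qed

lemma has_integral_assoc_legendre:
  assumes m: "\<bar>m\<bar> \<le> int l" "\<bar>m\<bar> \<le> int l'"
  shows "((\<lambda>\<theta>. sin \<theta> * (assoc_legendre l m (cos \<theta>) * assoc_legendre l' m (cos \<theta>))) has_integral
    (if l = l' then 2 / (2 * real l + 1) * fact (nat (int l + m)) / fact (nat (int l - m)) else 0)) {0..pi}"
proof (cases "l' \<le> l")
  case False
  then have "((\<lambda>\<theta>. sin \<theta> * (assoc_legendre l' m (cos \<theta>) * assoc_legendre l m (cos \<theta>))) has_integral 0) {0..pi}"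
    using has_integral_assoc_legendre_le[OF m(2,1)] by auto
  with False show ?thesis by (auto simp: mult.commute[of "assoc_legendre l m _"])
qed (use has_integral_assoc_legendre_le[OF m] in auto)

lemma integrable_sin_assoc_legendre:
  assumes m: "\<bar>m\<bar> \<le> int l" "\<bar>m'\<bar> \<le> int l'"
  shows "set_integrable lborel {0..pi} (\<lambda>\<theta>. sin \<theta> * (assoc_legendre l m (cos \<theta>) * assoc_legendre l' m' (cos \<theta>)))"
proof -
  obtain B where B: "\<And>x. x \<in> {-1..1} \<Longrightarrow> \<bar>assoc_legendre l m x\<bar> \<le> B"
    using bounded_assoc_legendre[OF m(1)] by blast
  obtain B' where B': "\<And>x. x \<in> {-1..1} \<Longrightarrow> \<bar>assoc_legendre l' m' x\<bar> \<le> B'"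
    using bounded_assoc_legendre[OF m(2)] by blast
  have [simp]: "0 \<le> B" using B[of 0] by simp
  have "\<bar>sin \<theta> * (assoc_legendre l m (cos \<theta>) * assoc_legendre l' m' (cos \<theta>))\<bar> \<le> B * B'" for \<theta>
  proof -
    have "\<bar>sin \<theta>\<bar> * (\<bar>assoc_legendre l m (cos \<theta>)\<bar> * \<bar>assoc_legendre l' m' (cos \<theta>)\<bar>) \<le> 1 * (B * B')"
      using B[of "cos \<theta>"] B'[of "cos \<theta>"] by (intro mult_mono) auto
    then show ?thesis by (simp add: abs_mult)
  qed
  then show ?thesis
    unfolding set_integrable_def
    by (intro integrableI_bounded_set_indicator[where B = "B * B'"]) (auto intro!: borel_measurable_times)
qed

lemma integral_cis_multiple:
  "(LBINT \<phi>:{0..<2 * pi}. cis (real_of_int k * \<phi>)) = (if k = 0 then 2 * pi else 0)"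
  "set_integrable lborel {0..<2 * pi} (\<lambda>\<phi>. cis (real_of_int k * \<phi>))"
proof -
  have cont: "continuous_on A (\<lambda>\<phi>. cis (real_of_int k * \<phi>))" for A
    by (auto simp: cis_conv_exp intro!: continuous_intros)
  have si: "set_integrable lborel {0..2 * pi} (\<lambda>\<phi>. cis (real_of_int k * \<phi>))"
    by (rule borel_integrable_atLeastAtMost'[OF cont])
  then show "set_integrable lborel {0..<2 * pi} (\<lambda>\<phi>. cis (real_of_int k * \<phi>))"
    by (rule set_integrable_subset) auto
  have "(LBINT \<phi>:{0..<2 * pi}. cis (real_of_int k * \<phi>)) = (LBINT \<phi>:{0..2 * pi}. cis (real_of_int k * \<phi>))"
    unfolding set_lebesgue_integral_def
  proof (rule integral_cong_AE)
    show "AE x in lborel. indicat_real {0..<2 * pi} x *\<^sub>R cis (real_of_int k * x) = indicat_real {0..2 * pi} x *\<^sub>R cis (real_of_int k * x)"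
      using AE_lborel_singleton[of "2 * pi"] by (rule eventually_mono) (auto simp: indicator_def)
  qed measurable
  also have "\<dots> = integral {0..2 * pi} (\<lambda>\<phi>. cis (real_of_int k * \<phi>))"
    by (rule set_borel_integral_eq_integral(2)[OF si])
  also have "\<dots> = (if k = 0 then 2 * pi else 0)"
  proof (cases "k = 0")
    case False
    have "((\<lambda>\<phi>. cis (real_of_int k * \<phi>)) has_integral
        (cis (real_of_int k * (2 * pi)) / (\<i> * of_int k) - cis (real_of_int k * 0) / (\<i> * of_int k))) {0..2 * pi}"
    proof (rule fundamental_theorem_of_calculus)
      fix x :: real
      have "((\<lambda>z. exp (\<i> * of_int k * z) / (\<i> * of_int k)) has_field_derivative exp (\<i> * of_int k * of_real x)) (at (of_real x))"
        using False by (auto intro!: derivative_eq_intros)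
      from has_vector_derivative_real_field[OF this]
      show "((\<lambda>\<phi>. cis (real_of_int k * \<phi>) / (\<i> * of_int k)) has_vector_derivative cis (real_of_int k * x)) (at x within {0..2 * pi})"
        by (simp add: cis_conv_exp mult_ac)
    qed simp
    moreover have "cis (real_of_int k * (2 * pi)) = 1"
      using cis_multiple_2pi[of "real_of_int k"] by (simp add: mult_ac)
    ultimately show ?thesis using False by (simp add: integral_unique)
  qed (simp add: scaleR_conv_of_real)
  finally show "(LBINT \<phi>:{0..<2 * pi}. cis (real_of_int k * \<phi>)) = (if k = 0 then 2 * pi else 0)" .
qed

lemma lborel_pair_integral_product:
  fixes A B :: "real \<Rightarrow> complex"
  assumes A: "integrable lborel A" and B: "integrable lborel B"
  shows "(\<integral>p. A (fst p) * B (snd p) \<partial>lborel) = integral\<^sup>L lborel A * integral\<^sup>L lborel B"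
proof -
  have [measurable]: "A \<in> borel_measurable borel" "B \<in> borel_measurable borel" using A B by auto
  have int: "integrable (lborel \<Otimes>\<^sub>M lborel) (\<lambda>p. A (fst p) * B (snd p))"
  proof (rule lborel_pair.Fubini_integrable)
    show "integrable lborel (\<lambda>x. \<integral>y. norm (A (fst (x, y)) * B (snd (x, y))) \<partial>lborel)"
      using A B by (simp add: norm_mult integrable_norm)
    show "AE x in lborel. integrable lborel (\<lambda>y. A (fst (x, y)) * B (snd (x, y)))"
      using B by simp
  qed measurable
  have "(\<integral>p. A (fst p) * B (snd p) \<partial>lborel) = (\<integral>p. A (fst p) * B (snd p) \<partial>(lborel \<Otimes>\<^sub>M lborel))"
    by (simp add: lborel_prod)
  also have "\<dots> = (\<integral>x. (\<integral>y. A x * B y \<partial>lborel) \<partial>lborel)"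
    using lborel_pair.integral_fst[of "\<lambda>x y. A x * B y"] int by (simp add: split_beta')
  also have "\<dots> = integral\<^sup>L lborel A * integral\<^sup>L lborel B"
    by simp
  finally show ?thesis .
qed

lemma integral_sph_measure:
  fixes F :: "real ^ 3 \<Rightarrow> complex"
  assumes [measurable]: "F \<in> borel_measurable sph_measure"
  shows "integral\<^sup>L sph_measure F =
    (\<integral>p. indicator ({0..pi} \<times> {0..<2 * pi}) p *\<^sub>R (sin (fst p) *\<^sub>R F (sph_coord p)) \<partial>lborel)"
proof -
  let ?R = "restrict_space lborel ({0..pi} \<times> {0..<2 * pi}) :: (real \<times> real) measure"
  have sets: "{0..pi} \<times> {0..<2 * pi} \<in> sets (lborel :: (real \<times> real) measure)"
    unfolding sets_lborel borel_prod[symmetric] by (rule pair_measureI) auto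
  have F: "F \<in> borel_measurable (restrict_space borel S2)"
    using assms by (simp add: measurable_cong_sets[OF sets_sph_measure refl])
  have m: "(\<lambda>p. sin (fst p)) \<in> borel_measurable ?R"
    by (intro measurable_restrict_space1) (auto intro!: borel_measurable_continuous_onI continuous_intros)
  have coord: "sph_coord \<in> measurable ?R (restrict_space borel S2)"
    using measurable_sph_coord by simp
  have "integral\<^sup>L sph_measure F = integral\<^sup>L (density ?R (\<lambda>(\<theta>, \<phi>). ennreal (sin \<theta>))) (\<lambda>p. F (sph_coord p))"
    unfolding sph_measure_def by (rule integral_distr[OF measurable_sph_coord F])
  also have "\<dots> = integral\<^sup>L (density ?R (\<lambda>p. ennreal (sin (fst p)))) (\<lambda>p. F (sph_coord p))"
    by (simp add: split_beta')
  also have "\<dots> = (\<integral>p. sin (fst p) *\<^sub>R F (sph_coord p) \<partial>?R)"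
    by (rule integral_density[OF measurable_compose[OF coord F] m])
       (auto intro!: AE_I2 sin_ge_zero simp: space_restrict_space)
  also have "\<dots> = (\<integral>p. indicator ({0..pi} \<times> {0..<2 * pi}) p *\<^sub>R (sin (fst p) *\<^sub>R F (sph_coord p)) \<partial>lborel)"
    using sets by (subst integral_restrict_space) auto
  finally show ?thesis .
qed

text \<open>The poles are left out, since the azimuth cannot be recovered there; in integrals their
  contribution has the factor \<open>sin \<theta> = 0\<close>.\<close>

lemma sph_harm_sph_coord:
  assumes "\<bar>m\<bar> \<le> int l" "0 < \<theta>" "\<theta> < pi" "0 \<le> \<phi>" "\<phi> < 2 * pi"
  shows "sph_harm l m (sph_coord (\<theta>, \<phi>)) = sph_harm_coord l m \<theta> \<phi>"
proof -
  have "0 < sin \<theta>" using assms by (intro sin_gt_zero)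
  have "of_real (sin \<theta>) * exp (\<i> * of_real \<phi>) = Complex (sin \<theta> * cos \<phi>) (sin \<theta> * sin \<phi>)"
    unfolding cis_conv_exp[symmetric] by (simp add: complex_eq_iff)
  then have "Arg2pi (Complex (sin \<theta> * cos \<phi>) (sin \<theta> * sin \<phi>)) = \<phi>"
    using \<open>0 < sin \<theta>\<close> assms by (intro Arg2pi_unique[of "sin \<theta>"]) auto
  moreover have "arccos (cos \<theta>) = \<theta>" using assms by (intro arccos_cos) auto
  ultimately show ?thesis
    using assms(1) by (simp add: sph_harm_def sph_coord_def vector_3)
qed

text \<open>In spherical coordinates the integral factorises: the azimuthal factor forces equal orders, and then the
  polar factor is the Legendre integral above.\<close>

lemma sph_harm_orthonormal:
  assumes m: "\<bar>m\<bar> \<le> int l" "\<bar>m'\<bar> \<le> int l'"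
  shows "(\<integral>x. sph_harm l m x * cnj (sph_harm l' m' x) \<partial>sph_measure) = (if l = l' \<and> m = m' then 1 else 0)"
proof -
  define N where "N l m = sqrt ((2 * real l + 1) * fact (nat (int l - m)) / (4 * pi * fact (nat (int l + m))))" for l m
  define A :: "real \<Rightarrow> complex" where "A \<theta> = of_real (N l m * N l' m' * (indicator {0..pi} \<theta> * (sin \<theta> * (assoc_legendre l m (cos \<theta>) * assoc_legendre l' m' (cos \<theta>)))))" for \<theta>
  define B where "B \<phi> = indicator {0..<2 * pi} \<phi> *\<^sub>R cis (real_of_int (m - m') * \<phi>)" for \<phi>
  have "(\<integral>x. sph_harm l m x * cnj (sph_harm l' m' x) \<partial>sph_measure) =
    (\<integral>p. indicator ({0..pi} \<times> {0..<2 * pi}) p *\<^sub>R (sin (fst p) *\<^sub>R (sph_harm l m (sph_coord p) * cnj (sph_harm l' m' (sph_coord p)))) \<partial>lborel)"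
    by (rule integral_sph_measure) measurable
  also have "\<dots> = (\<integral>p. A (fst p) * B (snd p) \<partial>lborel)"
  proof (rule Bochner_Integration.integral_cong[OF refl])
    fix p :: "real \<times> real"
    obtain \<theta> \<phi> where p: "p = (\<theta>, \<phi>)" by (cases p)
    consider "\<theta> \<notin> {0..pi} \<or> \<phi> \<notin> {0..<2 * pi}" | "\<theta> = 0 \<or> \<theta> = pi" | "0 < \<theta>" "\<theta> < pi" "0 \<le> \<phi>" "\<phi> < 2 * pi"
      by fastforce
    then show "indicator ({0..pi} \<times> {0..<2 * pi}) p *\<^sub>R (sin (fst p) *\<^sub>R (sph_harm l m (sph_coord p) * cnj (sph_harm l' m' (sph_coord p)))) = A (fst p) * B (snd p)"
    proof cases
      case 3
      have "cis (real_of_int m * \<phi>) * cnj (cis (real_of_int m' * \<phi>)) = cis (real_of_int (m - m') * \<phi>)"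
        by (simp add: cis_cnj cis_mult algebra_simps)
      then have "sph_harm_coord l m \<theta> \<phi> * cnj (sph_harm_coord l' m' \<theta> \<phi>) =
         of_real (N l m * N l' m' * (assoc_legendre l m (cos \<theta>) * assoc_legendre l' m' (cos \<theta>))) * cis (real_of_int (m - m') * \<phi>)"
        unfolding sph_harm_coord_def N_def[symmetric] by (simp add: mult_ac)
      with 3 show ?thesis
        unfolding p by (simp add: sph_harm_sph_coord m A_def B_def scaleR_conv_of_real mult_ac)
    qed (auto simp: p A_def B_def indicator_def)
  qed
  also have "\<dots> = integral\<^sup>L lborel A * integral\<^sup>L lborel B"
  proof (rule lborel_pair_integral_product)
    show "integrable lborel A"
      using integrable_sin_assoc_legendre[OF m] unfolding A_def[abs_def] set_integrable_def
      by (intro integrable_of_real integrable_mult_right) (simp add: mult.assoc)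
    show "integrable lborel B"
      using integral_cis_multiple(2)[of "m - m'"] by (simp add: set_integrable_def B_def[abs_def])
  qed
  also have "integral\<^sup>L lborel B = (if m = m' then 2 * pi else 0)"
    using integral_cis_multiple(1)[of "m - m'"] by (simp add: set_lebesgue_integral_def B_def[abs_def])
  also have "integral\<^sup>L lborel A * (if m = m' then 2 * pi else 0) = (if l = l' \<and> m = m' then 1 else 0)"
  proof (cases "m = m'")
    case True
    have "integral\<^sup>L lborel A = of_real (N l m * N l' m * (LBINT \<theta>:{0..pi}. sin \<theta> * (assoc_legendre l m (cos \<theta>) * assoc_legendre l' m (cos \<theta>))))"
      unfolding A_def[abs_def] integral_complex_of_real of_real_eq_iff True by (simp add: set_lebesgue_integral_def mult.assoc)
    also have "(LBINT \<theta>:{0..pi}. sin \<theta> * (assoc_legendre l m (cos \<theta>) * assoc_legendre l' m (cos \<theta>))) =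
      (if l = l' then 2 / (2 * real l + 1) * fact (nat (int l + m)) / fact (nat (int l - m)) else 0)"
      using set_borel_integral_eq_integral(2)[OF integrable_sin_assoc_legendre[OF m]]
        integral_unique[OF has_integral_assoc_legendre[of m l l']] m True by simp
    finally have A: "integral\<^sup>L lborel A = of_real (N l m * N l' m * (if l = l' then 2 / (2 * real l + 1) * fact (nat (int l + m)) / fact (nat (int l - m)) else 0))" .
    have "N l m * N l m = (2 * real l + 1) * fact (nat (int l - m)) / (4 * pi * fact (nat (int l + m)))"
      unfolding N_def by (subst real_sqrt_mult_self) auto
    moreover have "(2 * real l + 1) * X / (4 * pi * Y) * (2 / (2 * real l + 1) * Y / X) * (2 * pi) = 1"
      if "X > 0" "Y > 0" for X Y :: real
    proof -
      have "2 * real l + 1 > 0" by simp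
      then show ?thesis using that by (simp add: divide_simps)
    qed
    ultimately have "N l m * N l m * (2 / (2 * real l + 1) * fact (nat (int l + m)) / fact (nat (int l - m))) * (2 * pi) = 1"
      by simp
    then have "of_real (N l m * N l m * (2 / (2 * real l + 1) * fact (nat (int l + m)) / fact (nat (int l - m))) * (2 * pi)) = (1 :: complex)"
      by (simp only: of_real_1)
    then show ?thesis unfolding A using True by auto
  qed auto
  finally show ?thesis .
qed

section \<open>Zonal series in Sobolev spaces\<close>

lemma sph_harm_L2_outside: "\<not> \<bar>m\<bar> \<le> int l \<Longrightarrow> sph_harm_L2 l m = 0"
  by transfer (auto simp: sph_harm_def L2_rel_def square_integrable_def)

lemma scaleC_of_real: "complex_of_real c *\<^sub>C f = c *\<^sub>R f"
  by transfer (auto simp: L2_rel_def square_integrable_cmult)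

lemma scaleC_0_left [simp]: "0 *\<^sub>C f = 0"
  using scaleC_of_real[of 0 f] by simp

lemma scaleC_0_right [simp]: "c *\<^sub>C 0 = 0"
  using norm_scaleC[of c 0] by simp

lemma fl_coeff_outside: "\<not> \<bar>m\<bar> \<le> int l \<Longrightarrow> fl_coeff f l m = 0"
  by (simp add: fl_coeff_eq_inner sph_harm_L2_outside complex_eq_iff)

lemma fl_coeff_sph_harm_L2:
  "fl_coeff (sph_harm_L2 l m) l' m' = (if l' = l \<and> m' = m \<and> \<bar>m\<bar> \<le> int l then 1 else 0)"
proof (cases "\<bar>m\<bar> \<le> int l \<and> \<bar>m'\<bar> \<le> int l'")
  case True
  then have m: "\<bar>m\<bar> \<le> int l" "\<bar>m'\<bar> \<le> int l'" by auto
  have "fl_coeff (sph_harm_L2 l m) l' m' = (\<integral>x. sph_harm l m x * cnj (sph_harm l' m' x) \<partial>sph_measure)"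
    by transfer simp
  then show ?thesis using sph_harm_orthonormal[OF m] m by auto
next
  case False
  then show ?thesis by (auto simp: sph_harm_L2_outside fl_coeff_outside)
qed

lemma norm_sph_harm_L2_le: "norm (sph_harm_L2 l m) \<le> 1"
proof (cases "\<bar>m\<bar> \<le> int l")
  case True
  then have "Re (fl_coeff (sph_harm_L2 l m) l m) = 1"
    by (simp add: fl_coeff_sph_harm_L2)
  then have "(norm (sph_harm_L2 l m))\<^sup>2 = 1"
    by (simp add: fl_coeff_eq_inner power2_norm_eq_inner)
  then have "norm (sph_harm_L2 l m) = 1 \<or> norm (sph_harm_L2 l m) = - 1"
    by (simp only: power2_eq_1_iff)
  then show ?thesis using norm_ge_zero[of "sph_harm_L2 l m"] by linarith
qed (simp add: sph_harm_L2_outside)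

definition zonal :: "(nat \<Rightarrow> real) \<Rightarrow> sphere_L2" where
  "zonal b = (\<Sum>l. b l *\<^sub>R sph_harm_L2 l 0)"

lemma summable_zonal_norm:
  assumes "summable (\<lambda>l. \<bar>b l\<bar>)"
  shows "summable (\<lambda>l. norm (b l *\<^sub>R sph_harm_L2 l 0))"
  by (rule summable_comparison_test'[OF assms]) (use norm_sph_harm_L2_le in \<open>auto intro: mult_right_le_one_le\<close>)

lemma zonal_sums:
  assumes "summable (\<lambda>l. \<bar>b l\<bar>)"
  shows "(\<lambda>l. b l *\<^sub>R sph_harm_L2 l 0) sums zonal b"
  unfolding zonal_def by (intro summable_sums summable_sphere_L2 summable_zonal_norm assms)

lemma norm_zonal_le:
  assumes "summable (\<lambda>l. \<bar>b l\<bar>)"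
  shows "norm (zonal b) \<le> (\<Sum>l. \<bar>b l\<bar>)"
proof (rule LIMSEQ_le_const2)
  show "(\<lambda>n. norm (\<Sum>l<n. b l *\<^sub>R sph_harm_L2 l 0)) \<longlonglongrightarrow> norm (zonal b)"
    using zonal_sums[OF assms] unfolding sums_def by (rule tendsto_norm)
  have "norm (\<Sum>l<n. b l *\<^sub>R sph_harm_L2 l 0) \<le> (\<Sum>l. \<bar>b l\<bar>)" for n
  proof -
    have "norm (\<Sum>l<n. b l *\<^sub>R sph_harm_L2 l 0) \<le> (\<Sum>l<n. \<bar>b l\<bar>)"
      using norm_sph_harm_L2_le by (intro order_trans[OF norm_sum] sum_mono) (auto intro: mult_right_le_one_le)
    also have "\<dots> \<le> (\<Sum>l. \<bar>b l\<bar>)" by (rule sum_le_suminf[OF assms]) auto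
    finally show ?thesis .
  qed
  then show "\<exists>N. \<forall>n\<ge>N. norm (\<Sum>l<n. b l *\<^sub>R sph_harm_L2 l 0) \<le> (\<Sum>l. \<bar>b l\<bar>)" by blast
qed

lemma fl_coeff_zonal:
  assumes "summable (\<lambda>l. \<bar>b l\<bar>)"
  shows "fl_coeff (zonal b) l m = (if m = 0 then of_real (b l) else 0)"
proof -
  have "(\<lambda>l'. fl_coeff (b l' *\<^sub>R sph_harm_L2 l' 0) l m) sums fl_coeff (zonal b) l m"
    by (rule bounded_linear.sums[OF bounded_linear_fl_coeff zonal_sums[OF assms]])
  moreover have "(\<lambda>l'. fl_coeff (b l' *\<^sub>R sph_harm_L2 l' 0) l m) =
      (\<lambda>l'. if l' = l then (if m = 0 then of_real (b l) else 0) else 0)"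
    by (auto simp: fl_coeff_sph_harm_L2 scaleR_conv_of_real)
  ultimately show ?thesis
    using sums_unique2[OF _ sums_single[of l "\<lambda>_. if m = 0 then complex_of_real (b l) else 0"]] by simp
qed

lemma ang_power_zonal:
  assumes "summable (\<lambda>l. \<bar>b l\<bar>)"
  shows "ang_power (zonal b) l = (b l)\<^sup>2"
proof -
  have "ang_power (zonal b) l = (\<Sum>m = - int l..int l. if m = 0 then (b l)\<^sup>2 else 0)"
    unfolding ang_power_def by (intro sum.cong) (auto simp: fl_coeff_zonal[OF assms])
  then show ?thesis by simp
qed

lemma zonal_diff:
  assumes "summable (\<lambda>l. \<bar>b l\<bar>)" "summable (\<lambda>l. \<bar>c l\<bar>)"
  shows "zonal b - zonal c = zonal (\<lambda>l. b l - c l)"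
  using sums_diff[OF zonal_sums[OF assms(1)] zonal_sums[OF assms(2)]]
  by (simp add: zonal_def[of "\<lambda>l. b l - c l"] scaleR_diff_left sums_iff)

lemma zonal_scaleR:
  assumes "summable (\<lambda>l. \<bar>b l\<bar>)"
  shows "r *\<^sub>R zonal b = zonal (\<lambda>l. r * b l)"
  using sums_scaleR_right[OF zonal_sums[OF assms], of r]
  by (simp add: zonal_def[of "\<lambda>l. r * b l"] sums_iff)

text \<open>The Sobolev norm of a zonal series is bounded by the weighted sum of its coefficients with this
  weight; this replaces square summability by absolute summability.\<close>

definition weight :: "real \<Rightarrow> nat \<Rightarrow> real" where
  "weight \<sigma> l = 1 + real l powr \<sigma>"

lemma weight_ge_1: "1 \<le> weight \<sigma> l"
  by (simp add: weight_def)

lemma weight_pos [simp]: "0 < weight \<sigma> l" "0 \<le> weight \<sigma> l"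
  using weight_ge_1[of \<sigma> l] by linarith+

lemma summable_weight_imp:
  assumes "summable (\<lambda>l. weight \<sigma> l * \<bar>b l\<bar>)"
  shows "summable (\<lambda>l. \<bar>b l\<bar>)"
  by (rule summable_comparison_test'[OF assms, of 0])
     (simp add: weight_def algebra_simps)

lemma summable_square:
  fixes x :: "nat \<Rightarrow> real"
  assumes "summable x" "\<And>n. 0 \<le> x n"
  shows "summable (\<lambda>n. (x n)\<^sup>2)" "sqrt (\<Sum>n. (x n)\<^sup>2) \<le> (\<Sum>n. x n)"
proof -
  have le: "(\<Sum>n<N. (x n)\<^sup>2) \<le> (\<Sum>n. x n)\<^sup>2" for N
  proof -
    have "(\<Sum>n<N. (x n)\<^sup>2) \<le> (\<Sum>n<N. x n)\<^sup>2"
    proof (induction N)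
      case (Suc N)
      have "0 \<le> (\<Sum>n<N. x n) * x N" using assms(2) by (intro mult_nonneg_nonneg sum_nonneg) auto
      with Suc show ?case by (simp add: power2_sum)
    qed simp
    also have "\<dots> \<le> (\<Sum>n. x n)\<^sup>2"
      using assms by (intro power_mono sum_le_suminf sum_nonneg) auto
    finally show ?thesis .
  qed
  show s: "summable (\<lambda>n. (x n)\<^sup>2)"
    by (rule summableI_nonneg_bounded[OF _ le]) auto
  have "(\<Sum>n. (x n)\<^sup>2) \<le> (\<Sum>n. x n)\<^sup>2"
    by (rule suminf_le_const[OF s le])
  then show "sqrt (\<Sum>n. (x n)\<^sup>2) \<le> (\<Sum>n. x n)"
    using assms by (intro real_le_lsqrt suminf_nonneg) auto
qed

lemma zonal_Sobolev:
  assumes "summable (\<lambda>l. weight \<sigma> l * \<bar>b l\<bar>)"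
  shows "zonal b \<in> Sobolev \<sigma>" and "Sobolev_norm \<sigma> (zonal b) \<le> (\<Sum>l. weight \<sigma> l * \<bar>b l\<bar>)"
proof -
  have s: "summable (\<lambda>l. \<bar>b l\<bar>)" using assms by (rule summable_weight_imp)
  have s': "summable (\<lambda>l. real l powr \<sigma> * \<bar>b l\<bar>)"
    using summable_diff[OF assms s] by (simp add: weight_def algebra_simps)
  have eq: "real l powr (2 * \<sigma>) * ang_power (zonal b) l = (real l powr \<sigma> * \<bar>b l\<bar>)\<^sup>2" for l
  proof -
    have "real l powr (2 * \<sigma>) = (real l powr \<sigma>)\<^sup>2"
      using powr_add[of "real l" \<sigma> \<sigma>] by (simp add: power2_eq_square)
    then show ?thesis by (simp add: ang_power_zonal[OF s] power_mult_distrib)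
  qed
  have nn: "0 \<le> real l powr \<sigma> * \<bar>b l\<bar>" for l by simp
  show "zonal b \<in> Sobolev \<sigma>"
    using summable_square(1)[OF s' nn] by (simp add: Sobolev_def eq)
  have "Sobolev_norm \<sigma> (zonal b) \<le> (\<Sum>l. \<bar>b l\<bar>) + (\<Sum>l. real l powr \<sigma> * \<bar>b l\<bar>)"
    unfolding Sobolev_norm_def eq by (intro add_mono norm_zonal_le s summable_square(2)[OF s' nn])
  also have "\<dots> = (\<Sum>l. weight \<sigma> l * \<bar>b l\<bar>)"
    by (subst suminf_add[OF s s']) (simp add: weight_def algebra_simps)
  finally show "Sobolev_norm \<sigma> (zonal b) \<le> (\<Sum>l. weight \<sigma> l * \<bar>b l\<bar>)" .
qed

lemma norm_le_Sobolev_norm: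
  assumes "f \<in> Sobolev \<sigma>"
  shows "norm f \<le> Sobolev_norm \<sigma> f"
proof -
  have "0 \<le> (\<Sum>l. real l powr (2 * \<sigma>) * ang_power f l)"
    using assms by (intro suminf_nonneg) (auto simp: Sobolev_def ang_power_def sum_nonneg)
  then show ?thesis by (simp add: Sobolev_norm_def)
qed

lemma Sobolev_diff:
  assumes "f \<in> Sobolev \<sigma>" "g \<in> Sobolev \<sigma>"
  shows "f - g \<in> Sobolev \<sigma>"
proof -
  have le: "ang_power (f - g) l \<le> 2 * ang_power f l + 2 * ang_power g l" for l
  proof -
    have sq: "(cmod (a - b))\<^sup>2 \<le> 2 * (cmod a)\<^sup>2 + 2 * (cmod b)\<^sup>2" for a b
    proof -
      have "(cmod (a - b))\<^sup>2 \<le> (cmod a + cmod b)\<^sup>2"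
        by (intro power_mono norm_triangle_ineq4) simp
      also have "\<dots> \<le> 2 * (cmod a)\<^sup>2 + 2 * (cmod b)\<^sup>2"
        using zero_le_power2[of "cmod a - cmod b"] by (simp add: power2_diff power2_sum)
      finally show ?thesis .
    qed
    show ?thesis
      unfolding ang_power_def sum_distrib_left sum.distrib[symmetric]
      by (intro sum_mono) (simp add: sq)
  qed
  have "summable (\<lambda>l. real l powr (2 * \<sigma>) * (2 * ang_power f l + 2 * ang_power g l))"
    using summable_add[OF summable_mult[of "\<lambda>l. real l powr (2 * \<sigma>) * ang_power f l" 2]
        summable_mult[of "\<lambda>l. real l powr (2 * \<sigma>) * ang_power g l" 2]] assms
    by (simp add: Sobolev_def algebra_simps)
  then have "summable (\<lambda>l. real l powr (2 * \<sigma>) * ang_power (f - g) l)"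
    by (rule summable_comparison_test'[where N = 0])
       (use le in \<open>auto simp: ang_power_def sum_nonneg intro!: mult_left_mono\<close>)
  then show ?thesis by (simp add: Sobolev_def)
qed

lemma Sobolev_scaleR:
  assumes "f \<in> Sobolev \<sigma>"
  shows "c *\<^sub>R f \<in> Sobolev \<sigma>"
proof -
  have eq: "real l powr (2 * \<sigma>) * ang_power (c *\<^sub>R f) l = c\<^sup>2 * (real l powr (2 * \<sigma>) * ang_power f l)" for l
    by (simp add: ang_power_def power_mult_distrib sum_distrib_left mult_ac)
  show ?thesis
    using assms unfolding Sobolev_def mem_Collect_eq eq by (rule summable_mult)
qed

lemma subspace_Sobolev: "subspace (Sobolev \<sigma>)"
proof (rule subspaceI)
  show "0 \<in> Sobolev \<sigma>" by (simp add: Sobolev_def ang_power_def)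
  show "f + g \<in> Sobolev \<sigma>" if "f \<in> Sobolev \<sigma>" "g \<in> Sobolev \<sigma>" for f g
    using Sobolev_diff[OF that(1) Sobolev_scaleR[OF that(2), of "-1"]] by simp
qed (rule Sobolev_scaleR)

lemma Sobolev_norm_zonal_diff_le:
  assumes "summable (\<lambda>l. weight \<sigma> l * \<bar>b l\<bar>)" "summable (\<lambda>l. weight \<sigma> l * \<bar>c l\<bar>)"
  shows "summable (\<lambda>l. weight \<sigma> l * \<bar>b l - c l\<bar>)"
    and "0 \<le> Sobolev_norm \<sigma> (zonal b - zonal c)"
    and "Sobolev_norm \<sigma> (zonal b - zonal c) \<le> (\<Sum>l. weight \<sigma> l * \<bar>b l - c l\<bar>)"
proof -
  show s: "summable (\<lambda>l. weight \<sigma> l * \<bar>b l - c l\<bar>)"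
  proof (rule summable_comparison_test'[OF summable_add[OF assms], of 0])
    fix l
    have "weight \<sigma> l * \<bar>b l - c l\<bar> \<le> weight \<sigma> l * (\<bar>b l\<bar> + \<bar>c l\<bar>)"
      by (intro mult_left_mono) auto
    then show "norm (weight \<sigma> l * \<bar>b l - c l\<bar>) \<le> weight \<sigma> l * \<bar>b l\<bar> + weight \<sigma> l * \<bar>c l\<bar>"
      by (simp add: distrib_left)
  qed
  have eq: "zonal b - zonal c = zonal (\<lambda>l. b l - c l)"
    by (rule zonal_diff[OF summable_weight_imp[OF assms(1)] summable_weight_imp[OF assms(2)]])
  show "0 \<le> Sobolev_norm \<sigma> (zonal b - zonal c)"
    unfolding eq by (rule order_trans[OF norm_ge_zero norm_le_Sobolev_norm[OF zonal_Sobolev(1)[OF s]]])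
  show "Sobolev_norm \<sigma> (zonal b - zonal c) \<le> (\<Sum>l. weight \<sigma> l * \<bar>b l - c l\<bar>)"
    unfolding eq by (rule zonal_Sobolev(2)[OF s])
qed

text \<open>Dominated convergence of series, for the Sobolev norm: convergence of each coefficient and a summable bound
  suffice. Continuity in time, the strong derivative and the limits in the Bochner integral are instances of this.\<close>

lemma zonal_tendsto:
  assumes lim: "\<And>l. ((\<lambda>\<tau>. b \<tau> l) \<longlongrightarrow> c l) F"
    and bound: "eventually (\<lambda>\<tau>. \<forall>l. weight \<sigma> l * \<bar>b \<tau> l\<bar> \<le> M l) F"
    and M: "summable M" and F: "F \<noteq> bot"
  shows "summable (\<lambda>l. weight \<sigma> l * \<bar>c l\<bar>)"
    and "((\<lambda>\<tau>. \<Sum>l. weight \<sigma> l * \<bar>b \<tau> l - c l\<bar>) \<longlongrightarrow> 0) F"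
    and "tendsto_in (Sobolev_norm \<sigma>) (\<lambda>\<tau>. zonal (b \<tau>)) (zonal c) F"
proof -
  have c_le: "weight \<sigma> l * \<bar>c l\<bar> \<le> M l" for l
  proof (rule tendsto_upperbound[OF _ _ F])
    show "((\<lambda>\<tau>. weight \<sigma> l * \<bar>b \<tau> l\<bar>) \<longlongrightarrow> weight \<sigma> l * \<bar>c l\<bar>) F"
      by (intro tendsto_intros lim)
    show "eventually (\<lambda>\<tau>. weight \<sigma> l * \<bar>b \<tau> l\<bar> \<le> M l) F"
      using bound by (rule eventually_mono) auto
  qed
  show sc: "summable (\<lambda>l. weight \<sigma> l * \<bar>c l\<bar>)"
    by (rule summable_comparison_test'[OF M]) (use c_le in auto)
  define e where "e l \<tau> = weight \<sigma> l * \<bar>b \<tau> l - c l\<bar>" for l \<tau>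
  have bound': "eventually (\<lambda>\<tau>. (\<forall>l. norm (e l \<tau>) \<le> 2 * M l) \<and> summable (\<lambda>l. weight \<sigma> l * \<bar>b \<tau> l\<bar>)) F"
    using bound
  proof (rule eventually_mono)
    fix \<tau> assume *: "\<forall>l. weight \<sigma> l * \<bar>b \<tau> l\<bar> \<le> M l"
    have "norm (e l \<tau>) \<le> 2 * M l" for l
    proof -
      have "e l \<tau> \<le> weight \<sigma> l * (\<bar>b \<tau> l\<bar> + \<bar>c l\<bar>)"
        unfolding e_def by (intro mult_left_mono) auto
      also have "\<dots> \<le> 2 * M l" using spec[OF *, of l] c_le[of l] unfolding distrib_left by linarith
      finally show ?thesis by (simp add: e_def)
    qed
    moreover have "summable (\<lambda>l. weight \<sigma> l * \<bar>b \<tau> l\<bar>)"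
      by (rule summable_comparison_test'[OF M]) (use * in auto)
    ultimately show "(\<forall>l. norm (e l \<tau>) \<le> 2 * M l) \<and> summable (\<lambda>l. weight \<sigma> l * \<bar>b \<tau> l\<bar>)" by blast
  qed
  have "((\<lambda>\<tau>. \<Sum>l. e l \<tau>) \<longlongrightarrow> (\<Sum>l. 0)) F"
  proof (rule tannerys_theorem[THEN conjunct2, THEN conjunct2])
    show "((\<lambda>\<tau>. e l \<tau>) \<longlongrightarrow> 0) F" for l
      unfolding e_def using tendsto_mult_right_zero[OF tendsto_rabs_zero[OF LIM_zero[OF lim[of l]]]] .
    have "eventually (\<lambda>x. (\<lambda>_. True) (fst x) \<and> (\<lambda>\<tau>. \<forall>l. norm (e l \<tau>) \<le> 2 * M l) (snd x)) (at_top \<times>\<^sub>F F)"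
      by (intro eventually_prodI eventually_mono[OF bound']) auto
    then show "eventually (\<lambda>(l, \<tau>). norm (e l \<tau>) \<le> 2 * M l) (at_top \<times>\<^sub>F F)"
      by (rule eventually_mono) auto
    show "summable (\<lambda>l. 2 * M l)" using M by (rule summable_mult)
  qed (rule F)
  then have lim0: "((\<lambda>\<tau>. \<Sum>l. e l \<tau>) \<longlongrightarrow> 0) F" by simp
  then show "((\<lambda>\<tau>. \<Sum>l. weight \<sigma> l * \<bar>b \<tau> l - c l\<bar>) \<longlongrightarrow> 0) F"
    by (simp add: e_def)
  have "eventually (\<lambda>\<tau>. norm (Sobolev_norm \<sigma> (zonal (b \<tau>) - zonal c)) \<le> (\<Sum>l. e l \<tau>)) F"
    using bound'
  proof (rule eventually_mono)
    fix \<tau> assume *: "(\<forall>l. norm (e l \<tau>) \<le> 2 * M l) \<and> summable (\<lambda>l. weight \<sigma> l * \<bar>b \<tau> l\<bar>)"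
    show "norm (Sobolev_norm \<sigma> (zonal (b \<tau>) - zonal c)) \<le> (\<Sum>l. e l \<tau>)"
      using Sobolev_norm_zonal_diff_le(2,3)[OF conjunct2[OF *] sc] by (simp add: e_def)
  qed
  then show "tendsto_in (Sobolev_norm \<sigma>) (\<lambda>\<tau>. zonal (b \<tau>)) (zonal c) F"
    unfolding tendsto_in_def using lim0 by (rule Lim_null_comparison)
qed

text \<open>The eigenvalue of the operator on the spherical harmonic of degree \<open>l\<close> and order \<open>m\<close>.\<close>

abbreviation symbol :: "real \<Rightarrow> nat \<Rightarrow> int \<Rightarrow> complex" where
  "symbol \<mu> l m \<equiv> \<i> * complex_of_real \<mu> * of_int m - of_nat (l * (l + 1))"

lemma G_op_zonal:
  assumes "summable (\<lambda>l. \<bar>b l\<bar>)"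
  shows "G_op \<mu> (zonal b) = zonal (\<lambda>l. - (real (l * (l + 1)) * b l))"
proof -
  have "(\<Sum>m = - int l..int l. (symbol \<mu> l m * fl_coeff (zonal b) l m) *\<^sub>C sph_harm_L2 l m)
     = (\<Sum>m = - int l..int l. if m = 0 then (- (real (l * (l + 1)) * b l)) *\<^sub>R sph_harm_L2 l 0 else 0)" for l
  proof (intro sum.cong refl)
    fix m :: int
    have "(\<i> * complex_of_real \<mu> * of_int 0 - of_nat (l * (l + 1))) * complex_of_real (b l) = complex_of_real (- (real (l * (l + 1)) * b l))"
      by (simp add: algebra_simps)
    then show "(symbol \<mu> l m * fl_coeff (zonal b) l m) *\<^sub>C sph_harm_L2 l m =
      (if m = 0 then (- (real (l * (l + 1)) * b l)) *\<^sub>R sph_harm_L2 l 0 else 0)"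
      unfolding fl_coeff_zonal[OF assms] scaleC_of_real[symmetric] by (cases "m = 0") (simp_all only: simp_thms if_True if_False mult_zero_right scaleC_0_left)
  qed
  then show ?thesis
    unfolding G_op_def zonal_def by simp
qed

lemma cmod_symbol_le:
  assumes "\<bar>m\<bar> \<le> int l"
  shows "cmod (symbol \<mu> l m) \<le> (\<bar>\<mu>\<bar> + 2) * real l ^ 2"
proof -
  have m: "\<bar>real_of_int m\<bar> \<le> real l" using assms by linarith
  have sq: "real l \<le> real l ^ 2"
    using self_le_power[of "real l" 2] by (cases "l = 0") auto
  have "cmod (symbol \<mu> l m) \<le> cmod (\<i> * complex_of_real \<mu> * of_int m) + cmod (of_nat (l * (l + 1)))"
    by (rule norm_triangle_ineq4)
  also have "\<dots> = \<bar>\<mu>\<bar> * \<bar>real_of_int m\<bar> + real (l * (l + 1))"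
    by (simp only: norm_mult norm_ii norm_of_real norm_of_int norm_of_nat mult_1)
  also have "\<dots> \<le> \<bar>\<mu>\<bar> * real l ^ 2 + (real l ^ 2 + real l ^ 2)"
    using m sq by (intro add_mono mult_left_mono) (auto simp: power2_eq_square algebra_simps)
  finally show ?thesis by (simp add: algebra_simps)
qed

text \<open>There are \<open>2 l + 1\<close> terms of degree \<open>l\<close>. By the inequality \<open>a b \<le> a\<^sup>2 + b\<^sup>2\<close> with \<open>a = l\<^sup>-\<^sup>s\<close> each of
  them is at most \<open>l\<^sup>-\<^sup>2\<^sup>s\<close> plus a multiple of \<open>l\<^sup>2\<^sup>(\<^sup>s\<^sup>+\<^sup>2\<^sup>)\<close> times a squared coefficient. The sum over all
  terms is finite precisely because \<open>s > 1\<close>.\<close>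

lemma G_op_sums:
  assumes v: "v \<in> Sobolev (s + 2)" and s: "s > 1"
  shows "(\<lambda>l. \<Sum>m = - int l..int l. (symbol \<mu> l m * fl_coeff v l m) *\<^sub>C sph_harm_L2 l m)
    sums G_op \<mu> v"
proof -
  define K where "K = \<bar>\<mu>\<bar> + 2"
  define g where "g l = (\<Sum>m = - int l..int l. (symbol \<mu> l m * fl_coeff v l m) *\<^sub>C sph_harm_L2 l m)" for l
  have K: "0 \<le> K" by (simp add: K_def)
  have g_le: "norm (g l) \<le> 3 * real l powr (1 - 2 * s) + K\<^sup>2 * (real l powr (2 * (s + 2)) * ang_power v l)" for l
  proof (cases "l = 0")
    case True
    then show ?thesis by (simp add: g_def)
  next
    case False
    then have l: "real l > 0" by simp
    have term_le: "norm ((symbol \<mu> l m * fl_coeff v l m) *\<^sub>C sph_harm_L2 l m)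
       \<le> real l powr (- (2 * s)) + K\<^sup>2 * real l powr (2 * s + 4) * (cmod (fl_coeff v l m))\<^sup>2"
      if "m \<in> {- int l..int l}" for m
    proof -
      define x where "x = cmod (fl_coeff v l m)"
      have "norm ((symbol \<mu> l m * fl_coeff v l m) *\<^sub>C sph_harm_L2 l m)
         = cmod (symbol \<mu> l m) * x * norm (sph_harm_L2 l m)"
        by (simp only: norm_scaleC norm_mult x_def)
      also have "\<dots> \<le> K * real l ^ 2 * x * 1"
        using cmod_symbol_le[of m l \<mu>] that norm_sph_harm_L2_le[of l m]
        by (intro mult_mono) (auto simp: x_def K_def)
      also have "\<dots> = real l powr (- s) * (K * real l powr (s + 2) * x)"
      proof -
        have "real l powr (- s) * real l powr (s + 2) = real l ^ 2"
          using l by (simp add: powr_add[symmetric])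
        then show ?thesis by (simp add: mult_ac)
      qed
      also have "\<dots> \<le> (real l powr (- s))\<^sup>2 + (K * real l powr (s + 2) * x)\<^sup>2"
      proof -
        have "a * b \<le> a\<^sup>2 + b\<^sup>2" for a b :: real
          using zero_le_power2[of "a - b"] zero_le_power2[of a] zero_le_power2[of b] unfolding power2_diff by linarith
        then show ?thesis .
      qed
      also have "\<dots> = real l powr (- (2 * s)) + K\<^sup>2 * real l powr (2 * s + 4) * x\<^sup>2"
      proof -
        have "(real l powr (- s))\<^sup>2 = real l powr (- (2 * s))"
          using powr_add[of "real l" "- s" "- s"] by (simp add: power2_eq_square)
        moreover have "(real l powr (s + 2))\<^sup>2 = real l powr (2 * s + 4)"
          using powr_add[of "real l" "s + 2" "s + 2"] by (simp add: power2_eq_square)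
        ultimately show ?thesis by (simp add: power_mult_distrib)
      qed
      finally show ?thesis unfolding x_def .
    qed
    have "norm (g l) \<le> (\<Sum>m = - int l..int l. real l powr (- (2 * s)) + K\<^sup>2 * real l powr (2 * s + 4) * (cmod (fl_coeff v l m))\<^sup>2)"
      unfolding g_def by (intro order_trans[OF norm_sum] sum_mono term_le)
    also have "\<dots> = (2 * real l + 1) * real l powr (- (2 * s)) + K\<^sup>2 * (real l powr (2 * (s + 2)) * ang_power v l)"
    proof -
      have "2 * (s + 2) = 2 * s + 4" by simp
      then show ?thesis
        by (simp add: sum.distrib ang_power_def sum_distrib_left mult.assoc)
    qed
    also have "(2 * real l + 1) * real l powr (- (2 * s)) \<le> (3 * real l) * real l powr (- (2 * s))"
      using False by (intro mult_right_mono) auto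
    also have "\<dots> = 3 * real l powr (1 - 2 * s)"
      using powr_mult_base[of "real l" "- (2 * s)"] by simp
    finally show ?thesis by simp
  qed
  have "summable (\<lambda>l. norm (g l))"
  proof (rule summable_comparison_test'[where N = 0])
    have "summable (\<lambda>l. real l powr (1 - 2 * s))"
      using s by (subst summable_real_powr_iff) auto
    then show "summable (\<lambda>l. 3 * real l powr (1 - 2 * s) + K\<^sup>2 * (real l powr (2 * (s + 2)) * ang_power v l))"
      using v by (intro summable_add summable_mult) (auto simp: Sobolev_def)
  qed (use g_le in auto)
  then have "g sums suminf g" by (intro summable_sums summable_sphere_L2)
  then show ?thesis by (simp add: G_op_def g_def[abs_def])
qed

lemma fl_coeff_G_op:
  assumes v: "v \<in> Sobolev (s + 2)" and s: "s > 1"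
  shows "fl_coeff (G_op \<mu> v) l m = symbol \<mu> l m * fl_coeff v l m"
proof (cases "\<bar>m\<bar> \<le> int l")
  case True
  define c where "c l m = symbol \<mu> l m * fl_coeff v l m" for l m
  have "(\<lambda>l'. fl_coeff (\<Sum>m' = - int l'..int l'. c l' m' *\<^sub>C sph_harm_L2 l' m') l m) sums fl_coeff (G_op \<mu> v) l m"
    unfolding c_def by (rule bounded_linear.sums[OF bounded_linear_fl_coeff G_op_sums[OF v s]])
  moreover have "fl_coeff (\<Sum>m' = - int l'..int l'. c l' m' *\<^sub>C sph_harm_L2 l' m') l m = (if l' = l then c l m else 0)" for l'
  proof -
    have "fl_coeff (\<Sum>m' = - int l'..int l'. c l' m' *\<^sub>C sph_harm_L2 l' m') l m =
       (\<Sum>m' = - int l'..int l'. if m' = m then (if l' = l then c l m else 0) else 0)"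
      unfolding fl_coeff_sum by (intro sum.cong refl) (use True in \<open>auto simp: fl_coeff_sph_harm_L2\<close>)
    then show ?thesis using True by auto
  qed
  ultimately have "(\<lambda>l'. if l' = l then c l m else 0) sums fl_coeff (G_op \<mu> v) l m" by simp
  then show ?thesis
    using sums_unique2[OF _ sums_single[of l "\<lambda>_. c l m"]] by (simp add: c_def)
qed (simp add: fl_coeff_outside)

section \<open>Uniqueness of the strong solution\<close>

lemma tendsto_in_Sobolev_imp_tendsto:
  assumes "tendsto_in (Sobolev_norm \<sigma>) f x F" and "x \<in> Sobolev \<sigma>" and "eventually (\<lambda>t. f t \<in> Sobolev \<sigma>) F"
  shows "(f \<longlongrightarrow> x) F"
proof -
  have "eventually (\<lambda>t. norm (f t - x) \<le> Sobolev_norm \<sigma> (f t - x)) F"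
    using assms(3) by (rule eventually_mono) (intro norm_le_Sobolev_norm Sobolev_diff assms(2))
  then have "((\<lambda>t. f t - x) \<longlongrightarrow> 0) F"
    using assms(1) unfolding tendsto_in_def by (rule Lim_null_comparison)
  then show ?thesis by (rule LIM_zero_cancel)
qed

text \<open>The approximating simple functions of the Bochner integral in the Sobolev space are mapped to approximating simple
  functions of an ordinary integral. The function \<open>t \<mapsto> N (f t - \<rho> i t)\<close> need not be measurable, so constants
  are pulled out of the integral before it is compared with that function.\<close>

lemma has_bochner_integral_in_functional:
  fixes \<phi> :: "sphere_L2 \<Rightarrow> complex"
  assumes \<phi>: "bounded_linear \<phi>" and f: "has_bochner_integral_in (Sobolev \<sigma>) (Sobolev_norm \<sigma>) M f x"
    and meas [measurable]: "(\<lambda>t. \<phi> (f t)) \<in> borel_measurable M"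
  shows "has_bochner_integral M (\<lambda>t. \<phi> (f t)) (\<phi> x)"
proof -
  interpret \<phi>: bounded_linear \<phi> by fact
  from f obtain \<rho> where x: "x \<in> Sobolev \<sigma>" and fV: "\<And>t. t \<in> space M \<Longrightarrow> f t \<in> Sobolev \<sigma>"
    and \<rho>: "\<And>i. Bochner_Integration.simple_bochner_integrable M (\<rho> i)" "\<And>i t. t \<in> space M \<Longrightarrow> \<rho> i t \<in> Sobolev \<sigma>"
    and lim: "(\<lambda>i. \<integral>\<^sup>+t. ennreal (Sobolev_norm \<sigma> (f t - \<rho> i t)) \<partial>M) \<longlonglongrightarrow> 0"
    and lim_int: "tendsto_in (Sobolev_norm \<sigma>) (\<lambda>i. Bochner_Integration.simple_bochner_integral M (\<rho> i)) x sequentially"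
    unfolding has_bochner_integral_in_def by blast
  obtain K where K: "0 < K" "\<And>y. norm (\<phi> y) \<le> norm y * K"
    using \<phi>.pos_bounded by blast
  have simple: "Bochner_Integration.simple_bochner_integrable M (\<lambda>t. \<phi> (\<rho> i t))" for i
    by (rule simple_bochner_integrable_compose2[where p = "\<lambda>y _. \<phi> y", OF _ \<rho>(1) \<rho>(1)]) (simp add: \<phi>.zero)
  show ?thesis
  proof (rule has_bochner_integral.intros[OF meas simple])
    show "(\<lambda>i. \<integral>\<^sup>+t. ennreal (norm (\<phi> (f t) - \<phi> (\<rho> i t))) \<partial>M) \<longlonglongrightarrow> 0"
    proof (rule tendsto_sandwich[of "\<lambda>_. 0" _ _ "\<lambda>i. ennreal K * (\<integral>\<^sup>+t. ennreal (Sobolev_norm \<sigma> (f t - \<rho> i t)) \<partial>M)"])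
      show "\<forall>\<^sub>F i in sequentially. (\<integral>\<^sup>+t. ennreal (norm (\<phi> (f t) - \<phi> (\<rho> i t))) \<partial>M)
          \<le> ennreal K * (\<integral>\<^sup>+t. ennreal (Sobolev_norm \<sigma> (f t - \<rho> i t)) \<partial>M)"
      proof (intro always_eventually allI)
        fix i
        have "(\<lambda>t. \<phi> (\<rho> i t)) \<in> borel_measurable M"
          using simple[of i] by (auto elim: simple_bochner_integrable.cases intro: borel_measurable_simple_function)
        then have [measurable]: "(\<lambda>t. norm (\<phi> (f t) - \<phi> (\<rho> i t)) / K) \<in> borel_measurable M"
          by measurable
        have "(\<integral>\<^sup>+t. ennreal (norm (\<phi> (f t) - \<phi> (\<rho> i t))) \<partial>M)
            = (\<integral>\<^sup>+t. ennreal K * ennreal (norm (\<phi> (f t) - \<phi> (\<rho> i t)) / K) \<partial>M)"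
          using K(1) by (intro nn_integral_cong) (simp flip: ennreal_mult)
        also have "\<dots> = ennreal K * (\<integral>\<^sup>+t. ennreal (norm (\<phi> (f t) - \<phi> (\<rho> i t)) / K) \<partial>M)"
          by (rule nn_integral_cmult) measurable
        also have "\<dots> \<le> ennreal K * (\<integral>\<^sup>+t. ennreal (Sobolev_norm \<sigma> (f t - \<rho> i t)) \<partial>M)"
        proof (intro mult_left_mono nn_integral_mono ennreal_leI)
          fix t assume t: "t \<in> space M"
          have "norm (\<phi> (f t) - \<phi> (\<rho> i t)) / K \<le> norm (f t - \<rho> i t)"
            using K(2)[of "f t - \<rho> i t"] K(1) by (simp add: \<phi>.diff divide_le_eq)
          also have "\<dots> \<le> Sobolev_norm \<sigma> (f t - \<rho> i t)"
            by (intro norm_le_Sobolev_norm Sobolev_diff fV \<rho>(2) t)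
          finally show "norm (\<phi> (f t) - \<phi> (\<rho> i t)) / K \<le> Sobolev_norm \<sigma> (f t - \<rho> i t)" .
        qed simp
        finally show "(\<integral>\<^sup>+t. ennreal (norm (\<phi> (f t) - \<phi> (\<rho> i t))) \<partial>M)
          \<le> ennreal K * (\<integral>\<^sup>+t. ennreal (Sobolev_norm \<sigma> (f t - \<rho> i t)) \<partial>M)" .
      qed
      have "(\<lambda>i. ennreal K * (\<integral>\<^sup>+t. ennreal (Sobolev_norm \<sigma> (f t - \<rho> i t)) \<partial>M)) \<longlonglongrightarrow> ennreal K * 0"
        by (intro ennreal_tendsto_cmult lim) simp
      then show "(\<lambda>i. ennreal K * (\<integral>\<^sup>+t. ennreal (Sobolev_norm \<sigma> (f t - \<rho> i t)) \<partial>M)) \<longlonglongrightarrow> 0"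
        by simp
    qed auto
    have "Bochner_Integration.simple_bochner_integral M (\<rho> i) \<in> Sobolev \<sigma>" for i
      unfolding simple_bochner_integral_def using \<rho>(2)
      by (intro subspace_sum[OF subspace_Sobolev] Sobolev_scaleR) auto
    then have "(\<lambda>i. Bochner_Integration.simple_bochner_integral M (\<rho> i)) \<longlonglongrightarrow> x"
      by (intro tendsto_in_Sobolev_imp_tendsto[OF lim_int x]) auto
    then have "(\<lambda>i. \<phi> (Bochner_Integration.simple_bochner_integral M (\<rho> i))) \<longlonglongrightarrow> \<phi> x"
      by (rule \<phi>.tendsto)
    then show "(\<lambda>i. Bochner_Integration.simple_bochner_integral M (\<lambda>t. \<phi> (\<rho> i t))) \<longlonglongrightarrow> \<phi> x"
      by (simp add: simple_bochner_integral_linear[OF \<phi>.linear \<rho>(1)])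
  qed
qed

lemma levy_tail_eq_riesz: "levy_tail \<alpha> = riesz (1 - \<alpha>)"
  by (rule ext) (simp add: levy_tail_def riesz_def)

lemma continuous_into_Sobolev_imp_continuous_on:
  assumes "continuous_into (Sobolev \<sigma>) (Sobolev_norm \<sigma>) I u"
  shows "continuous_on I u"
  unfolding continuous_on_def
proof
  fix t assume t: "t \<in> I"
  have "eventually (\<lambda>\<tau>. u \<tau> \<in> Sobolev \<sigma>) (at t within I)"
    using assms by (auto simp: eventually_at_filter continuous_into_def)
  then show "(u \<longlongrightarrow> u t) (at t within I)"
    using assms t unfolding continuous_into_def by (intro tendsto_in_Sobolev_imp_tendsto[of \<sigma>]) auto
qed

text \<open>A continuous functional turns a solution of the Cauchy problem into a scalar function with a fractional
  derivative. The convolution integral in the definition of the nonlocal derivative may depend on the time at which the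
  derivative is taken; its image under the functional does not, being an ordinary integral.\<close>

lemma solution_functional:
  fixes \<phi> :: "sphere_L2 \<Rightarrow> complex" and v :: "real \<Rightarrow> sphere_L2"
  assumes \<phi>: "bounded_linear \<phi>" and sol: "solves_Cauchy_problem \<mu> \<alpha> s f v"
  defines "J \<equiv> \<lambda>r. \<integral>\<tau>. riesz (1 - \<alpha>) (r - \<tau>) *\<^sub>R \<phi> (v \<tau> - f) \<partial>restrict_space lborel {0..r}"
  shows "continuous_on {0..} (\<lambda>t. \<phi> (v t))"
    and "\<And>r. 0 < r \<Longrightarrow> has_bochner_integral (restrict_space lborel {0..r}) (\<lambda>\<tau>. riesz (1 - \<alpha>) (r - \<tau>) *\<^sub>R \<phi> (v \<tau> - f)) (J r)"
    and "\<And>t. 0 < t \<Longrightarrow> ((\<lambda>h. (J (t + h) - J t) /\<^sub>R h) \<longlongrightarrow> \<phi> (G_op \<mu> (v t))) (at 0)"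
proof -
  interpret \<phi>: bounded_linear \<phi> by fact
  let ?V = "Sobolev s" and ?N = "Sobolev_norm s"
  have cv: "continuous_into ?V ?N {0..} v" and v0: "v 0 = f"
    using sol unfolding solves_Cauchy_problem_def by blast+
  have vV: "v t \<in> ?V" if "0 \<le> t" for t
    using cv that by (auto simp: continuous_into_def)
  have cont_v: "continuous_on {0..} v"
    by (rule continuous_into_Sobolev_imp_continuous_on[OF cv])
  then show "continuous_on {0..} (\<lambda>t. \<phi> (v t))"
    by (rule \<phi>.continuous_on)
  have core: "\<exists>J'. (\<forall>r>0. J' r \<in> ?V \<and> has_bochner_integral (restrict_space lborel {0..r}) (\<lambda>\<tau>. riesz (1 - \<alpha>) (r - \<tau>) *\<^sub>R \<phi> (v \<tau> - f)) (\<phi> (J' r)))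
      \<and> tendsto_in ?N (\<lambda>h. (J' (t + h) - J' t) /\<^sub>R h) (G_op \<mu> (v t)) (at 0) \<and> G_op \<mu> (v t) \<in> ?V" if "0 < t" for t
  proof -
    obtain D where "\<forall>t>0. has_nonlocal_derivative_in ?V ?N (levy_tail \<alpha>) v (D t) t" "\<forall>t>0. D t = G_op \<mu> (v t)"
      using sol unfolding solves_Cauchy_problem_def by blast
    with that have "has_nonlocal_derivative_in ?V ?N (levy_tail \<alpha>) v (G_op \<mu> (v t)) t" by metis
    then obtain u0 J' where u0: "u0 \<in> ?V" "tendsto_in ?N v u0 (at_right 0)" and GV: "G_op \<mu> (v t) \<in> ?V"
      and J': "\<And>r. 0 < r \<Longrightarrow> has_bochner_integral_in ?V ?N (restrict_space lborel {0..r}) (\<lambda>\<tau>. levy_tail \<alpha> (r - \<tau>) *\<^sub>R (v \<tau> - u0)) (J' r)"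
      and lim: "tendsto_in ?N (\<lambda>h. (J' (t + h) - J' t) /\<^sub>R h) (G_op \<mu> (v t)) (at 0)"
      unfolding has_nonlocal_derivative_in_def by blast
    have "(v \<longlongrightarrow> u0) (at_right 0)"
      by (rule tendsto_in_Sobolev_imp_tendsto[OF u0(2,1)]) (auto simp: eventually_at_filter vV)
    moreover have "(v \<longlongrightarrow> v 0) (at_right 0)"
      using cont_v by (intro tendsto_within_subset[of v _ 0 "{0..}" "{0<..}"]) (auto simp: continuous_on_def)
    ultimately have u0_eq: "u0 = f"
      using tendsto_unique[of "at_right (0::real)" v] v0 by auto
    have "J' r \<in> ?V \<and> has_bochner_integral (restrict_space lborel {0..r}) (\<lambda>\<tau>. riesz (1 - \<alpha>) (r - \<tau>) *\<^sub>R \<phi> (v \<tau> - f)) (\<phi> (J' r))"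
      if r: "0 < r" for r
    proof
      show "J' r \<in> ?V" using J'[OF r] by (simp add: has_bochner_integral_in_def)
      have "continuous_on {0..r} (\<lambda>\<tau>. \<phi> (v \<tau> - f))"
        by (intro \<phi>.continuous_on continuous_intros continuous_on_subset[OF cont_v]) auto
      then have "(\<lambda>\<tau>. \<phi> (v \<tau> - f)) \<in> borel_measurable (restrict_space borel {0..r})"
        by (rule borel_measurable_continuous_on_restrict)
      then have m1: "(\<lambda>\<tau>. \<phi> (v \<tau> - f)) \<in> borel_measurable (restrict_space lborel {0..r})"
        by (simp add: measurable_cong_sets[OF sets_restrict_space_cong[OF sets_lborel] refl])
      have m2: "(\<lambda>\<tau>. riesz (1 - \<alpha>) (r - \<tau>)) \<in> borel_measurable (restrict_space lborel {0..r})"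
        by (rule measurable_restrict_lborel) measurable
      have "(\<lambda>\<tau>. riesz (1 - \<alpha>) (r - \<tau>) *\<^sub>R \<phi> (v \<tau> - f)) \<in> borel_measurable (restrict_space lborel {0..r})"
        using m2 m1 by (rule borel_measurable_scaleR)
      then show "has_bochner_integral (restrict_space lborel {0..r}) (\<lambda>\<tau>. riesz (1 - \<alpha>) (r - \<tau>) *\<^sub>R \<phi> (v \<tau> - f)) (\<phi> (J' r))"
        using has_bochner_integral_in_functional[OF \<phi> J'[OF r]] by (simp add: u0_eq \<phi>.scaleR levy_tail_eq_riesz)
    qed
    with lim GV show ?thesis by blast
  qed
  have J_eq: "J r = \<phi> y" if "has_bochner_integral (restrict_space lborel {0..r}) (\<lambda>\<tau>. riesz (1 - \<alpha>) (r - \<tau>) *\<^sub>R \<phi> (v \<tau> - f)) (\<phi> y)" for r y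
    unfolding J_def using that by (rule has_bochner_integral_integral_eq)
  show "has_bochner_integral (restrict_space lborel {0..r}) (\<lambda>\<tau>. riesz (1 - \<alpha>) (r - \<tau>) *\<^sub>R \<phi> (v \<tau> - f)) (J r)" if r: "0 < r" for r
  proof -
    obtain y where "has_bochner_integral (restrict_space lborel {0..r}) (\<lambda>\<tau>. riesz (1 - \<alpha>) (r - \<tau>) *\<^sub>R \<phi> (v \<tau> - f)) (\<phi> y)"
      using core[OF r] r by blast
    then show ?thesis using J_eq by simp
  qed
  show "((\<lambda>h. (J (t + h) - J t) /\<^sub>R h) \<longlongrightarrow> \<phi> (G_op \<mu> (v t))) (at 0)" if t: "0 < t" for t
  proof -
    obtain J' where J': "\<And>r. 0 < r \<Longrightarrow> J' r \<in> ?V"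
      "\<And>r. 0 < r \<Longrightarrow> has_bochner_integral (restrict_space lborel {0..r}) (\<lambda>\<tau>. riesz (1 - \<alpha>) (r - \<tau>) *\<^sub>R \<phi> (v \<tau> - f)) (\<phi> (J' r))"
      and lim: "tendsto_in ?N (\<lambda>h. (J' (t + h) - J' t) /\<^sub>R h) (G_op \<mu> (v t)) (at 0)" and GV: "G_op \<mu> (v t) \<in> ?V"
      using core[OF t] by blast
    have ev: "eventually (\<lambda>h. 0 < t + h) (at 0)"
      unfolding eventually_at using t by (intro exI[of _ t]) (auto simp: dist_real_def)
    have "eventually (\<lambda>h. (J' (t + h) - J' t) /\<^sub>R h \<in> ?V) (at 0)"
      using ev by (rule eventually_mono) (intro Sobolev_scaleR Sobolev_diff J'(1) t)
    then have "((\<lambda>h. (J' (t + h) - J' t) /\<^sub>R h) \<longlongrightarrow> G_op \<mu> (v t)) (at 0)"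
      by (rule tendsto_in_Sobolev_imp_tendsto[OF lim GV])
    then have "((\<lambda>h. \<phi> ((J' (t + h) - J' t) /\<^sub>R h)) \<longlongrightarrow> \<phi> (G_op \<mu> (v t))) (at 0)"
      by (rule \<phi>.tendsto)
    moreover have "eventually (\<lambda>h. \<phi> ((J' (t + h) - J' t) /\<^sub>R h) = (J (t + h) - J t) /\<^sub>R h) (at 0)"
      using ev by (rule eventually_mono) (simp add: \<phi>.scaleR \<phi>.diff J_eq[OF J'(2)] t)
    ultimately show ?thesis by (rule Lim_transform_eventually)
  qed
qed

lemma solutions_agree_functional:
  fixes \<phi> :: "sphere_L2 \<Rightarrow> complex"
  assumes \<alpha>: "0 < \<alpha>" "\<alpha> < 1" and \<phi>: "bounded_linear \<phi>"
    and u: "solves_Cauchy_problem \<mu> \<alpha> s f u" and v: "solves_Cauchy_problem \<mu> \<alpha> s f v"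
    and eigen: "\<And>t. 0 < t \<Longrightarrow> \<phi> (G_op \<mu> (v t)) - \<phi> (G_op \<mu> (u t)) = c * (\<phi> (v t) - \<phi> (u t))"
    and t: "0 \<le> t"
  shows "\<phi> (v t) = \<phi> (u t)"
proof -
  interpret \<phi>: bounded_linear \<phi> by fact
  define J where "J w r = (\<integral>\<tau>. riesz (1 - \<alpha>) (r - \<tau>) *\<^sub>R \<phi> (w \<tau> - f) \<partial>restrict_space lborel {0..r})" for w r
  note su = solution_functional[OF \<phi> u, folded J_def] and sv = solution_functional[OF \<phi> v, folded J_def]
  have "\<phi> (v t) - \<phi> (u t) = 0"
  proof (rule fractional_ivp_unique[OF \<alpha>, where J = "\<lambda>r. J v r - J u r"])
    show "continuous_on {0..} (\<lambda>t. \<phi> (v t) - \<phi> (u t))"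
      by (intro continuous_on_diff su(1) sv(1))
  next
    fix r :: real assume r: "0 < r"
    have "riesz (1 - \<alpha>) (r - \<tau>) *\<^sub>R \<phi> (v \<tau> - f) - riesz (1 - \<alpha>) (r - \<tau>) *\<^sub>R \<phi> (u \<tau> - f)
        = riesz (1 - \<alpha>) (r - \<tau>) *\<^sub>R (\<phi> (v \<tau>) - \<phi> (u \<tau>))" for \<tau>
      by (simp add: \<phi>.diff scaleR_diff_right)
    then show "has_bochner_integral (restrict_space lborel {0..r}) (\<lambda>\<tau>. riesz (1 - \<alpha>) (r - \<tau>) *\<^sub>R (\<phi> (v \<tau>) - \<phi> (u \<tau>))) (J v r - J u r)"
      using has_bochner_integral_diff[OF sv(2)[OF r] su(2)[OF r]] by simp
  next
    fix t :: real assume t: "0 < t"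
    have "((\<lambda>h. (J v (t + h) - J v t) /\<^sub>R h - (J u (t + h) - J u t) /\<^sub>R h) \<longlongrightarrow> c * (\<phi> (v t) - \<phi> (u t))) (at 0)"
      using tendsto_diff[OF sv(3)[OF t] su(3)[OF t]] by (simp only: eigen[OF t])
    then show "((\<lambda>h. (J v (t + h) - J u (t + h) - (J v t - J u t)) /\<^sub>R h) \<longlongrightarrow> c * (\<phi> (v t) - \<phi> (u t))) (at 0)"
      by (simp add: algebra_simps)
  qed (rule t)
  then show ?thesis by simp
qed

text \<open>First the coefficients of the difference vanish, since they satisfy equations with rates
  \<open>symbol \<mu> l m\<close>. As \<open>G_op\<close> sees only the coefficients, the inner product of the difference with
  any vector then satisfies the equation with rate 0; the vector chosen is the difference itself.\<close>

lemma Cauchy_problem_unique: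
  assumes \<alpha>: "0 < \<alpha>" "\<alpha> < 1" and s: "s > 1"
    and u: "solves_Cauchy_problem \<mu> \<alpha> s f u" and v: "solves_Cauchy_problem \<mu> \<alpha> s f v" and t: "0 \<le> t"
  shows "v t = u t"
proof -
  have "continuous_into (Sobolev (s + 2)) (Sobolev_norm (s + 2)) {0<..} u"
    "continuous_into (Sobolev (s + 2)) (Sobolev_norm (s + 2)) {0<..} v"
    using u v unfolding solves_Cauchy_problem_def by blast+
  then have reg: "u t \<in> Sobolev (s + 2)" "v t \<in> Sobolev (s + 2)" if "0 < t" for t
    using that by (simp_all add: continuous_into_def)
  have coeff: "fl_coeff (v t) l m = fl_coeff (u t) l m" if "0 \<le> t" for t l m
  proof (rule solutions_agree_functional[OF \<alpha> bounded_linear_fl_coeff u v _ that])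
    fix t :: real assume "0 < t"
    show "fl_coeff (G_op \<mu> (v t)) l m - fl_coeff (G_op \<mu> (u t)) l m =
        symbol \<mu> l m * (fl_coeff (v t) l m - fl_coeff (u t) l m)"
      unfolding fl_coeff_G_op[OF reg(1)[OF \<open>0 < t\<close>] s] fl_coeff_G_op[OF reg(2)[OF \<open>0 < t\<close>] s]
      by (rule right_diff_distrib[symmetric])
  qed
  have G_eq: "G_op \<mu> (v t) = G_op \<mu> (u t)" if "0 < t" for t
    unfolding G_op_def coeff[OF less_imp_le[OF that]] ..
  define w where "w = v t - u t"
  have "bounded_linear (\<lambda>x. complex_of_real (inner x w))"
    by (intro bounded_linear_compose[OF bounded_linear_of_real] bounded_linear_inner_left)
  then have "complex_of_real (inner (v t) w) = complex_of_real (inner (u t) w)"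
  proof (rule solutions_agree_functional[OF \<alpha> _ u v _ t])
    fix t :: real assume "0 < t"
    show "complex_of_real (inner (G_op \<mu> (v t)) w) - complex_of_real (inner (G_op \<mu> (u t)) w) =
        0 * (complex_of_real (inner (v t) w) - complex_of_real (inner (u t) w))"
      unfolding G_eq[OF \<open>0 < t\<close>] by simp
  qed
  then have "inner w w = 0"
    by (simp add: w_def inner_diff_left)
  then show ?thesis by (simp add: w_def)
qed

section \<open>Bochner integrals of zonal series\<close>

lemma zonal_truncated:
  "zonal (\<lambda>l. if l < n then c l else 0) = (\<Sum>l<n. c l *\<^sub>R sph_harm_L2 l 0)"
  unfolding zonal_def by (subst suminf_finite[of "{..<n}"]) (auto intro!: sum.cong)

lemma summable_truncated: "summable (\<lambda>l. weight \<sigma> l * \<bar>if l < n then c l else 0\<bar>)"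
  by (rule summable_finite[of "{..<n}"]) auto

lemma simple_bochner_sum:
  fixes s :: "nat \<Rightarrow> 'a \<Rightarrow> real" and y :: "nat \<Rightarrow> 'b::real_vector"
  assumes "\<And>l. Bochner_Integration.simple_bochner_integrable M (s l)"
  shows "Bochner_Integration.simple_bochner_integrable M (\<lambda>t. \<Sum>l<n. (a l * s l t) *\<^sub>R y l) \<and>
    Bochner_Integration.simple_bochner_integral M (\<lambda>t. \<Sum>l<n. (a l * s l t) *\<^sub>R y l)
      = (\<Sum>l<n. (a l * integral\<^sup>L M (s l)) *\<^sub>R y l)"
proof (induction n)
  case 0
  have "simple_function M (\<lambda>_. 0 :: 'b)" by simp
  then show ?case
    by (auto intro!: simple_bochner_integrable.intros sum.neutral simp: simple_bochner_integral_def)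
next
  case (Suc n)
  have t: "Bochner_Integration.simple_bochner_integrable M (\<lambda>t. (a n * s n t) *\<^sub>R y n)"
    by (rule simple_bochner_integrable_compose2[where p = "\<lambda>x _. (a n * x) *\<^sub>R y n", OF _ assms assms]) simp
  have "linear (\<lambda>x::real. (a n * x) *\<^sub>R y n)"
    by (rule linearI) (simp_all add: algebra_simps)
  from simple_bochner_integral_linear[OF this assms[of n]]
  have i: "Bochner_Integration.simple_bochner_integral M (\<lambda>t. (a n * s n t) *\<^sub>R y n) = (a n * integral\<^sup>L M (s n)) *\<^sub>R y n"
    by (simp add: simple_bochner_integrable_eq_integral[OF assms])
  have "Bochner_Integration.simple_bochner_integrable M (\<lambda>t. (\<Sum>l<n. (a l * s l t) *\<^sub>R y l) + (a n * s n t) *\<^sub>R y n)"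
    using Suc t by (intro simple_bochner_integrable_compose2[where p = "(+)"]) auto
  moreover have "Bochner_Integration.simple_bochner_integral M (\<lambda>t. (\<Sum>l<n. (a l * s l t) *\<^sub>R y l) + (a n * s n t) *\<^sub>R y n)
     = (\<Sum>l<n. (a l * integral\<^sup>L M (s l)) *\<^sub>R y l) + (a n * integral\<^sup>L M (s n)) *\<^sub>R y n"
    using simple_bochner_integral_add[OF conjunct1[OF Suc] t] Suc i by simp
  ultimately show ?case by simp
qed

text \<open>The approximating functions are finite zonal sums in which each scalar integrand is replaced
  by simple functions converging to it with twice its modulus as bound. Pointwise convergence, convergence
  in mean and convergence of the integrals are then dominated convergence, for series and for integrals.\<close>

lemma zonal_bochner_integral:
  assumes p: "\<And>l. has_bochner_integral M (p l) (I l)"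
    and h: "integrable M h" and le: "\<And>l t. t \<in> space M \<Longrightarrow> \<bar>p l t\<bar> \<le> h t"
    and a: "summable (\<lambda>l. weight \<sigma> l * \<bar>a l\<bar>)"
    and f: "\<And>t. t \<in> space M \<Longrightarrow> f t = zonal (\<lambda>l. a l * p l t)"
  shows "has_bochner_integral_in (Sobolev \<sigma>) (Sobolev_norm \<sigma>) M f (zonal (\<lambda>l. a l * I l))"
proof -
  have p_int: "integrable M (p l)" and I: "I l = integral\<^sup>L M (p l)" for l
    using p[of l] by (auto simp: has_bochner_integral_iff)
  have [measurable]: "p l \<in> borel_measurable M" for l using p_int by auto
  have "\<exists>S. (\<forall>i. simple_function M (S i)) \<and> (\<forall>t\<in>space M. (\<lambda>i. S i t) \<longlonglongrightarrow> p l t) \<and>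
     (\<forall>i. \<forall>t\<in>space M. dist (S i t) 0 \<le> 2 * dist (p l t) 0)" for l
    by (rule borel_measurable_implies_sequence_metric) measurable
  then have "\<forall>l. \<exists>S. (\<forall>i. simple_function M (S i)) \<and> (\<forall>t\<in>space M. (\<lambda>i. S i t) \<longlonglongrightarrow> p l t) \<and>
     (\<forall>i. \<forall>t\<in>space M. dist (S i t) 0 \<le> 2 * dist (p l t) 0)" by blast
  from choice[OF this] obtain S where
    S_simple: "\<And>l i. simple_function M (S l i)" and
    S_lim: "\<And>l t. t \<in> space M \<Longrightarrow> (\<lambda>i. S l i t) \<longlonglongrightarrow> p l t" and
    S_dist: "\<And>l i t. t \<in> space M \<Longrightarrow> dist (S l i t) 0 \<le> 2 * dist (p l t) 0"
    by blast
  have S_le: "\<bar>S l i t\<bar> \<le> 2 * h t" if "t \<in> space M" for l i t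
    using S_dist[OF that, of l i] le[OF that, of l] by (simp add: dist_real_def)
  have h_nonneg: "0 \<le> h t" if "t \<in> space M" for t
    using le[OF that, of 0] by linarith
  have [measurable]: "S l i \<in> borel_measurable M" for l i
    using S_simple by (rule borel_measurable_simple_function)
  have [measurable]: "h \<in> borel_measurable M" using h by auto
  have S_int: "integrable M (S l i)" for l i
    by (rule Bochner_Integration.integrable_bound[of M "\<lambda>t. 2 * h t"])
       (use h h_nonneg S_le in \<open>auto intro!: AE_I2\<close>)
  have S_sbi: "Bochner_Integration.simple_bochner_integrable M (S l i)" for l i
    using S_simple S_int[of l i] by (intro simple_bochner_integrableI_bounded) (auto simp: integrable_iff_bounded)
  define b where "b i t l = (if l < i then a l * S l i t else 0)" for i t l
  define \<rho> where "\<rho> i t = (\<Sum>l<i. (a l * S l i t) *\<^sub>R sph_harm_L2 l 0)" for i t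
  have \<rho>_eq: "\<rho> i t = zonal (b i t)" for i t
    unfolding \<rho>_def b_def by (rule zonal_truncated[symmetric])
  have b_sum: "summable (\<lambda>l. weight \<sigma> l * \<bar>b i t l\<bar>)" for i t
    unfolding b_def by (rule summable_truncated)
  have b_lim: "(\<lambda>i. b i t l) \<longlonglongrightarrow> a l * p l t" if "t \<in> space M" for t l
  proof (rule Lim_transform_eventually)
    show "(\<lambda>i. a l * S l i t) \<longlonglongrightarrow> a l * p l t"
      by (intro tendsto_mult_left S_lim that)
    show "eventually (\<lambda>i. a l * S l i t = b i t l) sequentially"
      using eventually_gt_at_top[of l] by (rule eventually_mono) (simp add: b_def)
  qed
  have b_bound: "weight \<sigma> l * \<bar>b i t l\<bar> \<le> 2 * h t * (weight \<sigma> l * \<bar>a l\<bar>)" if "t \<in> space M" for i t l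
  proof -
    have "\<bar>b i t l\<bar> \<le> \<bar>a l\<bar> * (2 * h t)"
      using S_le[OF that, of l i] h_nonneg[OF that] by (auto simp: b_def abs_mult intro!: mult_left_mono)
    then have "weight \<sigma> l * \<bar>b i t l\<bar> \<le> weight \<sigma> l * (\<bar>a l\<bar> * (2 * h t))"
      by (intro mult_left_mono) auto
    then show ?thesis by (simp only: mult_ac)
  qed
  have tendsto:
    "summable (\<lambda>l. weight \<sigma> l * \<bar>a l * p l t\<bar>)"
    "(\<lambda>i. \<Sum>l. weight \<sigma> l * \<bar>b i t l - a l * p l t\<bar>) \<longlonglongrightarrow> 0"
    "tendsto_in (Sobolev_norm \<sigma>) (\<lambda>i. zonal (b i t)) (zonal (\<lambda>l. a l * p l t)) sequentially"
    if "t \<in> space M" for t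
    using zonal_tendsto[where F = sequentially and b = "\<lambda>i. b i t" and M = "\<lambda>l. 2 * h t * (weight \<sigma> l * \<bar>a l\<bar>)",
        OF b_lim[OF that] always_eventually summable_mult[OF a] sequentially_bot] b_bound[OF that] by blast+
  \<comment> \<open>a measurable majorant of the distance in the Sobolev norm\<close>
  define E where "E i t = (\<Sum>l. weight \<sigma> l * \<bar>b i t l - a l * p l t\<bar>)" for i t
  define K where "K = 3 * (\<Sum>l. weight \<sigma> l * \<bar>a l\<bar>)"
  have [measurable]: "(\<lambda>t. b i t l) \<in> borel_measurable M" for i l
    unfolding b_def by (cases "l < i") auto
  have E_meas [measurable]: "E i \<in> borel_measurable M" for i
    unfolding E_def[abs_def] by measurable
  have E_nonneg: "0 \<le> E i t" if "t \<in> space M" for i t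
    unfolding E_def by (intro suminf_nonneg Sobolev_norm_zonal_diff_le(1) b_sum tendsto(1) that) auto
  have E_le: "E i t \<le> K * h t" if t: "t \<in> space M" for i t
  proof -
    have "E i t \<le> (\<Sum>l. 3 * h t * (weight \<sigma> l * \<bar>a l\<bar>))"
      unfolding E_def
    proof (rule suminf_le)
      fix l
      have "weight \<sigma> l * \<bar>b i t l - a l * p l t\<bar> \<le> weight \<sigma> l * (\<bar>b i t l\<bar> + \<bar>a l * p l t\<bar>)"
        by (intro mult_left_mono) auto
      also have "\<dots> = weight \<sigma> l * \<bar>b i t l\<bar> + weight \<sigma> l * \<bar>a l\<bar> * \<bar>p l t\<bar>"
        by (simp add: distrib_left abs_mult mult.assoc)
      also have "\<dots> \<le> 2 * h t * (weight \<sigma> l * \<bar>a l\<bar>) + weight \<sigma> l * \<bar>a l\<bar> * h t"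
        by (intro add_mono b_bound mult_left_mono le t) auto
      finally show "weight \<sigma> l * \<bar>b i t l - a l * p l t\<bar> \<le> 3 * h t * (weight \<sigma> l * \<bar>a l\<bar>)"
        by (simp add: algebra_simps)
      show "summable (\<lambda>l. weight \<sigma> l * \<bar>b i t l - a l * p l t\<bar>)"
        by (rule Sobolev_norm_zonal_diff_le(1)[OF b_sum tendsto(1)[OF t]])
      show "summable (\<lambda>l. 3 * h t * (weight \<sigma> l * \<bar>a l\<bar>))"
        using a by (rule summable_mult)
    qed
    also have "\<dots> = K * h t"
      using suminf_mult[OF a, of "3 * h t"] by (simp add: K_def)
    finally show ?thesis .
  qed
  have E_int: "integrable M (E i)" for i
  proof (rule Bochner_Integration.integrable_bound)
    show "integrable M (\<lambda>t. K * h t)" using h by simp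
    show "AE t in M. norm (E i t) \<le> norm (K * h t)"
    proof (rule AE_I2)
      fix t assume "t \<in> space M"
      then show "norm (E i t) \<le> norm (K * h t)"
        using E_le[of t i] E_nonneg[of t i] by simp
    qed
  qed (rule E_meas)
  have E_lim: "(\<lambda>i. \<integral>t. E i t \<partial>M) \<longlonglongrightarrow> (\<integral>t. 0 \<partial>M)"
  proof (rule integral_dominated_convergence[where w = "\<lambda>t. K * h t"])
    show "AE t in M. (\<lambda>i. E i t) \<longlonglongrightarrow> 0"
      unfolding E_def by (intro AE_I2 tendsto(2))
    show "AE t in M. norm (E i t) \<le> K * h t" for i
      using E_le E_nonneg by (intro AE_I2) simp
  qed (use h E_meas in auto)
  show ?thesis
    unfolding has_bochner_integral_in_def
  proof (intro conjI ballI exI[of _ \<rho>] allI)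
    have I_le: "\<bar>I l\<bar> \<le> (\<integral>t. h t \<partial>M)" for l
    proof -
      have "\<bar>I l\<bar> \<le> (\<integral>t. \<bar>p l t\<bar> \<partial>M)" unfolding I using integral_norm_bound[of M "p l"] by simp
      also have "\<dots> \<le> (\<integral>t. h t \<partial>M)"
        using p_int h le by (intro integral_mono) auto
      finally show ?thesis .
    qed
    have SI_le: "\<bar>integral\<^sup>L M (S l i)\<bar> \<le> 2 * (\<integral>t. h t \<partial>M)" for l i
    proof -
      have "\<bar>integral\<^sup>L M (S l i)\<bar> \<le> (\<integral>t. \<bar>S l i t\<bar> \<partial>M)" using integral_norm_bound[of M "S l i"] by simp
      also have "\<dots> \<le> (\<integral>t. 2 * h t \<partial>M)"
        using S_int h S_le by (intro integral_mono) auto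
      finally show ?thesis by simp
    qed
    have int_h: "0 \<le> (\<integral>t. h t \<partial>M)" using h_nonneg by (intro integral_nonneg_AE AE_I2)
    define B where "B i l = (if l < i then a l * integral\<^sup>L M (S l i) else 0)" for i l
    have \<rho>_integral: "Bochner_Integration.simple_bochner_integrable M (\<rho> i)"
      "Bochner_Integration.simple_bochner_integral M (\<rho> i) = zonal (B i)" for i
      using simple_bochner_sum[of M "\<lambda>l. S l i" a "\<lambda>l. sph_harm_L2 l 0" i, OF S_sbi]
      unfolding \<rho>_def[abs_def] B_def zonal_truncated by auto
    have B_lim: "(\<lambda>i. B i l) \<longlonglongrightarrow> a l * I l" for l
    proof (rule Lim_transform_eventually)
      have "(\<lambda>i. integral\<^sup>L M (S l i)) \<longlonglongrightarrow> integral\<^sup>L M (p l)"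
        by (rule integral_dominated_convergence[where w = "\<lambda>t. 2 * h t"])
           (use h S_lim S_le in \<open>auto intro!: AE_I2\<close>)
      then show "(\<lambda>i. a l * integral\<^sup>L M (S l i)) \<longlonglongrightarrow> a l * I l"
        unfolding I by (rule tendsto_mult_left)
      show "eventually (\<lambda>i. a l * integral\<^sup>L M (S l i) = B i l) sequentially"
        using eventually_gt_at_top[of l] by (rule eventually_mono) (simp add: B_def)
    qed
    have B_bound: "weight \<sigma> l * \<bar>B i l\<bar> \<le> 2 * (\<integral>t. h t \<partial>M) * (weight \<sigma> l * \<bar>a l\<bar>)" for i l
    proof -
      have "\<bar>B i l\<bar> \<le> \<bar>a l\<bar> * (2 * (\<integral>t. h t \<partial>M))"
        using SI_le[of l i] int_h by (auto simp: B_def abs_mult intro!: mult_left_mono)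
      then have "weight \<sigma> l * \<bar>B i l\<bar> \<le> weight \<sigma> l * (\<bar>a l\<bar> * (2 * (\<integral>t. h t \<partial>M)))"
        by (intro mult_left_mono) auto
      then show ?thesis by (simp only: mult_ac)
    qed
    have B_tendsto: "summable (\<lambda>l. weight \<sigma> l * \<bar>a l * I l\<bar>)"
      "tendsto_in (Sobolev_norm \<sigma>) (\<lambda>i. zonal (B i)) (zonal (\<lambda>l. a l * I l)) sequentially"
      using zonal_tendsto[where F = sequentially and b = B and M = "\<lambda>l. 2 * (\<integral>t. h t \<partial>M) * (weight \<sigma> l * \<bar>a l\<bar>)",
        OF B_lim always_eventually summable_mult[OF a] sequentially_bot] B_bound by blast+
    show "zonal (\<lambda>l. a l * I l) \<in> Sobolev \<sigma>"
      by (rule zonal_Sobolev(1)[OF B_tendsto(1)])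
    show "tendsto_in (Sobolev_norm \<sigma>) (\<lambda>i. Bochner_Integration.simple_bochner_integral M (\<rho> i)) (zonal (\<lambda>l. a l * I l)) sequentially"
      unfolding \<rho>_integral(2) by (rule B_tendsto(2))
    show "Bochner_Integration.simple_bochner_integrable M (\<rho> i)" for i by (rule \<rho>_integral(1))
    show "f t \<in> Sobolev \<sigma>" if "t \<in> space M" for t
      unfolding f[OF that] by (rule zonal_Sobolev(1)[OF tendsto(1)[OF that]])
    show "\<rho> i t \<in> Sobolev \<sigma>" for i t
      unfolding \<rho>_eq by (rule zonal_Sobolev(1)[OF b_sum])
    show "AE t in M. tendsto_in (Sobolev_norm \<sigma>) (\<lambda>i. \<rho> i t) (f t) sequentially"
    proof (rule AE_I2)
      fix t assume t: "t \<in> space M"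
      show "tendsto_in (Sobolev_norm \<sigma>) (\<lambda>i. \<rho> i t) (f t) sequentially"
        unfolding \<rho>_eq f[OF t] by (rule tendsto(3)[OF t])
    qed
    show "(\<lambda>i. \<integral>\<^sup>+t. ennreal (Sobolev_norm \<sigma> (f t - \<rho> i t)) \<partial>M) \<longlonglongrightarrow> 0"
    proof (rule tendsto_sandwich[of "\<lambda>_. 0" _ _ "\<lambda>i. ennreal (\<integral>t. E i t \<partial>M)"])
      show "\<forall>\<^sub>F i in sequentially. (\<integral>\<^sup>+t. ennreal (Sobolev_norm \<sigma> (f t - \<rho> i t)) \<partial>M) \<le> ennreal (\<integral>t. E i t \<partial>M)"
      proof (intro always_eventually allI)
        fix i
        have "(\<integral>\<^sup>+t. ennreal (Sobolev_norm \<sigma> (f t - \<rho> i t)) \<partial>M) \<le> (\<integral>\<^sup>+t. ennreal (E i t) \<partial>M)"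
        proof (intro nn_integral_mono ennreal_leI)
          fix t assume t: "t \<in> space M"
          show "Sobolev_norm \<sigma> (f t - \<rho> i t) \<le> E i t"
            unfolding f[OF t] \<rho>_eq E_def
            using Sobolev_norm_zonal_diff_le(3)[OF tendsto(1)[OF t] b_sum[of i t]] by (simp add: abs_minus_commute)
        qed
        also have "\<dots> = ennreal (\<integral>t. E i t \<partial>M)"
          by (intro nn_integral_eq_integral E_int AE_I2 E_nonneg)
        finally show "(\<integral>\<^sup>+t. ennreal (Sobolev_norm \<sigma> (f t - \<rho> i t)) \<partial>M) \<le> ennreal (\<integral>t. E i t \<partial>M)" .
      qed
      show "(\<lambda>i. ennreal (\<integral>t. E i t \<partial>M)) \<longlonglongrightarrow> 0"
        using tendsto_ennrealI[OF E_lim] by simp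
    qed auto
  qed
qed

section \<open>The solution with a sparse zonal datum\<close>

lemma DERIV_ml_2:
  assumes \<alpha>: "0 < \<alpha>" "\<alpha> < 1" and \<kappa>: "0 \<le> \<kappa>" and t: "0 < t"
  shows "(ml_kernel \<alpha> \<kappa> 2 has_field_derivative relax \<alpha> \<kappa> t) (at t)"
proof -
  have c: "continuous_on {0..b} (relax \<alpha> \<kappa>)" for b
    by (rule continuous_on_subset[OF continuous_on_relax[OF \<alpha> \<kappa>]]) auto
  have eq: "integral {0..r} (relax \<alpha> \<kappa>) = ml_kernel \<alpha> \<kappa> 2 r" if "0 < r" for r
  proof -
    have "integral\<^sup>L lborel (\<lambda>\<tau>. indicator {0..r} \<tau> * relax \<alpha> \<kappa> \<tau>) = ml_kernel \<alpha> \<kappa> 2 r"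
      using integral_relax[OF \<alpha> \<kappa> that] unfolding has_bochner_integral_restrict_iff
      by (rule has_bochner_integral_integral_eq)
    then show ?thesis
      using set_borel_integral_eq_integral(2)[OF borel_integrable_atLeastAtMost'[OF c], of r]
      by (simp add: set_lebesgue_integral_def)
  qed
  have "((\<lambda>u. integral {0..u} (relax \<alpha> \<kappa>)) has_vector_derivative relax \<alpha> \<kappa> t) (at t within {0..t + 1})"
    using t by (intro integral_has_vector_derivative c) auto
  then have "((\<lambda>u. integral {0..u} (relax \<alpha> \<kappa>)) has_field_derivative relax \<alpha> \<kappa> t) (at t)"
    using t at_within_interior[of t "{0..t + 1}"] by (simp add: has_real_derivative_iff_has_vector_derivative)
  then show ?thesis
    by (rule has_field_derivative_transform_within_open[of _ _ _ "{0<..}"]) (use t eq in auto)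
qed

text \<open>The sequence \<open>q\<close> lives on the powers of 2, with \<open>q (2\<^sup>k) = 1 / (k + 1)\<^sup>2\<close>.\<close>

lemma sparse_sequence_exists:
  "\<exists>q :: nat \<Rightarrow> real. (\<forall>l. 0 \<le> q l) \<and> summable q \<and> (\<forall>\<epsilon>>0. \<not> (\<lambda>l. real l powr \<epsilon> * q l) \<longlonglongrightarrow> 0)"
proof -
  define g :: "nat \<Rightarrow> nat" where "g k = 2 ^ k" for k
  have g: "strict_mono g" by (simp add: g_def strict_mono_def)
  then have inj: "inj g" by (rule strict_mono_imp_inj_on)
  define q where "q l = (if l \<in> range g then inverse (real (Suc (inv g l)) ^ 2) else 0)" for l
  have qg: "q (g k) = inverse (real (Suc k) ^ 2)" for k
    by (simp add: q_def inv_f_f[OF inj])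
  have "summable (\<lambda>k. inverse (real (Suc k) ^ 2))"
    using inverse_power_summable[of 2, where 'a = real] by (subst summable_Suc_iff) simp
  then have "summable (\<lambda>k. q (g k))" by (simp add: qg)
  then have "summable q"
    by (subst (asm) summable_mono_reindex[OF g]) (auto simp: q_def)
  moreover have "\<not> (\<lambda>l. real l powr \<epsilon> * q l) \<longlonglongrightarrow> 0" if \<epsilon>: "0 < \<epsilon>" for \<epsilon>
  proof
    assume "(\<lambda>l. real l powr \<epsilon> * q l) \<longlonglongrightarrow> 0"
    then have "(\<lambda>k. real (g k) powr \<epsilon> * q (g k)) \<longlonglongrightarrow> 0"
      by (rule LIMSEQ_subseq_LIMSEQ[OF _ g, unfolded o_def])
    moreover have "real (g k) powr \<epsilon> * q (g k) = 2 powr (\<epsilon> * real k) / (real k + 1) ^ 2" for k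
    proof -
      have "real (g k) = 2 powr real k" by (simp add: g_def powr_realpow)
      then have "real (g k) powr \<epsilon> = 2 powr (\<epsilon> * real k)" by (simp add: powr_powr mult.commute)
      then show ?thesis by (simp add: qg divide_inverse add.commute)
    qed
    ultimately have "(\<lambda>k. 2 powr (\<epsilon> * real k) / (real k + 1) ^ 2) \<longlonglongrightarrow> 0" by simp
    moreover have "filterlim (\<lambda>k::nat. 2 powr (\<epsilon> * real k) / (real k + 1) ^ 2) at_top sequentially"
      using \<epsilon> by real_asymp
    ultimately show False
      using not_tendsto_and_filterlim_at_infinity[OF sequentially_bot] filterlim_at_top_imp_at_infinity by metis
  qed
  ultimately show ?thesis by (intro exI[of _ q]) (auto simp: q_def)
qed

context
  fixes \<alpha> s :: real and q :: "nat \<Rightarrow> real"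
  assumes \<alpha>: "0 < \<alpha>" "\<alpha> < 1" and s: "s > 1"
    and q: "\<And>l. 0 \<le> q l" "summable q"
begin

definition eigen :: "nat \<Rightarrow> real" where
  "eigen l = real (l * (l + 1))"

text \<open>With these coefficients the datum is in \<open>H\<^sup>s\<close> because \<open>q\<close> is summable, and barely so because
  \<open>q\<close> is sparse.\<close>

definition amp :: "nat \<Rightarrow> real" where
  "amp l = real l powr (- s) * q l"

abbreviation mode :: "nat \<Rightarrow> real \<Rightarrow> real" where
  "mode l \<equiv> relax \<alpha> (eigen l)"

abbreviation mode_integral :: "nat \<Rightarrow> real \<Rightarrow> real" where
  "mode_integral l \<equiv> ml_kernel \<alpha> (eigen l) 2"

definition sol :: "real \<Rightarrow> sphere_L2" where
  "sol t = zonal (\<lambda>l. amp l * mode l t)"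

abbreviation sol_deriv :: "real \<Rightarrow> sphere_L2" where
  "sol_deriv t \<equiv> zonal (\<lambda>l. - (eigen l * (amp l * mode l t)))"

lemma eigen_nonneg: "0 \<le> eigen l" by (simp add: eigen_def)

lemma amp_nonneg: "0 \<le> amp l" using q by (simp add: amp_def)

lemma weight_amp_le: "weight s l * amp l \<le> 2 * q l"
proof (cases "l = 0")
  case False
  then have "real l powr (- s) \<le> real l powr 0" using s by (intro powr_mono) auto
  moreover have "real l powr s * real l powr (- s) = 1" using False by (simp flip: powr_add)
  ultimately have "weight s l * real l powr (- s) \<le> 2"
    using False by (simp add: weight_def distrib_right)
  then have "weight s l * real l powr (- s) * q l \<le> 2 * q l"
    using q(1) by (rule mult_right_mono)
  then show ?thesis by (simp add: amp_def mult.assoc)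
qed (use q in \<open>simp add: amp_def\<close>)

lemma weight_2_amp_le: "weight (s + 2) l * amp l \<le> 2 * q l * eigen l"
proof (cases "l = 0")
  case False
  then have l: "1 \<le> real l" by simp
  have 1: "real l powr (- s) \<le> real l powr 0" using s l by (intro powr_mono) auto
  have 2: "real l powr (s + 2) * real l powr (- s) = real l * real l"
    using False by (simp flip: powr_add add: power2_eq_square)
  have 3: "1 \<le> real l * real l" using mult_mono[OF l l] by simp
  have "weight (s + 2) l * real l powr (- s) = real l powr (- s) + real l powr (s + 2) * real l powr (- s)"
    by (simp add: weight_def distrib_right)
  also have "\<dots> \<le> 1 + real l * real l" using 1 2 False by simp
  also have "\<dots> \<le> 2 * eigen l" using 3 by (simp add: eigen_def algebra_simps)
  finally have "weight (s + 2) l * real l powr (- s) * q l \<le> 2 * eigen l * q l"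
    using q(1) by (rule mult_right_mono)
  then show ?thesis by (simp add: amp_def mult_ac)
qed (simp add: amp_def eigen_def)

lemma relax_bounds:
  assumes "0 \<le> t"
  shows "0 \<le> mode l t" "mode l t \<le> 1"
  using relax_nonneg[OF \<alpha> eigen_nonneg assms] relax_le_1[OF \<alpha> eigen_nonneg assms] by auto

text \<open>A bound for \<open>eigen l * mode l t\<close> that is uniform in \<open>l\<close> and in \<open>t \<ge> T\<close> (lemma
  \<open>eigen_relax_le\<close>).\<close>

definition decay :: "real \<Rightarrow> real" where "decay T = T powr (- \<alpha>) / Gamma (2 - \<alpha>)"

lemma eigen_relax_le:
  assumes "0 < T" "T \<le> t"
  shows "eigen l * mode l t \<le> decay T"
proof -
  have "eigen l * mode l t \<le> t powr (- \<alpha>) / Gamma (2 - \<alpha>)"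
    using assms by (intro relax_upper[OF \<alpha> eigen_nonneg]) auto
  also have "\<dots> \<le> decay T"
    unfolding decay_def using assms \<alpha> by (intro divide_right_mono powr_mono2') (auto simp: less_imp_le)
  finally show ?thesis .
qed

lemma weight_amp_relax_le:
  "0 \<le> t \<Longrightarrow> weight s l * \<bar>amp l * mode l t\<bar> \<le> 2 * q l"
proof -
  assume t: "0 \<le> t"
  have "weight s l * \<bar>amp l * mode l t\<bar> = weight s l * amp l * mode l t"
    using relax_bounds[OF t] amp_nonneg by (simp add: abs_mult)
  also have "\<dots> \<le> weight s l * amp l * 1"
    using relax_bounds[OF t] amp_nonneg by (intro mult_left_mono) auto
  also have "\<dots> \<le> 2 * q l" using weight_amp_le[of l] by simp
  finally show ?thesis .
qed

text \<open>Two more derivatives cost a factor \<open>eigen l\<close>, which the decay of the modes compensates; this is the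
  smoothing by two orders.\<close>

lemma weight_2_amp_relax_le:
  assumes "0 < T" "T \<le> t"
  shows "weight (s + 2) l * \<bar>amp l * mode l t\<bar> \<le> 2 * decay T * q l"
proof -
  have t: "0 \<le> t" using assms by simp
  have "weight (s + 2) l * \<bar>amp l * mode l t\<bar> = weight (s + 2) l * amp l * mode l t"
    using relax_bounds[OF t] amp_nonneg by (simp add: abs_mult)
  also have "\<dots> \<le> 2 * q l * eigen l * mode l t"
    by (intro mult_right_mono weight_2_amp_le relax_bounds t)
  also have "\<dots> = 2 * q l * (eigen l * mode l t)" by simp
  also have "\<dots> \<le> 2 * q l * decay T"
    using q by (intro mult_left_mono eigen_relax_le assms) auto
  finally show ?thesis by (simp add: mult_ac)
qed

lemma weight_eigen_amp_le:
  assumes "\<bar>eigen l * y\<bar> \<le> C"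
  shows "weight s l * \<bar>- (eigen l * (amp l * y))\<bar> \<le> 2 * C * q l"
proof -
  have "weight s l * \<bar>- (eigen l * (amp l * y))\<bar> = weight s l * amp l * \<bar>eigen l * y\<bar>"
    using amp_nonneg by (simp add: abs_mult mult_ac)
  also have "\<dots> \<le> 2 * q l * C"
    by (rule mult_mono[OF weight_amp_le assms]) (use q in auto)
  finally show ?thesis by (simp add: mult_ac)
qed

lemma relax_tendsto:
  assumes "t \<in> I" "I \<subseteq> {0..}"
  shows "((\<lambda>\<tau>. mode l \<tau>) \<longlongrightarrow> mode l t) (at t within I)"
proof -
  have "continuous_on I (mode l)"
    by (rule continuous_on_subset[OF continuous_on_relax[OF \<alpha> eigen_nonneg] assms(2)])
  then show ?thesis using assms(1) by (simp add: continuous_on_def)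
qed

lemma sol_0: "sol 0 = zonal amp"
  by (simp add: sol_def relax_def)

lemma summable_weight_amp: "summable (\<lambda>l. weight s l * \<bar>amp l\<bar>)"
  by (rule summable_comparison_test'[OF summable_mult[OF q(2), of 2], of 0])
     (use weight_amp_le amp_nonneg in auto)

lemma summable_amp_relax: "0 \<le> t \<Longrightarrow> summable (\<lambda>l. weight s l * \<bar>amp l * mode l t\<bar>)"
  by (rule summable_comparison_test'[OF summable_mult[OF q(2), of 2], of 0])
     (use weight_amp_relax_le in auto)

lemma sol_in_Sobolev: "0 \<le> t \<Longrightarrow> sol t \<in> Sobolev s"
  unfolding sol_def by (intro zonal_Sobolev(1) summable_amp_relax)

lemma sol_tendsto:
  assumes t: "t \<in> I" "I \<subseteq> {0..}" and F: "at t within I \<noteq> bot"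
  shows "tendsto_in (Sobolev_norm s) sol (sol t) (at t within I)"
  unfolding sol_def
proof (rule zonal_tendsto(3)[OF _ _ summable_mult[OF q(2), of 2] F])
  show "((\<lambda>\<tau>. amp l * mode l \<tau>) \<longlongrightarrow> amp l * mode l t) (at t within I)" for l
    by (intro tendsto_mult_left relax_tendsto t)
  show "eventually (\<lambda>\<tau>. \<forall>l. weight s l * \<bar>amp l * mode l \<tau>\<bar> \<le> 2 * q l) (at t within I)"
    unfolding eventually_at_filter
  proof (intro always_eventually allI impI)
    fix \<tau> l assume "\<tau> \<in> I"
    then have "0 \<le> \<tau>" using t(2) by auto
    then show "weight s l * \<bar>amp l * mode l \<tau>\<bar> \<le> 2 * q l"
      by (rule weight_amp_relax_le)
  qed
qed

lemma eventually_ge_half: "0 < t \<Longrightarrow> eventually (\<lambda>\<tau>. t / 2 \<le> \<tau>) (at t within I)" for t :: real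
  unfolding eventually_at by (intro exI[of _ "t / 2"]) (auto simp: dist_real_def abs_if split: if_splits)

lemma at_within_Ici_neq_bot: "0 \<le> t \<Longrightarrow> at t within {0..} \<noteq> bot" for t :: real
proof
  assume "0 \<le> t" "at t within {0..} = bot"
  moreover from \<open>0 \<le> t\<close> have "at_right t \<le> at t within {0..}" by (intro at_le) auto
  ultimately have "at_right t \<le> bot" by simp
  then have "at_right t = bot" by (rule le_bot)
  with trivial_limit_at_right_real[of t] show False by contradiction
qed

lemma sol_continuous: "continuous_into (Sobolev s) (Sobolev_norm s) {0..} sol"
  unfolding continuous_into_def
proof
  fix t :: real assume t: "t \<in> {0..}"
  have "at t within {0..} \<noteq> bot"
    using t by (intro at_within_Ici_neq_bot) simp
  then show "sol t \<in> Sobolev s \<and> tendsto_in (Sobolev_norm s) sol (sol t) (at t within {0..})"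
    using t by (intro conjI sol_in_Sobolev sol_tendsto) auto
qed

lemma sol_continuous_2: "continuous_into (Sobolev (s + 2)) (Sobolev_norm (s + 2)) {0<..} sol"
  unfolding continuous_into_def
proof
  fix t :: real assume t: "t \<in> {0<..}"
  then have F: "at t within {0<..} \<noteq> bot" using at_within_open[of t "{0<..}"] by simp
  have "tendsto_in (Sobolev_norm (s + 2)) sol (sol t) (at t within {0<..})"
    unfolding sol_def
  proof (rule zonal_tendsto(3)[OF _ _ summable_mult[OF q(2), of "2 * decay (t / 2)"] F])
    show "((\<lambda>\<tau>. amp l * mode l \<tau>) \<longlongrightarrow> amp l * mode l t) (at t within {0<..})" for l
      using t by (intro tendsto_mult_left relax_tendsto) auto
    show "eventually (\<lambda>\<tau>. \<forall>l. weight (s + 2) l * \<bar>amp l * mode l \<tau>\<bar> \<le> 2 * decay (t / 2) * q l) (at t within {0<..})"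
    proof (rule eventually_mono[OF eventually_ge_half])
      show "0 < t" using t by simp
      show "\<forall>l. weight (s + 2) l * \<bar>amp l * mode l \<tau>\<bar> \<le> 2 * decay (t / 2) * q l" if "t / 2 \<le> \<tau>" for \<tau>
        using t that by (intro allI weight_2_amp_relax_le) auto
    qed
  qed
  moreover have "summable (\<lambda>l. weight (s + 2) l * \<bar>amp l * mode l t\<bar>)"
    by (rule summable_comparison_test'[OF summable_mult[OF q(2), of "2 * decay t"], of 0])
       (use t weight_2_amp_relax_le[of t t] in auto)
  ultimately show "sol t \<in> Sobolev (s + 2) \<and> tendsto_in (Sobolev_norm (s + 2)) sol (sol t) (at t within {0<..})"
    unfolding sol_def by (intro conjI zonal_Sobolev(1))
qed

lemma G_op_sol: "0 \<le> t \<Longrightarrow> G_op \<mu> (sol t) = sol_deriv t"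
  unfolding sol_def using G_op_zonal[OF summable_weight_imp[OF summable_amp_relax[of t]]]
  by (simp only: eigen_def)

lemma eigen_relax_abs_le:
  assumes "0 < T" "T \<le> t"
  shows "\<bar>eigen l * mode l t\<bar> \<le> decay T"
  using eigen_relax_le[OF assms] relax_bounds[of t l] eigen_nonneg[of l] assms by simp

lemma G_op_sol_continuous: "continuous_into (Sobolev s) (Sobolev_norm s) {0<..} sol_deriv"
  unfolding continuous_into_def
proof
  fix t :: real assume t: "t \<in> {0<..}"
  then have F: "at t within {0<..} \<noteq> bot" using at_within_open[of t "{0<..}"] by simp
  have lim: "((\<lambda>\<tau>. - (eigen l * (amp l * mode l \<tau>))) \<longlongrightarrow> - (eigen l * (amp l * mode l t))) (at t within {0<..})" for l
    using t by (intro tendsto_minus tendsto_mult_left relax_tendsto) auto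
  have bd: "eventually (\<lambda>\<tau>. \<forall>l. weight s l * \<bar>- (eigen l * (amp l * mode l \<tau>))\<bar> \<le> 2 * decay (t / 2) * q l) (at t within {0<..})"
  proof (rule eventually_mono[OF eventually_ge_half])
    show "0 < t" using t by simp
    show "\<forall>l. weight s l * \<bar>- (eigen l * (amp l * mode l \<tau>))\<bar> \<le> 2 * decay (t / 2) * q l" if "t / 2 \<le> \<tau>" for \<tau>
      using t that by (intro allI weight_eigen_amp_le eigen_relax_abs_le) auto
  qed
  note z = zonal_tendsto[OF lim bd summable_mult[OF q(2)] F]
  show "sol_deriv t \<in> Sobolev s \<and>
    tendsto_in (Sobolev_norm s) sol_deriv (sol_deriv t) (at t within {0<..})"
    using zonal_Sobolev(1)[OF z(1)] z(3) by blast
qed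

lemma sol_bochner:
  assumes r: "0 < r"
  shows "has_bochner_integral_in (Sobolev s) (Sobolev_norm s) (restrict_space lborel {0..r})
    (\<lambda>\<tau>. levy_tail \<alpha> (r - \<tau>) *\<^sub>R (sol \<tau> - zonal amp)) (zonal (\<lambda>l. amp l * (- eigen l * mode_integral l r)))"
proof (rule zonal_bochner_integral[where h = "\<lambda>\<tau>. riesz (1 - \<alpha>) (r - \<tau>)"])
  show "has_bochner_integral (restrict_space lborel {0..r}) (\<lambda>\<tau>. riesz (1 - \<alpha>) (r - \<tau>) * (mode l \<tau> - 1)) (- eigen l * mode_integral l r)" for l
    by (rule relax_fractional_equation[OF \<alpha> eigen_nonneg r])
  show "integrable (restrict_space lborel {0..r}) (\<lambda>\<tau>. riesz (1 - \<alpha>) (r - \<tau>))"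
    using integral_riesz[of "1 - \<alpha>" r] \<alpha> r by (simp add: has_bochner_integral_iff)
  show "summable (\<lambda>l. weight s l * \<bar>amp l\<bar>)" by (rule summable_weight_amp)
next
  fix \<tau> assume "\<tau> \<in> space (restrict_space lborel {0..r})"
  then have \<tau>: "0 \<le> \<tau>" by (simp add: space_restrict_space)
  have "\<bar>mode l \<tau> - 1\<bar> \<le> 1" for l using relax_bounds[OF \<tau>, of l] by linarith
  then show "\<bar>riesz (1 - \<alpha>) (r - \<tau>) * (mode l \<tau> - 1)\<bar> \<le> riesz (1 - \<alpha>) (r - \<tau>)" for l
    using \<alpha> by (simp add: abs_mult riesz_nonneg mult_right_le_one_le)
  have 1: "summable (\<lambda>l. \<bar>amp l * mode l \<tau>\<bar>)"
    by (rule summable_weight_imp[OF summable_amp_relax[OF \<tau>]])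
  have 2: "summable (\<lambda>l. \<bar>amp l\<bar>)" by (rule summable_weight_imp[OF summable_weight_amp])
  have d: "sol \<tau> - zonal amp = zonal (\<lambda>l. amp l * mode l \<tau> - amp l)"
    unfolding sol_def by (rule zonal_diff[OF 1 2])
  have "summable (\<lambda>l. weight s l * \<bar>amp l * mode l \<tau> - amp l\<bar>)"
    by (rule Sobolev_norm_zonal_diff_le(1)[OF summable_amp_relax[OF \<tau>] summable_weight_amp])
  then show "levy_tail \<alpha> (r - \<tau>) *\<^sub>R (sol \<tau> - zonal amp) = zonal (\<lambda>l. amp l * (riesz (1 - \<alpha>) (r - \<tau>) * (mode l \<tau> - 1)))"
    unfolding d levy_tail_eq_riesz by (subst zonal_scaleR[OF summable_weight_imp]) (auto simp: algebra_simps)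
qed

text \<open>By the mean value theorem the quotient is a value of the mode at a time that is at least
  \<open>t / 2\<close>, where the uniform decay bound applies.\<close>

lemma difference_quotient_le:
  assumes t: "0 < t" and h: "h \<noteq> 0" "\<bar>h\<bar> < t / 2"
  shows "\<bar>eigen l * ((mode_integral l (t + h) - mode_integral l t) / h)\<bar> \<le> decay (t / 2)"
proof -
  have "\<exists>z\<ge>t / 2. (mode_integral l (t + h) - mode_integral l t) / h = mode l z"
  proof (cases "0 < h")
    case True
    have "\<exists>z. t < z \<and> z < t + h \<and> mode_integral l (t + h) - mode_integral l t = (t + h - t) * mode l z"
      using t True by (intro MVT2 DERIV_ml_2[OF \<alpha> eigen_nonneg]) auto
    then obtain z where "t < z" "mode_integral l (t + h) - mode_integral l t = h * mode l z"
      by auto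
    then show ?thesis using True t by (intro exI[of _ z]) auto
  next
    case False
    have "\<exists>z. t + h < z \<and> z < t \<and> mode_integral l t - mode_integral l (t + h) = (t - (t + h)) * mode l z"
      using t False h by (intro MVT2 DERIV_ml_2[OF \<alpha> eigen_nonneg]) auto
    then obtain z where z: "t + h < z" "mode_integral l t - mode_integral l (t + h) = - h * mode l z"
      by auto
    then have "mode_integral l (t + h) - mode_integral l t = h * mode l z" by simp
    then have "(mode_integral l (t + h) - mode_integral l t) / h = mode l z"
      using h by simp
    moreover have "t / 2 \<le> z" using z(1) h False by simp
    ultimately show ?thesis by blast
  qed
  then obtain z where z: "t / 2 \<le> z" "(mode_integral l (t + h) - mode_integral l t) / h = mode l z"
    by blast
  show ?thesis unfolding z(2) using t by (intro eigen_relax_abs_le z(1)) simp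
qed

text \<open>The convolution integral is the zonal series with coefficients \<open>- eigen l * amp l * mode_integral l r\<close>, and its
  difference quotients converge termwise with a summable bound.\<close>

lemma sol_nonlocal_derivative:
  assumes t: "0 < t"
  shows "has_nonlocal_derivative_in (Sobolev s) (Sobolev_norm s) (levy_tail \<alpha>) sol
    (sol_deriv t) t"
proof -
  define J where "J r = zonal (\<lambda>l. amp l * (- eigen l * mode_integral l r))" for r
  define Q where "Q h l = - (eigen l * (amp l * ((mode_integral l (t + h) - mode_integral l t) / h)))" for h l
  have lim: "((\<lambda>h. Q h l) \<longlongrightarrow> - (eigen l * (amp l * mode l t))) (at 0)" for l
    unfolding Q_def using DERIV_ml_2[OF \<alpha> eigen_nonneg t]
    by (intro tendsto_minus tendsto_mult_left) (simp add: DERIV_def)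
  have near: "eventually (\<lambda>h. h \<noteq> 0 \<and> \<bar>h\<bar> < t / 2) (at 0)"
    unfolding eventually_at using t by (intro exI[of _ "t / 2"]) (auto simp: dist_real_def)
  have bd: "eventually (\<lambda>h. \<forall>l. weight s l * \<bar>Q h l\<bar> \<le> 2 * decay (t / 2) * q l) (at 0)"
    using near
  proof (rule eventually_mono)
    fix h assume "h \<noteq> 0 \<and> \<bar>h\<bar> < t / 2"
    then show "\<forall>l. weight s l * \<bar>Q h l\<bar> \<le> 2 * decay (t / 2) * q l"
      unfolding Q_def by (intro allI weight_eigen_amp_le difference_quotient_le t) auto
  qed
  note z = zonal_tendsto[OF lim bd summable_mult[OF q(2)] at_neq_bot]
  have J_sum: "summable (\<lambda>l. \<bar>amp l * (- eigen l * mode_integral l r)\<bar>)" if r: "0 < r" for r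
  proof -
    have "\<bar>- eigen l * mode_integral l r\<bar> \<le> riesz (1 + (1 - \<alpha>)) r" for l
      using ml_2_bounds[OF \<alpha> eigen_nonneg r, of l] by simp
    then have "\<bar>amp l * (- eigen l * mode_integral l r)\<bar> \<le> riesz (1 + (1 - \<alpha>)) r * \<bar>amp l\<bar>" for l
      unfolding abs_mult[of "amp l"] mult.commute[of _ "\<bar>amp l\<bar>"] by (rule mult_left_mono) simp
    then show ?thesis
      by (intro summable_comparison_test'[OF summable_mult[OF summable_weight_imp[OF summable_weight_amp]], of 0]) auto
  qed
  have quotient: "(J (t + h) - J t) /\<^sub>R h = zonal (Q h)" if h: "h \<noteq> 0 \<and> \<bar>h\<bar> < t / 2" for h
  proof -
    have th: "0 < t + h" using h t by linarith
    have d: "J (t + h) - J t = zonal (\<lambda>l. amp l * (- eigen l * mode_integral l (t + h)) - amp l * (- eigen l * mode_integral l t))"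
      unfolding J_def by (rule zonal_diff[OF J_sum[OF th] J_sum[OF t]])
    have "summable (\<lambda>l. \<bar>amp l * (- eigen l * mode_integral l (t + h)) - amp l * (- eigen l * mode_integral l t)\<bar>)"
      by (rule summable_comparison_test'[OF summable_add[OF J_sum[OF th] J_sum[OF t]], of 0]) simp
    from zonal_scaleR[OF this, of "inverse h"]
    show ?thesis unfolding d Q_def[abs_def] by (simp add: divide_inverse algebra_simps)
  qed
  have "tendsto_in (Sobolev_norm s) (\<lambda>h. (J (t + h) - J t) /\<^sub>R h) (sol_deriv t) (at 0)"
    unfolding tendsto_in_def
  proof (rule Lim_transform_eventually)
    show "((\<lambda>h. Sobolev_norm s (zonal (Q h) - sol_deriv t)) \<longlongrightarrow> 0) (at 0)"
      using z(3) by (simp add: tendsto_in_def)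
    show "eventually (\<lambda>h. Sobolev_norm s (zonal (Q h) - sol_deriv t) =
        Sobolev_norm s ((J (t + h) - J t) /\<^sub>R h - sol_deriv t)) (at 0)"
      using near
    proof (rule eventually_mono)
      fix h assume "h \<noteq> 0 \<and> \<bar>h\<bar> < t / 2"
      from quotient[OF this] show "Sobolev_norm s (zonal (Q h) - sol_deriv t) =
        Sobolev_norm s ((J (t + h) - J t) /\<^sub>R h - sol_deriv t)"
        by simp
    qed
  qed
  moreover have "zonal amp \<in> Sobolev s"
    by (rule zonal_Sobolev(1)[OF summable_weight_amp])
  moreover have "tendsto_in (Sobolev_norm s) sol (zonal amp) (at_right 0)"
    using tendsto_within_subset[OF sol_tendsto[of 0 "{0..}", unfolded tendsto_in_def sol_0], of "{0<..}"]
      at_within_Ici_neq_bot[of 0] by (simp add: tendsto_in_def subset_eq)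
  moreover have "\<forall>r>0. has_bochner_integral_in (Sobolev s) (Sobolev_norm s) (restrict_space lborel {0..r})
      (\<lambda>\<tau>. levy_tail \<alpha> (r - \<tau>) *\<^sub>R (sol \<tau> - zonal amp)) (J r)"
    unfolding J_def using sol_bochner by blast
  ultimately show ?thesis
    unfolding has_nonlocal_derivative_in_def using zonal_Sobolev(1)[OF z(1)] by blast
qed

lemma sol_solves: "solves_Cauchy_problem \<mu> \<alpha> s (zonal amp) sol"
  unfolding solves_Cauchy_problem_def
proof (intro conjI exI[of _ "\<lambda>t. sol_deriv t"] allI impI)
  show "sol_deriv t = G_op \<mu> (sol t)" if "0 < t" for t
    using that by (simp add: G_op_sol)
  show "has_nonlocal_derivative_in (Sobolev s) (Sobolev_norm s) (levy_tail \<alpha>) sol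
    (sol_deriv t) t" if "0 < t" for t
    using that by (rule sol_nonlocal_derivative)
qed (rule sol_continuous sol_continuous_2 G_op_sol_continuous sol_0)+

text \<open>If \<open>u(t)\<close> were that smooth, the terms \<open>l\<^sup>s\<^sup>+\<^sup>2\<^sup>+\<^sup>\<epsilon> a\<^sub>l y\<^sub>l(t)\<close> would tend to 0. By the lower bound for the
  modes they dominate a fixed multiple of \<open>l\<^sup>\<epsilon> q\<^sub>l\<close>.\<close>

lemma sol_not_in_Sobolev:
  assumes t: "0 < t" and notlim: "\<not> (\<lambda>l. real l powr \<epsilon> * q l) \<longlonglongrightarrow> 0"
  shows "sol t \<notin> Sobolev (s + 2 + \<epsilon>)"
proof
  assume "sol t \<in> Sobolev (s + 2 + \<epsilon>)"
  then have "(\<lambda>l. real l powr (2 * (s + 2 + \<epsilon>)) * ang_power (sol t) l) \<longlonglongrightarrow> 0"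
    unfolding Sobolev_def mem_Collect_eq by (rule summable_LIMSEQ_zero)
  moreover have "real l powr (2 * (s + 2 + \<epsilon>)) * ang_power (sol t) l = (real l powr (s + 2 + \<epsilon>) * (amp l * mode l t))\<^sup>2" for l
  proof -
    have "real l powr (2 * (s + 2 + \<epsilon>)) = (real l powr (s + 2 + \<epsilon>))\<^sup>2"
      using powr_add[of "real l" "s + 2 + \<epsilon>" "s + 2 + \<epsilon>"] unfolding power2_eq_square mult_2 by simp
    then show ?thesis
      using t unfolding sol_def by (simp add: ang_power_zonal[OF summable_weight_imp[OF summable_amp_relax]] power_mult_distrib)
  qed
  ultimately have "(\<lambda>l. (real l powr (s + 2 + \<epsilon>) * (amp l * mode l t))\<^sup>2) \<longlonglongrightarrow> 0" by simp
  then have "(\<lambda>l. sqrt ((real l powr (s + 2 + \<epsilon>) * (amp l * mode l t))\<^sup>2)) \<longlonglongrightarrow> sqrt 0"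
    by (rule tendsto_real_sqrt)
  then have lim: "(\<lambda>l. real l powr (s + 2 + \<epsilon>) * (amp l * mode l t)) \<longlonglongrightarrow> 0"
    using amp_nonneg relax_bounds t by simp
  define k where "k = riesz (1 - \<alpha>) t"
  have k: "0 < k" using \<alpha> t by (simp add: k_def riesz_pos)
  have le: "real l powr \<epsilon> * q l \<le> (2 + k) / k * (real l powr (s + 2 + \<epsilon>) * (amp l * mode l t))" for l
  proof (cases "l = 0")
    case False
    then have l: "1 \<le> real l" by simp
    have sq: "1 \<le> real l * real l" "real l \<le> real l * real l"
      using mult_mono[OF l l] mult_left_mono[OF l, of "real l"] by auto
    have nn: "0 \<le> mode l t" using t by (intro relax_bounds) auto
    have "eigen l + k \<le> (2 + k) * (real l * real l)"
    proof -
      have "k * 1 \<le> k * (real l * real l)" using k sq by (intro mult_left_mono) auto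
      then show ?thesis using sq by (simp add: eigen_def algebra_simps)
    qed
    then have "(eigen l + k) * mode l t \<le> (2 + k) * (real l * real l) * mode l t"
      using nn by (rule mult_right_mono)
    moreover have "k \<le> (eigen l + k) * mode l t"
      unfolding k_def by (rule relax_lower[OF \<alpha> eigen_nonneg t])
    ultimately have "k \<le> (2 + k) * (real l * real l) * mode l t" by linarith
    then have "1 \<le> (2 + k) / k * (real l * real l * mode l t)"
      using k by (simp add: field_simps)
    then have "real l powr \<epsilon> * q l * 1 \<le> real l powr \<epsilon> * q l * ((2 + k) / k * (real l * real l * mode l t))"
      using q(1) by (intro mult_left_mono) auto
    also have "\<dots> = (2 + k) / k * (real l powr \<epsilon> * (real l * real l) * q l * mode l t)"
      by (simp only: mult_ac)
    also have "real l powr \<epsilon> * (real l * real l) * q l * mode l t = real l powr (s + 2 + \<epsilon>) * (amp l * mode l t)"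
    proof -
      have "real l powr (s + 2 + \<epsilon>) * real l powr (- s) = real l powr \<epsilon> * real l powr 2"
        unfolding powr_add[symmetric] by (simp add: add.commute)
      also have "real l powr 2 = real l * real l" using False by (simp add: power2_eq_square)
      finally show ?thesis by (simp add: amp_def mult_ac)
    qed
    finally show ?thesis by simp
  qed simp
  have "(\<lambda>l. real l powr \<epsilon> * q l) \<longlonglongrightarrow> 0"
  proof (rule Lim_null_comparison)
    show "eventually (\<lambda>l. norm (real l powr \<epsilon> * q l) \<le> (2 + k) / k * (real l powr (s + 2 + \<epsilon>) * (amp l * mode l t))) sequentially"
      using le q(1) by (intro always_eventually allI) simp
    show "(\<lambda>l. (2 + k) / k * (real l powr (s + 2 + \<epsilon>) * (amp l * mode l t))) \<longlonglongrightarrow> 0"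
      using tendsto_mult_right_zero[OF lim] .
  qed
  with notlim show False by contradiction
qed

end

theorem proposition3p3:
  fixes \<mu> \<alpha> s :: real
  assumes "0 < \<alpha>" and "\<alpha> < 1" and "s > 1"
  shows "\<exists>f\<in>Sobolev s. \<exists>u. is_strong_solution \<mu> \<alpha> s f u \<and>
           (\<forall>t>0. \<forall>\<epsilon>>0. u t \<notin> Sobolev (s + 2 + \<epsilon>))"
proof -
  obtain q :: "nat \<Rightarrow> real" where q: "\<And>l. 0 \<le> q l" "summable q"
    and sparse: "\<And>\<epsilon>. 0 < \<epsilon> \<Longrightarrow> \<not> (\<lambda>l. real l powr \<epsilon> * q l) \<longlonglongrightarrow> 0"
    using sparse_sequence_exists by blast
  show ?thesis
  proof (intro bexI[of _ "zonal (amp s q)"] exI[of _ "sol \<alpha> s q"] conjI allI impI)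
    show "is_strong_solution \<mu> \<alpha> s (zonal (amp s q)) (sol \<alpha> s q)"
      unfolding is_strong_solution_def
    proof (intro conjI allI impI)
      show "solves_Cauchy_problem \<mu> \<alpha> s (zonal (amp s q)) (sol \<alpha> s q)"
        by (rule sol_solves[OF assms q])
      then show "v t = sol \<alpha> s q t" if "solves_Cauchy_problem \<mu> \<alpha> s (zonal (amp s q)) v" "0 \<le> t" for v t
        using Cauchy_problem_unique[OF assms _ that] by simp
    qed
    show "sol \<alpha> s q t \<notin> Sobolev (s + 2 + \<epsilon>)" if "0 < t" "0 < \<epsilon>" for t \<epsilon>
      by (rule sol_not_in_Sobolev[OF assms q that(1) sparse[OF that(2)]])
    show "zonal (amp s q) \<in> Sobolev s"
      by (rule zonal_Sobolev(1)[OF summable_weight_amp[OF assms q]])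
  qed
qed

end
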